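(* Let $f\in Z^2(\operatorname{Der}_k(A),A)$, let $(\tilde L,\tilde\alpha,\tilde\pi,[,],D)$ be a $D$-Lie algebra (relative to $f$) with canonical quotient $(L,\pi_L)$, and let $(E,\rho)$ be an $\tilde L$-connection with $\rho(D)=\operatorname{Id}_E$. Then the canonical quotient of the $D$-Lie algebra $\operatorname{End}(\tilde L,E)$ is isomorphic to the $A/k$-Lie-Rinehart algebra $\operatorname{End}(L,E)$. If $L$ is projective as left $A$-module, there is an isomorphism of $D$-Lie algebras $\operatorname{End}(\tilde L,E)\cong\operatorname{End}(L(f^{\alpha}),E)$, where $\alpha:=\pi_L$ and $E$ is regarded as an $L(f^{\alpha})$-connection through an isomorphism $L(f^{\alpha})\cong\tilde L$ of $D$-Lie algebras.
   Context: $k$ is a commutative unital ring and $A$ a commutative unital $k$-algebra. $I$ is the kernel of the multiplication $A\otimes_k A\to A$ and $P:=A\otimes_k A/I^2$. A left $P$-module is a left $A\otimes_k A$-module annihilated by $I^2$; write $cu:=(c\otimes 1)u$, $uc:=(1\otimes c)u$ and $dc:=1\otimes c-c\otimes 1$, so $dc\cdot u=uc-cu$. $\operatorname{Der}_k(A)$ is a $P$-module with $xc:=cx$. An $A/k$-Lie-Rinehart algebra $(L,\alpha)$ is a $k$-Lie algebra and left $A$-module $L$ with an $A$-linear map of $k$-Lie algebras $\alpha:L\to\operatorname{Der}_k(A)$ such that $[x,ay]=a[x,y]+\alpha(x)(a)y$. $Z^2(L,A)$ is the group of 2-cocycles of the Lie-Rinehart complex $C^p(L,A)=\operatorname{Hom}_A(\wedge^p_A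 L,A)$; $\operatorname{Der}_k(A)$ is a Lie-Rinehart algebra with identity anchor. For $f\in Z^2(\operatorname{Der}_k(A),A)$ let $f^{\alpha}(x,y):=f(\alpha(x),\alpha(y))\in Z^2(L,A)$. $D^1(A,f):=A\oplus\operatorname{Der}_k(A)$ with $[(a,x),(b,y)]:=(x(b)-y(a)+f(x,y),[x,y])$, $c(a,x):=(ca,cx)$, $(a,x)c:=(ac+x(c),cx)$ and $\pi(a,x):=x$; it is a $k$-Lie algebra and left $P$-module. A $D$-Lie algebra (relative to $f$) is a 5-tuple $(\tilde L,\tilde\alpha,\tilde\pi,[,],D)$ where $\tilde L$ is a $k$-Lie algebra and left $P$-module, $\tilde\alpha:\tilde L\to D^1(A,f)$ and $\tilde\pi:\tilde L\to\operatorname{Der}_k(A)$ are maps of $P$-modules and $k$-Lie algebras with $\tilde\pi=\pi\circ\tilde\alpha$, $[u,av]=a[u,v]+\tilde\pi(u)(a)v$, $da\cdot u=\tilde\pi(u)(a)D$ for all $u,v\in\tilde L$, $a\in A$, and $D\in\tilde L$ is a central element with $\tilde\pi(D)=0$. A map of $D$-Lie algebras $\phi:\tilde L\to\tilde L'$ is a map of left $P$-modules and $k$-Lie algebras with $\phi(D)=D'$ and $\tilde\pi=\tilde\pi'\circ\phi$. The canonical quotient of $\tilde L$ is $L:=\tilde L/J$, $J:=\{aD:a\in A\}$, with anchor $\pi_L$ induced by $\tilde\pi$; it is an $A/k$-Lie-Rinehart algebra. $L(f^{\alpha}):=Az\oplus L$ is the $D$-Lie algebra with $[az+x,bz+y]:=(\alpha(x)(b)-\alpha(y)(a)+f^{\alpha}(x,y))z+[x,y]$,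 $c(az+x):=caz+cx$, $(az+x)c:=(ac+\alpha(x)(c))z+cx$, $\tilde\alpha(az+x):=(a,\alpha(x))\in D^1(A,f)$, $\tilde\pi(az+x):=\alpha(x)$ and central element $z$. For a left $A$-module $E$, $\operatorname{Diff}^1(E)$ is the set of $\partial\in\operatorname{End}_k(E)$ with $[[\partial,a],b]=0$ for all $a,b\in A$; it is a left $P$-module by $(a\otimes b\cdot\partial)(e):=a\partial(be)$. An $\tilde L$-connection is a pair $(E,\rho)$ with $\rho:\tilde L\to\operatorname{Diff}^1(E)$ a map of left $P$-modules; its curvature is $R_\rho(u,v):=[\rho(u),\rho(v)]-\rho([u,v])$. For an $\tilde L$-connection $(E,\rho)$ with $\rho(D)=\operatorname{Id}_E$, $\operatorname{End}(\tilde L,E):=\operatorname{End}_A(E)\oplus\tilde L$ is the $D$-Lie algebra with $c(\phi,u):=(c\phi,cu)$, $(\phi,u)c:=(\phi c,uc)$, $\alpha_E(\phi,u):=\tilde\alpha(u)$, $\pi_E(\phi,u):=\tilde\pi(u)$, central element $\tilde D:=(0,D)$ and bracket $[(\phi,u),(\psi,v)]:=([\phi,\psi]+[\rho(u),\psi]-[\rho(v),\phi]+R_\rho(u,v),[u,v])$. $\operatorname{End}(L,E)$ denotes the left $A$-module $\operatorname{End}_A(E)\oplus L$ with anchor $(\phi,\overline u)\mapsto\pi_L(\overline u)$ and bracket $[(\phi,\overline u),(\psi,\overline v)]:=([\phi,\psi]+[\rho(u),\psi]-[\rho(v),\phi]+R_\rho(u,v),[\overline u,\overline v])$, where $u,v\in\tilde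 L$ are any lifts of $\overline u,\overline v\in L$ (the expression does not depend on the lifts).
   Formalization: Existence of an isomorphism L(f^α) ≅ L̃ is claimed only if α̃(D) = (1,0); it fails otherwise (Heisenberg algebra over a field, α̃ = 0). The isomorphism of the two endomorphism D-Lie algebras is proved for every given isomorphism L(f^α) ≅ L̃, with no condition on α̃(D). *)

theory Defs
  imports
    "HOL-Algebra.Module" "HOL-Algebra.QuotRing" "HOL-Algebra.Ideal_Product"
    "HOL-Library.Poly_Mapping"
begin

text \<open>
  Throughout, \<open>k\<close> and \<open>A\<close> are related by the locale \<open>algebra k A\<close>. Every derivation, endomorphism
  and differential operator is an extensional function (\<open>undefined\<close> off the carrier), so that
  equality of functions is equality on the carrier. Records extending \<open>module\<close> inherit the ring
  fields \<open>mult\<close> and \<open>one\<close>; these carry no meaning for modules.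
\<close>


section \<open>The tensor product of \<open>A\<close> with itself and \<open>P\<close>-modules\<close>

text \<open>
  The tensor product \<open>A \<otimes>\<^sub>k A\<close> is the monoid ring over the integers of the multiplicative monoid
  \<open>A \<times> A\<close> modulo the bilinearity and \<open>k\<close>-balancing relations.
  The subgroup generated by the relations is already an ideal.
\<close>

definition pre_tensor_ring :: "('k, 'a) module \<Rightarrow> (('a \<times> 'a) \<Rightarrow>\<^sub>0 int) ring" where
  "pre_tensor_ring A =
    \<lparr>carrier = {t. Poly_Mapping.keys t \<subseteq> carrier A \<times> carrier A},
     mult = (\<lambda>s t. frag_extend (\<lambda>(a, b). frag_extend (\<lambda>(c, d).
        frag_of (a \<otimes>\<^bsub>A\<^esub> c, b \<otimes>\<^bsub>A\<^esub> d)) t) s),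
     one = frag_of (\<one>\<^bsub>A\<^esub>, \<one>\<^bsub>A\<^esub>),
     zero = 0,
     add = (+)\<rparr>"

definition tensor_relations :: "'k ring \<Rightarrow> ('k, 'a) module \<Rightarrow> (('a \<times> 'a) \<Rightarrow>\<^sub>0 int) set" where
  "tensor_relations k A =
     {frag_of (a \<oplus>\<^bsub>A\<^esub> a', b) - frag_of (a, b) - frag_of (a', b) | a a' b.
        a \<in> carrier A \<and> a' \<in> carrier A \<and> b \<in> carrier A} \<union>
     {frag_of (a, b \<oplus>\<^bsub>A\<^esub> b') - frag_of (a, b) - frag_of (a, b') | a b b'.
        a \<in> carrier A \<and> b \<in> carrier A \<and> b' \<in> carrier A} \<union>
     {frag_of (r \<odot>\<^bsub>A\<^esub> a, b) - frag_of (a, r \<odot>\<^bsub>A\<^esub> b) | r a b.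
        r \<in> carrier k \<and> a \<in> carrier A \<and> b \<in> carrier A}"

definition tensor_ideal :: "'k ring \<Rightarrow> ('k, 'a) module \<Rightarrow> (('a \<times> 'a) \<Rightarrow>\<^sub>0 int) set" where
  "tensor_ideal k A = Idl\<^bsub>pre_tensor_ring A\<^esub> (tensor_relations k A)"

definition tensor_ring :: "'k ring \<Rightarrow> ('k, 'a) module \<Rightarrow> (('a \<times> 'a) \<Rightarrow>\<^sub>0 int) set ring" where
  "tensor_ring k A = pre_tensor_ring A Quot tensor_ideal k A"

definition pure_tensor ::
    "'k ring \<Rightarrow> ('k, 'a) module \<Rightarrow> 'a \<Rightarrow> 'a \<Rightarrow> (('a \<times> 'a) \<Rightarrow>\<^sub>0 int) set" where
  "pure_tensor k A a b = tensor_ideal k A +>\<^bsub>pre_tensor_ring A\<^esub> frag_of (a, b)"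

text \<open>The multiplication \<open>a \<otimes> b \<mapsto> ab\<close>; it is constant on representatives, hence \<^const>\<open>the_elem\<close>.\<close>

definition tensor_mult_map :: "('k, 'a) module \<Rightarrow> (('a \<times> 'a) \<Rightarrow>\<^sub>0 int) set \<Rightarrow> 'a" where
  "tensor_mult_map A T = the_elem ((\<lambda>t. \<Oplus>\<^bsub>A\<^esub>p \<in> Poly_Mapping.keys t.
      add_pow A (Poly_Mapping.lookup t p) (fst p \<otimes>\<^bsub>A\<^esub> snd p)) ` T)"

definition diag_ideal :: "'k ring \<Rightarrow> ('k, 'a) module \<Rightarrow> (('a \<times> 'a) \<Rightarrow>\<^sub>0 int) set set" where
  "diag_ideal k A = a_kernel (tensor_ring k A) A (tensor_mult_map A)"

text \<open>
  A \<open>P\<close>-module is recorded through its two \<open>A\<close>-actions \<open>c u = (c \<otimes> 1) u\<close> (field \<open>smult\<close>) and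
  \<open>u c = (1 \<otimes> c) u\<close> (field \<open>rsmult\<close>). The predicate \<open>P_action\<close> says that \<open>act\<close> is the
  \<open>A \<otimes>\<^sub>k A\<close>-module structure with these two restrictions and that the square of the
  diagonal ideal annihilates the module; such an \<open>act\<close> is unique on the carriers.
\<close>

record ('a, 'b) bimodule = "('a, 'b) module" +
  rsmult :: "'b \<Rightarrow> 'a \<Rightarrow> 'b"

definition P_action ::
    "'k ring \<Rightarrow> ('k, 'a) module \<Rightarrow> ('a, 'b, 'm) bimodule_scheme
      \<Rightarrow> ((('a \<times> 'a) \<Rightarrow>\<^sub>0 int) set \<Rightarrow> 'b \<Rightarrow> 'b) \<Rightarrow> bool" where
  "P_action k A M act \<longleftrightarrow>
     module (tensor_ring k A)
       \<lparr>carrier = carrier M, mult = mult M, one = one M, zero = zero M, add = add M,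
        smult = act\<rparr> \<and>
     (\<forall>t \<in> diag_ideal k A \<cdot>\<^bsub>tensor_ring k A\<^esub> diag_ideal k A. \<forall>u \<in> carrier M. act t u = \<zero>\<^bsub>M\<^esub>) \<and>
     (\<forall>c \<in> carrier A. \<forall>u \<in> carrier M.
        act (pure_tensor k A c \<one>\<^bsub>A\<^esub>) u = c \<odot>\<^bsub>M\<^esub> u \<and>
        act (pure_tensor k A \<one>\<^bsub>A\<^esub> c) u = rsmult M u c)"

definition P_module :: "'k ring \<Rightarrow> ('k, 'a) module \<Rightarrow> ('a, 'b, 'm) bimodule_scheme \<Rightarrow> bool" where
  "P_module k A M \<longleftrightarrow> (\<exists>act. P_action k A M act)"

definition linear_map ::
    "('r, 'p) ring_scheme \<Rightarrow> ('r, 'b, 'm) module_scheme \<Rightarrow> ('r, 'c, 'n) module_scheme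
      \<Rightarrow> ('b \<Rightarrow> 'c) \<Rightarrow> bool" where
  "linear_map R M N h \<longleftrightarrow>
     h \<in> carrier M \<rightarrow> carrier N \<and>
     (\<forall>x \<in> carrier M. \<forall>y \<in> carrier M. h (x \<oplus>\<^bsub>M\<^esub> y) = h x \<oplus>\<^bsub>N\<^esub> h y) \<and>
     (\<forall>r \<in> carrier R. \<forall>x \<in> carrier M. h (r \<odot>\<^bsub>M\<^esub> x) = r \<odot>\<^bsub>N\<^esub> h x)"

definition P_linear_map ::
    "'k ring \<Rightarrow> ('k, 'a) module \<Rightarrow> ('a, 'b, 'm) bimodule_scheme \<Rightarrow> ('a, 'c, 'n) bimodule_scheme
      \<Rightarrow> ('b \<Rightarrow> 'c) \<Rightarrow> bool" where
  "P_linear_map k A M N h \<longleftrightarrow>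
     (\<exists>act act'. P_action k A M act \<and> P_action k A N act' \<and>
        h \<in> carrier M \<rightarrow> carrier N \<and>
        (\<forall>x \<in> carrier M. \<forall>y \<in> carrier M. h (x \<oplus>\<^bsub>M\<^esub> y) = h x \<oplus>\<^bsub>N\<^esub> h y) \<and>
        (\<forall>t \<in> carrier (tensor_ring k A). \<forall>x \<in> carrier M. h (act t x) = act' t (h x)))"


section \<open>Lie algebras and Lie-Rinehart algebras\<close>

definition restrict_scalars ::
    "('k, 'a) module \<Rightarrow> ('a, 'b, 'm) module_scheme \<Rightarrow> ('k, 'b) module" where
  "restrict_scalars A M =
     \<lparr>carrier = carrier M, mult = mult M, one = one M, zero = zero M, add = add M,
      smult = (\<lambda>r x. (r \<odot>\<^bsub>A\<^esub> \<one>\<^bsub>A\<^esub>) \<odot>\<^bsub>M\<^esub> x)\<rparr>"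

locale lie_algebra = module k V
  for k :: "'k ring" and V :: "('k, 'v) module" and br :: "'v \<Rightarrow> 'v \<Rightarrow> 'v" +
  assumes br_linear_right: "x \<in> carrier V \<Longrightarrow> linear_map k V V (br x)"
    and br_linear_left: "y \<in> carrier V \<Longrightarrow> linear_map k V V (\<lambda>x. br x y)"
    and br_alternating: "x \<in> carrier V \<Longrightarrow> br x x = \<zero>\<^bsub>V\<^esub>"
    and jacobi: "\<lbrakk>x \<in> carrier V; y \<in> carrier V; z \<in> carrier V\<rbrakk> \<Longrightarrow>
      br x (br y z) \<oplus>\<^bsub>V\<^esub> br y (br z x) \<oplus>\<^bsub>V\<^esub> br z (br x y) = \<zero>\<^bsub>V\<^esub>"

definition lie_hom ::
    "'k ring \<Rightarrow> ('k, 'v) module \<Rightarrow> ('v \<Rightarrow> 'v \<Rightarrow> 'v) \<Rightarrow> ('k, 'w) module \<Rightarrow> ('w \<Rightarrow> 'w \<Rightarrow> 'w)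
      \<Rightarrow> ('v \<Rightarrow> 'w) \<Rightarrow> bool" where
  "lie_hom k V br W br' h \<longleftrightarrow> linear_map k V W h \<and>
     (\<forall>x \<in> carrier V. \<forall>y \<in> carrier V. h (br x y) = br' (h x) (h y))"

record ('a, 'b) lie_bimodule = "('a, 'b) bimodule" +
  bracket :: "'b \<Rightarrow> 'b \<Rightarrow> 'b"

record ('a, 'b) lie_rinehart = "('a, 'b) module" +
  lr_bracket :: "'b \<Rightarrow> 'b \<Rightarrow> 'b"
  anchor :: "'b \<Rightarrow> 'a \<Rightarrow> 'a"

definition derivations :: "'k ring \<Rightarrow> ('k, 'a) module \<Rightarrow> ('a \<Rightarrow> 'a) set" where
  "derivations k A = {x \<in> carrier A \<rightarrow>\<^sub>E carrier A. linear_map k A A x \<and>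
     (\<forall>a \<in> carrier A. \<forall>b \<in> carrier A. x (a \<otimes>\<^bsub>A\<^esub> b) = (a \<otimes>\<^bsub>A\<^esub> x b) \<oplus>\<^bsub>A\<^esub> (x a \<otimes>\<^bsub>A\<^esub> b))}"

definition Der :: "'k ring \<Rightarrow> ('k, 'a) module \<Rightarrow> ('a, 'a \<Rightarrow> 'a) lie_bimodule" where
  "Der k A =
     \<lparr>carrier = derivations k A, mult = undefined, one = undefined,
      zero = (\<lambda>a \<in> carrier A. \<zero>\<^bsub>A\<^esub>),
      add = (\<lambda>x y. \<lambda>a \<in> carrier A. x a \<oplus>\<^bsub>A\<^esub> y a),
      smult = (\<lambda>c x. \<lambda>a \<in> carrier A. c \<otimes>\<^bsub>A\<^esub> x a),
      rsmult = (\<lambda>x c. \<lambda>a \<in> carrier A. c \<otimes>\<^bsub>A\<^esub> x a),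
      bracket = (\<lambda>x y. \<lambda>a \<in> carrier A. x (y a) \<ominus>\<^bsub>A\<^esub> y (x a))\<rparr>"

locale lie_rinehart_algebra = algebra k A + module A L +
    lie_algebra k "restrict_scalars A L" "lr_bracket L"
  for k :: "'k ring" and A :: "('k, 'a) module" and L :: "('a, 'b) lie_rinehart" +
  assumes anchor_linear: "linear_map A L (Der k A) (anchor L)"
    and anchor_lie_hom: "lie_hom k (restrict_scalars A L) (lr_bracket L)
          (restrict_scalars A (Der k A)) (bracket (Der k A)) (anchor L)"
    and leibniz: "\<lbrakk>a \<in> carrier A; x \<in> carrier L; y \<in> carrier L\<rbrakk> \<Longrightarrow>
          lr_bracket L x (a \<odot>\<^bsub>L\<^esub> y) = a \<odot>\<^bsub>L\<^esub> lr_bracket L x y \<oplus>\<^bsub>L\<^esub> anchor L x a \<odot>\<^bsub>L\<^esub> y"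

definition lie_rinehart_isomorphic ::
    "'k ring \<Rightarrow> ('k, 'a) module \<Rightarrow> ('a, 'b) lie_rinehart \<Rightarrow> ('a, 'c) lie_rinehart \<Rightarrow> bool" where
  "lie_rinehart_isomorphic k A L L' \<longleftrightarrow>
     lie_rinehart_algebra k A L \<and> lie_rinehart_algebra k A L' \<and>
     (\<exists>h. bij_betw h (carrier L) (carrier L') \<and> linear_map A L L' h \<and>
        lie_hom k (restrict_scalars A L) (lr_bracket L)
          (restrict_scalars A L') (lr_bracket L') h \<and>
        (\<forall>x \<in> carrier L. anchor L' (h x) = anchor L x))"

definition Der_lie_rinehart :: "'k ring \<Rightarrow> ('k, 'a) module \<Rightarrow> ('a, 'a \<Rightarrow> 'a) lie_rinehart" where
  "Der_lie_rinehart k A =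
     \<lparr>carrier = carrier (Der k A), mult = mult (Der k A), one = one (Der k A),
      zero = zero (Der k A), add = add (Der k A), smult = smult (Der k A),
      lr_bracket = bracket (Der k A), anchor = (\<lambda>x. x)\<rparr>"

text \<open>
  2-cochains, i.e. \<open>A\<close>-linear maps on the exterior square of \<open>L\<close>, are alternating \<open>A\<close>-bilinear
  maps; the last conjunct is the vanishing of the Lie-Rinehart differential.
\<close>

definition two_cocycles ::
    "('k, 'a) module \<Rightarrow> ('a, 'b) lie_rinehart \<Rightarrow> ('b \<Rightarrow> 'b \<Rightarrow> 'a) set" where
  "two_cocycles A L = {f.
     (\<forall>x \<in> carrier L. \<forall>y \<in> carrier L. f x y \<in> carrier A) \<and>
     (\<forall>x \<in> carrier L. \<forall>x' \<in> carrier L. \<forall>y \<in> carrier L.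
        f (x \<oplus>\<^bsub>L\<^esub> x') y = f x y \<oplus>\<^bsub>A\<^esub> f x' y \<and> f y (x \<oplus>\<^bsub>L\<^esub> x') = f y x \<oplus>\<^bsub>A\<^esub> f y x') \<and>
     (\<forall>a \<in> carrier A. \<forall>x \<in> carrier L. \<forall>y \<in> carrier L.
        f (a \<odot>\<^bsub>L\<^esub> x) y = a \<otimes>\<^bsub>A\<^esub> f x y \<and> f y (a \<odot>\<^bsub>L\<^esub> x) = a \<otimes>\<^bsub>A\<^esub> f y x) \<and>
     (\<forall>x \<in> carrier L. f x x = \<zero>\<^bsub>A\<^esub>) \<and>
     (\<forall>x \<in> carrier L. \<forall>y \<in> carrier L. \<forall>z \<in> carrier L.
        anchor L x (f y z) \<ominus>\<^bsub>A\<^esub> anchor L y (f x z) \<oplus>\<^bsub>A\<^esub> anchor L z (f x y)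
          \<ominus>\<^bsub>A\<^esub> f (lr_bracket L x y) z \<oplus>\<^bsub>A\<^esub> f (lr_bracket L x z) y \<ominus>\<^bsub>A\<^esub> f (lr_bracket L y z) x
        = \<zero>\<^bsub>A\<^esub>)}"

text \<open>
  In this lifting property the modules range over fixed types; since the free module on
  \<open>carrier L\<close> lives on the type \<open>'b \<Rightarrow> 'a\<close>, this is no loss.
\<close>

definition projective_module ::
    "('k, 'a) module \<Rightarrow> ('a, 'b, 'm) module_scheme \<Rightarrow> bool" where
  "projective_module A L \<longleftrightarrow> module A L \<and>
     (\<forall>(M :: ('a, 'b \<Rightarrow> 'a) module) (N :: ('a, 'b) module) g h.
        module A M \<and> module A N \<and> linear_map A M N g \<and> g ` carrier M = carrier N \<and>
        linear_map A L N h \<longrightarrow>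
        (\<exists>h'. linear_map A L M h' \<and> (\<forall>x \<in> carrier L. g (h' x) = h x)))"


section \<open>\<open>D\<close>-Lie algebras\<close>

definition D1 ::
    "'k ring \<Rightarrow> ('k, 'a) module \<Rightarrow> (('a \<Rightarrow> 'a) \<Rightarrow> ('a \<Rightarrow> 'a) \<Rightarrow> 'a)
      \<Rightarrow> ('a, 'a \<times> ('a \<Rightarrow> 'a)) lie_bimodule" where
  "D1 k A f =
     \<lparr>carrier = carrier A \<times> carrier (Der k A), mult = undefined, one = undefined,
      zero = (\<zero>\<^bsub>A\<^esub>, \<zero>\<^bsub>Der k A\<^esub>),
      add = (\<lambda>(a, x) (b, y). (a \<oplus>\<^bsub>A\<^esub> b, x \<oplus>\<^bsub>Der k A\<^esub> y)),
      smult = (\<lambda>c (a, x). (c \<otimes>\<^bsub>A\<^esub> a, c \<odot>\<^bsub>Der k A\<^esub> x)),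
      rsmult = (\<lambda>(a, x) c. ((a \<otimes>\<^bsub>A\<^esub> c) \<oplus>\<^bsub>A\<^esub> x c, c \<odot>\<^bsub>Der k A\<^esub> x)),
      bracket = (\<lambda>(a, x) (b, y). (x b \<ominus>\<^bsub>A\<^esub> y a \<oplus>\<^bsub>A\<^esub> f x y, bracket (Der k A) x y))\<rparr>"

record ('a, 'b) d_lie = "('a, 'b) lie_bimodule" +
  d_alpha :: "'b \<Rightarrow> 'a \<times> ('a \<Rightarrow> 'a)"
  d_pi :: "'b \<Rightarrow> 'a \<Rightarrow> 'a"
  d_center :: 'b

locale d_lie_algebra = algebra k A +
    lie_algebra k "restrict_scalars A Lt" "bracket Lt"
  for k :: "'k ring" and A :: "('k, 'a) module"
    and f :: "('a \<Rightarrow> 'a) \<Rightarrow> ('a \<Rightarrow> 'a) \<Rightarrow> 'a" and Lt :: "('a, 'b) d_lie" +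
  assumes cocycle: "f \<in> two_cocycles A (Der_lie_rinehart k A)"
    and P_module: "P_module k A Lt"
    and alpha_P_linear: "P_linear_map k A Lt (D1 k A f) (d_alpha Lt)"
    and alpha_lie_hom: "lie_hom k (restrict_scalars A Lt) (bracket Lt)
          (restrict_scalars A (D1 k A f)) (bracket (D1 k A f)) (d_alpha Lt)"
    and pi_P_linear: "P_linear_map k A Lt (Der k A) (d_pi Lt)"
    and pi_lie_hom: "lie_hom k (restrict_scalars A Lt) (bracket Lt)
          (restrict_scalars A (Der k A)) (bracket (Der k A)) (d_pi Lt)"
    and pi_alpha: "u \<in> carrier Lt \<Longrightarrow> d_pi Lt u = snd (d_alpha Lt u)"
    and leibniz: "\<lbrakk>a \<in> carrier A; u \<in> carrier Lt; v \<in> carrier Lt\<rbrakk> \<Longrightarrow>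
          bracket Lt u (a \<odot>\<^bsub>Lt\<^esub> v) = a \<odot>\<^bsub>Lt\<^esub> bracket Lt u v \<oplus>\<^bsub>Lt\<^esub> d_pi Lt u a \<odot>\<^bsub>Lt\<^esub> v"
    and d_action: "\<lbrakk>a \<in> carrier A; u \<in> carrier Lt\<rbrakk> \<Longrightarrow>
          rsmult Lt u a \<ominus>\<^bsub>Lt\<^esub> a \<odot>\<^bsub>Lt\<^esub> u = d_pi Lt u a \<odot>\<^bsub>Lt\<^esub> d_center Lt"
    and center_closed: "d_center Lt \<in> carrier Lt"
    and center_central: "u \<in> carrier Lt \<Longrightarrow> bracket Lt (d_center Lt) u = \<zero>\<^bsub>Lt\<^esub>"
    and center_pi: "d_pi Lt (d_center Lt) = \<zero>\<^bsub>Der k A\<^esub>"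

definition d_lie_hom ::
    "'k ring \<Rightarrow> ('k, 'a) module \<Rightarrow> ('a, 'b) d_lie \<Rightarrow> ('a, 'c) d_lie \<Rightarrow> ('b \<Rightarrow> 'c) \<Rightarrow> bool" where
  "d_lie_hom k A Lt Lt' h \<longleftrightarrow>
     P_linear_map k A Lt Lt' h \<and>
     lie_hom k (restrict_scalars A Lt) (bracket Lt) (restrict_scalars A Lt') (bracket Lt') h \<and>
     h (d_center Lt) = d_center Lt' \<and>
     (\<forall>u \<in> carrier Lt. d_pi Lt u = d_pi Lt' (h u))"

definition d_lie_iso ::
    "'k ring \<Rightarrow> ('k, 'a) module \<Rightarrow> ('a, 'b) d_lie \<Rightarrow> ('a, 'c) d_lie \<Rightarrow> ('b \<Rightarrow> 'c) \<Rightarrow> bool" where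
  "d_lie_iso k A Lt Lt' h \<longleftrightarrow>
     d_lie_hom k A Lt Lt' h \<and> bij_betw h (carrier Lt) (carrier Lt')"

definition d_lie_isomorphic ::
    "'k ring \<Rightarrow> ('k, 'a) module \<Rightarrow> (('a \<Rightarrow> 'a) \<Rightarrow> ('a \<Rightarrow> 'a) \<Rightarrow> 'a)
      \<Rightarrow> ('a, 'b) d_lie \<Rightarrow> ('a, 'c) d_lie \<Rightarrow> bool" where
  "d_lie_isomorphic k A f Lt Lt' \<longleftrightarrow>
     d_lie_algebra k A f Lt \<and> d_lie_algebra k A f Lt' \<and> (\<exists>h. d_lie_iso k A Lt Lt' h)"

definition center_span :: "('k, 'a) module \<Rightarrow> ('a, 'b) d_lie \<Rightarrow> 'b set" where
  "center_span A Lt = {a \<odot>\<^bsub>Lt\<^esub> d_center Lt | a. a \<in> carrier A}"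

definition canonical_quotient :: "('k, 'a) module \<Rightarrow> ('a, 'b) d_lie \<Rightarrow> ('a, 'b set) lie_rinehart" where
  "canonical_quotient A Lt =
     (let J = center_span A Lt in
      \<lparr>carrier = a_rcosets\<^bsub>Lt\<^esub> J, mult = undefined, one = undefined,
       zero = J,
       add = set_add Lt,
       smult = (\<lambda>a X. \<Union>x \<in> X. J +>\<^bsub>Lt\<^esub> (a \<odot>\<^bsub>Lt\<^esub> x)),
       lr_bracket = (\<lambda>X Y. \<Union>x \<in> X. \<Union>y \<in> Y. J +>\<^bsub>Lt\<^esub> bracket Lt x y),
       anchor = (\<lambda>X. the_elem (d_pi Lt ` X))\<rparr>)"

text \<open>The pair \<open>(a, x)\<close> stands for \<open>a z + x\<close>; the anchor of \<open>L\<close> plays the role of \<open>\<alpha>\<close>.\<close>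

definition L_ext ::
    "'k ring \<Rightarrow> ('k, 'a) module \<Rightarrow> (('a \<Rightarrow> 'a) \<Rightarrow> ('a \<Rightarrow> 'a) \<Rightarrow> 'a)
      \<Rightarrow> ('a, 'b) lie_rinehart \<Rightarrow> ('a, 'a \<times> 'b) d_lie" where
  "L_ext k A f L =
     \<lparr>carrier = carrier A \<times> carrier L, mult = undefined, one = undefined,
      zero = (\<zero>\<^bsub>A\<^esub>, \<zero>\<^bsub>L\<^esub>),
      add = (\<lambda>(a, x) (b, y). (a \<oplus>\<^bsub>A\<^esub> b, x \<oplus>\<^bsub>L\<^esub> y)),
      smult = (\<lambda>c (a, x). (c \<otimes>\<^bsub>A\<^esub> a, c \<odot>\<^bsub>L\<^esub> x)),
      rsmult = (\<lambda>(a, x) c. ((a \<otimes>\<^bsub>A\<^esub> c) \<oplus>\<^bsub>A\<^esub> anchor L x c, c \<odot>\<^bsub>L\<^esub> x)),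
      bracket = (\<lambda>(a, x) (b, y).
        (anchor L x b \<ominus>\<^bsub>A\<^esub> anchor L y a \<oplus>\<^bsub>A\<^esub> f (anchor L x) (anchor L y), lr_bracket L x y)),
      d_alpha = (\<lambda>(a, x). (a, anchor L x)),
      d_pi = (\<lambda>(a, x). anchor L x),
      d_center = (\<one>\<^bsub>A\<^esub>, \<zero>\<^bsub>L\<^esub>)\<rparr>"


section \<open>Connections\<close>

definition op_id :: "('a, 'e) module \<Rightarrow> 'e \<Rightarrow> 'e" where
  "op_id E = (\<lambda>e \<in> carrier E. e)"

definition op_zero :: "('a, 'e) module \<Rightarrow> 'e \<Rightarrow> 'e" where
  "op_zero E = (\<lambda>e \<in> carrier E. \<zero>\<^bsub>E\<^esub>)"

definition op_scalar :: "('a, 'e) module \<Rightarrow> 'a \<Rightarrow> 'e \<Rightarrow> 'e" where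
  "op_scalar E a = (\<lambda>e \<in> carrier E. a \<odot>\<^bsub>E\<^esub> e)"

definition op_add :: "('a, 'e) module \<Rightarrow> ('e \<Rightarrow> 'e) \<Rightarrow> ('e \<Rightarrow> 'e) \<Rightarrow> 'e \<Rightarrow> 'e" where
  "op_add E p q = (\<lambda>e \<in> carrier E. p e \<oplus>\<^bsub>E\<^esub> q e)"

definition op_diff :: "('a, 'e) module \<Rightarrow> ('e \<Rightarrow> 'e) \<Rightarrow> ('e \<Rightarrow> 'e) \<Rightarrow> 'e \<Rightarrow> 'e" where
  "op_diff E p q = (\<lambda>e \<in> carrier E. p e \<ominus>\<^bsub>E\<^esub> q e)"

definition op_comm :: "('a, 'e) module \<Rightarrow> ('e \<Rightarrow> 'e) \<Rightarrow> ('e \<Rightarrow> 'e) \<Rightarrow> 'e \<Rightarrow> 'e" where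
  "op_comm E p q = op_diff E (compose (carrier E) p q) (compose (carrier E) q p)"

definition linear_endos :: "'r ring \<Rightarrow> ('r, 'e) module \<Rightarrow> ('e \<Rightarrow> 'e) set" where
  "linear_endos R E = {p \<in> carrier E \<rightarrow>\<^sub>E carrier E. linear_map R E E p}"

definition Diff1 ::
    "'k ring \<Rightarrow> ('k, 'a) module \<Rightarrow> ('a, 'e) module \<Rightarrow> ('a, 'e \<Rightarrow> 'e) bimodule" where
  "Diff1 k A E =
     \<lparr>carrier = {p \<in> linear_endos k (restrict_scalars A E). \<forall>a \<in> carrier A. \<forall>b \<in> carrier A.
        op_comm E (op_comm E p (op_scalar E a)) (op_scalar E b) = op_zero E},
      mult = undefined, one = undefined,
      zero = op_zero E,
      add = op_add E,
      smult = (\<lambda>a p. compose (carrier E) (op_scalar E a) p),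
      rsmult = (\<lambda>p b. compose (carrier E) p (op_scalar E b))\<rparr>"

definition connection ::
    "'k ring \<Rightarrow> ('k, 'a) module \<Rightarrow> ('a, 'b) d_lie \<Rightarrow> ('a, 'e) module \<Rightarrow> ('b \<Rightarrow> 'e \<Rightarrow> 'e) \<Rightarrow> bool" where
  "connection k A Lt E \<rho> \<longleftrightarrow> module A E \<and> P_linear_map k A Lt (Diff1 k A E) \<rho>"

definition curvature ::
    "('a, 'b) d_lie \<Rightarrow> ('a, 'e) module \<Rightarrow> ('b \<Rightarrow> 'e \<Rightarrow> 'e) \<Rightarrow> 'b \<Rightarrow> 'b \<Rightarrow> 'e \<Rightarrow> 'e" where
  "curvature Lt E \<rho> u v = op_diff E (op_comm E (\<rho> u) (\<rho> v)) (\<rho> (bracket Lt u v))"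

definition A_endos :: "('k, 'a) module \<Rightarrow> ('a, 'e) module \<Rightarrow> ('e \<Rightarrow> 'e) set" where
  "A_endos A E = {p \<in> carrier E \<rightarrow>\<^sub>E carrier E. linear_map A E E p}"

text \<open>The endomorphism component of the bracket of \<open>(p, u)\<close> and \<open>(q, v)\<close>.\<close>

definition End_bracket ::
    "('a, 'b) d_lie \<Rightarrow> ('a, 'e) module \<Rightarrow> ('b \<Rightarrow> 'e \<Rightarrow> 'e)
      \<Rightarrow> ('e \<Rightarrow> 'e) \<Rightarrow> 'b \<Rightarrow> ('e \<Rightarrow> 'e) \<Rightarrow> 'b \<Rightarrow> 'e \<Rightarrow> 'e" where
  "End_bracket Lt E \<rho> p u q v =
     op_add E (op_diff E (op_add E (op_comm E p q) (op_comm E (\<rho> u) q)) (op_comm E (\<rho> v) p))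
       (curvature Lt E \<rho> u v)"

definition End_d_lie ::
    "('k, 'a) module \<Rightarrow> ('a, 'b) d_lie \<Rightarrow> ('a, 'e) module \<Rightarrow> ('b \<Rightarrow> 'e \<Rightarrow> 'e)
      \<Rightarrow> ('a, ('e \<Rightarrow> 'e) \<times> 'b) d_lie" where
  "End_d_lie A Lt E \<rho> =
     \<lparr>carrier = A_endos A E \<times> carrier Lt, mult = undefined, one = undefined,
      zero = (op_zero E, \<zero>\<^bsub>Lt\<^esub>),
      add = (\<lambda>(p, u) (q, v). (op_add E p q, u \<oplus>\<^bsub>Lt\<^esub> v)),
      smult = (\<lambda>c (p, u). (compose (carrier E) (op_scalar E c) p, c \<odot>\<^bsub>Lt\<^esub> u)),
      rsmult = (\<lambda>(p, u) c. (compose (carrier E) p (op_scalar E c), rsmult Lt u c)),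
      bracket = (\<lambda>(p, u) (q, v). (End_bracket Lt E \<rho> p u q v, bracket Lt u v)),
      d_alpha = (\<lambda>(p, u). d_alpha Lt u),
      d_pi = (\<lambda>(p, u). d_pi Lt u),
      d_center = (op_zero E, d_center Lt)\<rparr>"

text \<open>
  Elements of \<open>canonical_quotient A Lt\<close> are cosets, so the lifts of \<open>U\<close> are its elements; the
  bracket below takes the common value over all lifts.
\<close>

definition End_lie_rinehart ::
    "('k, 'a) module \<Rightarrow> ('a, 'b) d_lie \<Rightarrow> ('a, 'e) module \<Rightarrow> ('b \<Rightarrow> 'e \<Rightarrow> 'e)
      \<Rightarrow> ('a, ('e \<Rightarrow> 'e) \<times> 'b set) lie_rinehart" where
  "End_lie_rinehart A Lt E \<rho> =
     (let L = canonical_quotient A Lt in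
      \<lparr>carrier = A_endos A E \<times> carrier L, mult = undefined, one = undefined,
       zero = (op_zero E, \<zero>\<^bsub>L\<^esub>),
       add = (\<lambda>(p, U) (q, V). (op_add E p q, U \<oplus>\<^bsub>L\<^esub> V)),
       smult = (\<lambda>c (p, U). (compose (carrier E) (op_scalar E c) p, c \<odot>\<^bsub>L\<^esub> U)),
       lr_bracket = (\<lambda>(p, U) (q, V).
         (the_elem {End_bracket Lt E \<rho> p u q v | u v. u \<in> U \<and> v \<in> V}, lr_bracket L U V)),
       anchor = (\<lambda>(p, U). anchor L U)\<rparr>)"

end

theory Submission
  imports Defs
begin

text \<open>
  In \<open>End(Lt, E)\<close> the bracket is made so that \<open>(p, u) \<mapsto> p + \<rho> u\<close> is a homomorphism to the commutator
  Lie algebra of \<open>E\<close>. Together with the projection to \<open>Lt\<close> it is injective, so the Lie axioms and the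
  Leibniz rule are inherited. Since \<open>p + \<rho> u\<close> satisfies \<open>P(ce) = c P(e) + \<pi>(u)(c) e\<close>, the commutator of
  two such operators minus \<open>\<rho> [u, v]\<close> is \<open>A\<close>-linear. Modules over \<open>A \<otimes> A\<close> enter only through their
  two \<open>A\<close>-actions because pure tensors generate. The canonical quotient of \<open>End(Lt, E)\<close> and \<open>End(L, E)\<close>
  are both images of \<open>End(Lt, E)\<close>, with the same kernel \<open>A (0, D)\<close>. Finally, if \<open>D\<close> lies over \<open>(1, 0)\<close>, then
  \<open>u \<mapsto> (a, u + J)\<close>, with \<open>a\<close> the first component of the image of \<open>u\<close> in \<open>D\<^sup>1(A, f)\<close>, is an isomorphism
  from \<open>Lt\<close> to \<open>L(f\<^sup>\<alpha>)\<close>.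
\<close>

section \<open>The tensor ring and pure tensors\<close>

text \<open>That the square of the diagonal ideal acts by zero is never checked by calculation.
  \<open>P_linear_map\<close> asserts actions on its source and on its target, so the hypotheses on
  \<open>d_alpha\<close>, \<open>d_pi\<close> and \<open>\<rho>\<close> already make
  \<open>D1\<close>, \<open>Der\<close> and \<open>Diff1\<close> into P-modules. Every new P-module
  is placed, by two jointly injective maps, inside a product of known ones and inherits the
  annihilation from there. Maps of D-Lie algebras respect both actions, the bracket,
  \<open>D\<close> and \<open>d_pi\<close>, but nothing relates them to \<open>d_alpha\<close>. An
  isomorphism therefore transports every axiom except those on \<open>d_alpha\<close>, which are
  established separately for L(f^\<alpha>). The condition on \<open>D\<close> has this origin: the
  first component of \<open>d_alpha\<close> is \<open>A\<close>-linear, and if it sends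
  \<open>D\<close> to 1 it is a retraction of the map taking a to aD. Then \<open>Lt\<close> is the
  direct sum of AD and the kernel of the retraction, and the kernel is a copy of the canonical
  quotient.\<close>

lemma mult_pre_tensor_ring_linear [simp]:
  "mult (pre_tensor_ring A) 0 t = 0"
  "mult (pre_tensor_ring A) s 0 = 0"
  "mult (pre_tensor_ring A) (s - s') t = mult (pre_tensor_ring A) s t - mult (pre_tensor_ring A) s' t"
  "mult (pre_tensor_ring A) s (t - t') = mult (pre_tensor_ring A) s t - mult (pre_tensor_ring A) s t'"
  "mult (pre_tensor_ring A) (s + s') t = mult (pre_tensor_ring A) s t + mult (pre_tensor_ring A) s' t"
  "mult (pre_tensor_ring A) s (t + t') = mult (pre_tensor_ring A) s t + mult (pre_tensor_ring A) s t'"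
  "mult (pre_tensor_ring A) (frag_of p) (frag_of q) =
     frag_of (fst p \<otimes>\<^bsub>A\<^esub> fst q, snd p \<otimes>\<^bsub>A\<^esub> snd q)"
proof -
  have mult: "mult (pre_tensor_ring A) s t = frag_extend (\<lambda>(a, b). frag_extend (\<lambda>(c, d).
        frag_of (a \<otimes>\<^bsub>A\<^esub> c, b \<otimes>\<^bsub>A\<^esub> d)) t) s" for s t
    by (simp add: pre_tensor_ring_def)
  have minus: "frag_cmul c (x - y) = frag_cmul c x - frag_cmul c y" for c and x y :: "('c \<times> 'c) \<Rightarrow>\<^sub>0 int"
    by (metis add_diff_cancel diff_add_cancel frag_cmul_distrib2)
  show "mult (pre_tensor_ring A) s 0 = 0"
    by (simp add: mult frag_extend_def split_def)
  \<comment> \<open>\<open>frag_extend\<close> is visibly additive only in the element it is applied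
    to. Here \<open>t\<close> enters through the function being extended, so the sum over the keys
    of \<open>s\<close> has to be opened.\<close>
  show "mult (pre_tensor_ring A) s (t - t') = mult (pre_tensor_ring A) s t - mult (pre_tensor_ring A) s t'"
    unfolding mult frag_extend_diff
    by (simp add: frag_extend_def [where x = s] split_def minus sum_subtractf)
  show "mult (pre_tensor_ring A) s (t + t') = mult (pre_tensor_ring A) s t + mult (pre_tensor_ring A) s t'"
    unfolding mult frag_extend_add
    by (simp add: frag_extend_def [where x = s] split_def frag_cmul_distrib2 sum.distrib)
qed (simp_all add: pre_tensor_ring_def frag_extend_add frag_extend_diff split_def)

lemma pre_tensor_ring_simps [simp]:
  "carrier (pre_tensor_ring A) = {t. Poly_Mapping.keys t \<subseteq> carrier A \<times> carrier A}"
  "one (pre_tensor_ring A) = frag_of (\<one>\<^bsub>A\<^esub>, \<one>\<^bsub>A\<^esub>)"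
  "zero (pre_tensor_ring A) = 0"
  "add (pre_tensor_ring A) = (+)"
  by (simp_all add: pre_tensor_ring_def)

lemma abelian_group_pre_tensor_ring: "abelian_group (pre_tensor_ring A)"
proof (rule abelian_groupI)
  fix x assume "x \<in> carrier (pre_tensor_ring A)"
  then show "\<exists>y \<in> carrier (pre_tensor_ring A). y \<oplus>\<^bsub>pre_tensor_ring A\<^esub> x = \<zero>\<^bsub>pre_tensor_ring A\<^esub>"
    by (intro bexI [of _ "- x"]) auto
next
  fix x y assume "x \<in> carrier (pre_tensor_ring A)" "y \<in> carrier (pre_tensor_ring A)"
  then show "x \<oplus>\<^bsub>pre_tensor_ring A\<^esub> y \<in> carrier (pre_tensor_ring A)"
    using keys_add [of x y] by auto
qed (auto simp: add_ac)

text \<open>Multiplication is bilinear, so closure, associativity and the unit laws reduce to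
  generators, where they are the laws of the monoid A x A. \<open>frag_induction\<close> makes this
  reduction for one argument at a time.\<close>

lemma ring_pre_tensor_ring:
  assumes "cring A"
  shows "ring (pre_tensor_ring A)"
proof -
  interpret cring A by fact
  have closed: "s \<otimes>\<^bsub>pre_tensor_ring A\<^esub> t \<in> carrier (pre_tensor_ring A)"
    if "s \<in> carrier (pre_tensor_ring A)" "t \<in> carrier (pre_tensor_ring A)" for s t
  proof -
    have "Poly_Mapping.keys s \<subseteq> carrier A \<times> carrier A" using that by simp
    then show ?thesis
    proof (induction s rule: frag_induction)
      case (one p)
      have "Poly_Mapping.keys t \<subseteq> carrier A \<times> carrier A" using that by simp
      then show ?case
      proof (induction t rule: frag_induction)
        case (diff t t')
        then show ?case using keys_diff by fastforce
      qed (use one in auto)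
    next
      case (diff s s')
      then show ?case using keys_diff by fastforce
    qed auto
  qed
  have assoc: "(x \<otimes>\<^bsub>pre_tensor_ring A\<^esub> y) \<otimes>\<^bsub>pre_tensor_ring A\<^esub> z =
      x \<otimes>\<^bsub>pre_tensor_ring A\<^esub> (y \<otimes>\<^bsub>pre_tensor_ring A\<^esub> z)"
    if "x \<in> carrier (pre_tensor_ring A)" "y \<in> carrier (pre_tensor_ring A)"
      "z \<in> carrier (pre_tensor_ring A)" for x y z
  proof -
    have "Poly_Mapping.keys x \<subseteq> carrier A \<times> carrier A" using that by simp
    then show ?thesis
    proof (induction x rule: frag_induction)
      case p: (one p)
      have "Poly_Mapping.keys y \<subseteq> carrier A \<times> carrier A" using that by simp
      then show ?case
      proof (induction y rule: frag_induction)
        case q: (one q)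
        have "Poly_Mapping.keys z \<subseteq> carrier A \<times> carrier A" using that by simp
        then show ?case
          by (induction z rule: frag_induction) (use p q in \<open>auto simp: m_assoc\<close>)
      qed simp_all
    qed simp_all
  qed
  have unit: "\<one>\<^bsub>pre_tensor_ring A\<^esub> \<otimes>\<^bsub>pre_tensor_ring A\<^esub> x = x \<and>
      x \<otimes>\<^bsub>pre_tensor_ring A\<^esub> \<one>\<^bsub>pre_tensor_ring A\<^esub> = x"
    if "x \<in> carrier (pre_tensor_ring A)" for x
  proof -
    have "Poly_Mapping.keys x \<subseteq> carrier A \<times> carrier A" using that by simp
    then show ?thesis
      by (induction x rule: frag_induction) auto
  qed
  have "monoid (pre_tensor_ring A)"
    using closed assoc unit by (intro monoidI) auto
  then show ?thesis
    using abelian_group_pre_tensor_ring by (intro ringI) auto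
qed

lemma tensor_relations_closed:
  assumes "algebra k A"
  shows "tensor_relations k A \<subseteq> carrier (pre_tensor_ring A)"
proof -
  interpret algebra k A by fact
  interpret A: cring A by (rule M_cring)
  have keys: "Poly_Mapping.keys (frag_of p - frag_of q) \<subseteq> carrier A \<times> carrier A"
    "r \<in> carrier A \<times> carrier A \<Longrightarrow>
      Poly_Mapping.keys (frag_of p - frag_of q - frag_of r) \<subseteq> carrier A \<times> carrier A"
    if "p \<in> carrier A \<times> carrier A" "q \<in> carrier A \<times> carrier A" for p q r
    using that keys_diff [of "frag_of p - frag_of q" "frag_of r"] keys_diff [of "frag_of p" "frag_of q"]
    by auto
  show ?thesis
    unfolding tensor_relations_def
    by (rule subsetI, elim UnE CollectE exE conjE) (simp_all add: keys)
qed

lemma tensor_ideal_is_ideal: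
  assumes "algebra k A"
  shows "ideal (tensor_ideal k A) (pre_tensor_ring A)"
proof -
  interpret ring "pre_tensor_ring A"
    using assms by (intro ring_pre_tensor_ring algebra.M_cring)
  show ?thesis
    unfolding tensor_ideal_def using tensor_relations_closed [OF assms] by (rule genideal_ideal)
qed

lemma tensor_coset_eqI:
  assumes "algebra k A" and "s \<in> carrier (pre_tensor_ring A)" and "t \<in> carrier (pre_tensor_ring A)"
    and "s - t \<in> tensor_ideal k A"
  shows "tensor_ideal k A +>\<^bsub>pre_tensor_ring A\<^esub> s = tensor_ideal k A +>\<^bsub>pre_tensor_ring A\<^esub> t"
proof -
  interpret ideal "tensor_ideal k A" "pre_tensor_ring A"
    using assms by (intro tensor_ideal_is_ideal)
  have "s \<in> tensor_ideal k A +>\<^bsub>pre_tensor_ring A\<^esub> t"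
    using assms by (auto simp: a_r_coset_def' intro!: bexI [of _ "s - t"])
  then show ?thesis
    using assms a_repr_independence' by metis
qed

section \<open>The tensor ring as a quotient ring, and its generation by pure tensors\<close>

context
  fixes k :: "'k ring" and A :: "('k, 'a) module"
  assumes algebra: "algebra k A"
begin

interpretation algebra k A by (rule algebra)
interpretation ideal "tensor_ideal k A" "pre_tensor_ring A"
  using algebra by (rule tensor_ideal_is_ideal)

lemma tensor_coset_simps:
  assumes "s \<in> carrier (pre_tensor_ring A)" and "t \<in> carrier (pre_tensor_ring A)"
  shows "(tensor_ideal k A +>\<^bsub>pre_tensor_ring A\<^esub> s) \<oplus>\<^bsub>tensor_ring k A\<^esub>
      (tensor_ideal k A +>\<^bsub>pre_tensor_ring A\<^esub> t) = tensor_ideal k A +>\<^bsub>pre_tensor_ring A\<^esub> (s + t)"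
    and "(tensor_ideal k A +>\<^bsub>pre_tensor_ring A\<^esub> s) \<otimes>\<^bsub>tensor_ring k A\<^esub>
      (tensor_ideal k A +>\<^bsub>pre_tensor_ring A\<^esub> t) =
      tensor_ideal k A +>\<^bsub>pre_tensor_ring A\<^esub> (s \<otimes>\<^bsub>pre_tensor_ring A\<^esub> t)"
    and "tensor_ideal k A +>\<^bsub>pre_tensor_ring A\<^esub> s \<in> carrier (tensor_ring k A)"
  using assms a_rcos_sum [of s t] rcoset_mult_add [of s t] a_rcosetsI [OF a_subset, of s]
  by (simp_all add: tensor_ring_def FactRing_def)

lemma ring_tensor_ring: "ring (tensor_ring k A)"
  unfolding tensor_ring_def by (rule quotient_is_ring)

lemma pure_tensor_closed:
  "\<lbrakk>a \<in> carrier A; b \<in> carrier A\<rbrakk> \<Longrightarrow> pure_tensor k A a b \<in> carrier (tensor_ring k A)"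
  unfolding pure_tensor_def by (rule tensor_coset_simps) auto

lemma pure_tensor_mult:
  assumes "a \<in> carrier A" "b \<in> carrier A" "c \<in> carrier A" "d \<in> carrier A"
  shows "pure_tensor k A a b \<otimes>\<^bsub>tensor_ring k A\<^esub> pure_tensor k A c d =
    pure_tensor k A (a \<otimes>\<^bsub>A\<^esub> c) (b \<otimes>\<^bsub>A\<^esub> d)"
  using assms by (simp add: pure_tensor_def tensor_coset_simps)

lemma pure_tensor_one: "pure_tensor k A \<one>\<^bsub>A\<^esub> \<one>\<^bsub>A\<^esub> = \<one>\<^bsub>tensor_ring k A\<^esub>"
  by (simp add: pure_tensor_def tensor_ring_def FactRing_def)

lemma tensor_relations_subset: "tensor_relations k A \<subseteq> tensor_ideal k A"
  unfolding tensor_ideal_def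
  using tensor_relations_closed [OF algebra] by (rule genideal_self)

lemma pure_tensor_add:
  assumes "a \<in> carrier A" "a' \<in> carrier A" "b \<in> carrier A"
  shows "pure_tensor k A (a \<oplus>\<^bsub>A\<^esub> a') b =
      pure_tensor k A a b \<oplus>\<^bsub>tensor_ring k A\<^esub> pure_tensor k A a' b"
    and "pure_tensor k A b (a \<oplus>\<^bsub>A\<^esub> a') =
      pure_tensor k A b a \<oplus>\<^bsub>tensor_ring k A\<^esub> pure_tensor k A b a'"
proof -
  have "frag_of (a \<oplus>\<^bsub>A\<^esub> a', b) - (frag_of (a, b) + frag_of (a', b)) \<in> tensor_relations k A"
    "frag_of (b, a \<oplus>\<^bsub>A\<^esub> a') - (frag_of (b, a) + frag_of (b, a')) \<in> tensor_relations k A"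
    \<comment> \<open>Turning \<open>x - (y + z)\<close> into \<open>x - y - z\<close> gives both
      differences the literal form of a bilinearity relation.\<close>
    unfolding tensor_relations_def diff_diff_add [symmetric] using assms by blast+
  moreover have "Poly_Mapping.keys (frag_of p + frag_of q) \<subseteq> carrier A \<times> carrier A"
    if "p \<in> carrier A \<times> carrier A" "q \<in> carrier A \<times> carrier A" for p q
    using keys_add [of "frag_of p" "frag_of q"] that by auto
  ultimately show "pure_tensor k A (a \<oplus>\<^bsub>A\<^esub> a') b =
      pure_tensor k A a b \<oplus>\<^bsub>tensor_ring k A\<^esub> pure_tensor k A a' b"
    and "pure_tensor k A b (a \<oplus>\<^bsub>A\<^esub> a') =
      pure_tensor k A b a \<oplus>\<^bsub>tensor_ring k A\<^esub> pure_tensor k A b a'"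
    unfolding pure_tensor_def using assms tensor_relations_subset
    by (subst tensor_coset_simps; (intro tensor_coset_eqI [OF algebra])?; force)+
qed

text \<open>A coset is represented by an integral combination of pairs, so it is reached from pure
  tensors by sums and negatives. Differences are split into these two cases because the laws of a
  module are stated for sums and for negatives.\<close>

lemma tensor_ring_induct [consumes 1, case_names pure add minus]:
  assumes T: "T \<in> carrier (tensor_ring k A)"
    and pure: "\<And>a b. \<lbrakk>a \<in> carrier A; b \<in> carrier A\<rbrakk> \<Longrightarrow> P (pure_tensor k A a b)"
    and add: "\<And>S T. \<lbrakk>S \<in> carrier (tensor_ring k A); T \<in> carrier (tensor_ring k A); P S; P T\<rbrakk>
      \<Longrightarrow> P (S \<oplus>\<^bsub>tensor_ring k A\<^esub> T)"
    and minus: "\<And>T. \<lbrakk>T \<in> carrier (tensor_ring k A); P T\<rbrakk> \<Longrightarrow> P (\<ominus>\<^bsub>tensor_ring k A\<^esub> T)"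
  shows "P T"
proof -
  interpret T: ring "tensor_ring k A" by (rule ring_tensor_ring)
  let ?q = "\<lambda>t. tensor_ideal k A +>\<^bsub>pre_tensor_ring A\<^esub> t"
  have qminus: "?q (- t) = \<ominus>\<^bsub>tensor_ring k A\<^esub> ?q t" if "t \<in> carrier (pre_tensor_ring A)" for t
  proof -
    have "?q t \<oplus>\<^bsub>tensor_ring k A\<^esub> ?q (- t) = ?q 0"
      using that by (subst tensor_coset_simps) auto
    also have "?q 0 = \<zero>\<^bsub>tensor_ring k A\<^esub>"
      using a_coset_add_zero [OF a_subset] by (simp add: tensor_ring_def FactRing_def)
    finally show ?thesis
      using that tensor_coset_simps(3) [of t] tensor_coset_simps(3) [of "- t"]
      by (intro T.minus_equality [symmetric]) (simp_all add: T.a_comm)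
  qed
  obtain t where t: "t \<in> carrier (pre_tensor_ring A)" and T: "T = ?q t"
    using T by (auto simp: tensor_ring_def FactRing_def A_RCOSETS_def')
  have "Poly_Mapping.keys t \<subseteq> carrier A \<times> carrier A" using t by simp
  then have "t \<in> carrier (pre_tensor_ring A) \<and> P (?q t)"
  proof (induction t rule: frag_induction)
    case zero
    have "?q 0 = \<zero>\<^bsub>tensor_ring k A\<^esub>"
      using a_coset_add_zero [OF a_subset] by (simp add: tensor_ring_def FactRing_def)
    \<comment> \<open>Additivity gives 0 \<otimes> 0 = 0 \<otimes> 0 + 0 \<otimes> 0, so this pure
      tensor vanishes and the zero element falls under the \<open>pure\<close> case.\<close>
    also have "\<dots> = pure_tensor k A \<zero>\<^bsub>A\<^esub> \<zero>\<^bsub>A\<^esub>"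
      using pure_tensor_add(1) [of "\<zero>\<^bsub>A\<^esub>" "\<zero>\<^bsub>A\<^esub>" "\<zero>\<^bsub>A\<^esub>"] pure_tensor_closed [of "\<zero>\<^bsub>A\<^esub>" "\<zero>\<^bsub>A\<^esub>"]
      by (auto simp: T.add.l_cancel_one)
    finally show ?case using pure by auto
  next
    case (one p)
    then show ?case using pure by (cases p) (auto simp: pure_tensor_def)
  next
    case (diff s t)
    then have "- t \<in> carrier (pre_tensor_ring A)" by simp
    with diff have "?q (s - t) = ?q s \<oplus>\<^bsub>tensor_ring k A\<^esub> \<ominus>\<^bsub>tensor_ring k A\<^esub> ?q t"
      by (simp add: qminus [symmetric] tensor_coset_simps)
    moreover have "s - t \<in> carrier (pre_tensor_ring A)"
      using diff keys_diff [of s t] by auto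
    ultimately show ?case
      using diff add minus by (simp add: tensor_coset_simps)
  qed
  then show ?thesis by (simp add: T)
qed

end

section \<open>\<open>P\<close>-modules through their two actions\<close>

text \<open>A module over \<open>A\<close> and its copy with scalars in the tensor ring are
  different records with the same additive part. Group facts pass between them through these field
  equalities.\<close>

lemma abelian_group_cong:
  assumes "abelian_group M" "carrier N = carrier M" "zero N = zero M" "add N = add M"
  shows "abelian_group N"
proof -
  interpret abelian_group M by fact
  show ?thesis
    using a_assoc a_comm l_neg by (intro abelian_groupI) (auto simp: assms intro!: bexI [of _ "\<ominus>\<^bsub>M\<^esub> x" for x])
qed

lemma a_inv_cong:
  assumes "carrier N = carrier M" "zero N = zero M" "add N = add M"
  shows "\<ominus>\<^bsub>N\<^esub> x = \<ominus>\<^bsub>M\<^esub> x"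
  by (simp add: a_inv_def m_inv_def assms)

lemma linear_mapD:
  assumes "linear_map R M N h"
  shows "\<And>x. x \<in> carrier M \<Longrightarrow> h x \<in> carrier N"
    and "\<And>x y. \<lbrakk>x \<in> carrier M; y \<in> carrier M\<rbrakk> \<Longrightarrow> h (x \<oplus>\<^bsub>M\<^esub> y) = h x \<oplus>\<^bsub>N\<^esub> h y"
    and "\<And>r x. \<lbrakk>r \<in> carrier R; x \<in> carrier M\<rbrakk> \<Longrightarrow> h (r \<odot>\<^bsub>M\<^esub> x) = r \<odot>\<^bsub>N\<^esub> h x"
  using assms by (auto simp: linear_map_def)

lemma linear_mapI:
  assumes "\<And>x. x \<in> carrier M \<Longrightarrow> h x \<in> carrier N"
    and "\<And>x y. \<lbrakk>x \<in> carrier M; y \<in> carrier M\<rbrakk> \<Longrightarrow> h (x \<oplus>\<^bsub>M\<^esub> y) = h x \<oplus>\<^bsub>N\<^esub> h y"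
    and "\<And>r x. \<lbrakk>r \<in> carrier R; x \<in> carrier M\<rbrakk> \<Longrightarrow> h (r \<odot>\<^bsub>M\<^esub> x) = r \<odot>\<^bsub>N\<^esub> h x"
  shows "linear_map R M N h"
  using assms by (auto simp: linear_map_def)

text \<open>The part of \<open>P_linear_map\<close> that avoids the existentially quantified
  actions. Given P-modules on both sides it is all that \<open>P_linear_map\<close> says, as
  \<open>P_linear_map_iff\<close> shows.\<close>

definition bimodule_map ::
    "('r, 'p) ring_scheme \<Rightarrow> ('r, 'b, 'm) bimodule_scheme \<Rightarrow> ('r, 'c, 'n) bimodule_scheme
      \<Rightarrow> ('b \<Rightarrow> 'c) \<Rightarrow> bool" where
  "bimodule_map A M N h \<longleftrightarrow> linear_map A M N h \<and>
     (\<forall>c \<in> carrier A. \<forall>u \<in> carrier M. h (rsmult M u c) = rsmult N (h u) c)"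

lemma bimodule_mapD:
  assumes "bimodule_map A M N h"
  shows "linear_map A M N h"
    and "\<And>c u. \<lbrakk>c \<in> carrier A; u \<in> carrier M\<rbrakk> \<Longrightarrow> h (rsmult M u c) = rsmult N (h u) c"
  using assms by (auto simp: bimodule_map_def)

context
  fixes k :: "'k ring" and A :: "('k, 'a) module"
  assumes algebra: "algebra k A"
begin

interpretation algebra k A by (rule algebra)
interpretation T: ring "tensor_ring k A" using algebra by (rule ring_tensor_ring)

text \<open>Factor a \<otimes> b as (a \<otimes> 1)(1 \<otimes> b) and as (1 \<otimes> b)(a
  \<otimes> 1). In particular the left and the right action commute, and together they determine the
  action of pure tensors.\<close>

lemma P_action_pure:
  assumes "P_action k A M act" "a \<in> carrier A" "b \<in> carrier A" "u \<in> carrier M"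
  shows "act (pure_tensor k A a b) u = a \<odot>\<^bsub>M\<^esub> rsmult M u b"
    and "act (pure_tensor k A a b) u = rsmult M (a \<odot>\<^bsub>M\<^esub> u) b"
proof -
  let ?M = "\<lparr>carrier = carrier M, mult = mult M, one = one M, zero = zero M, add = add M, smult = act\<rparr>"
  interpret M: module "tensor_ring k A" ?M
    using assms by (simp add: P_action_def)
  have act: "act (pure_tensor k A c \<one>\<^bsub>A\<^esub>) v = c \<odot>\<^bsub>M\<^esub> v"
    "act (pure_tensor k A \<one>\<^bsub>A\<^esub> c) v = rsmult M v c" if "c \<in> carrier A" "v \<in> carrier M" for c v
    using assms(1) that by (auto simp: P_action_def)
  have closed: "act t v \<in> carrier M" if "t \<in> carrier (tensor_ring k A)" "v \<in> carrier M" for t v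
    using M.smult_closed that by simp
  have mult: "act (s \<otimes>\<^bsub>tensor_ring k A\<^esub> t) v = act s (act t v)"
    if "s \<in> carrier (tensor_ring k A)" "t \<in> carrier (tensor_ring k A)" "v \<in> carrier M" for s t v
    using M.smult_assoc1 that by simp
  note pure = pure_tensor_closed [OF algebra]
  have "pure_tensor k A a b = pure_tensor k A a \<one>\<^bsub>A\<^esub> \<otimes>\<^bsub>tensor_ring k A\<^esub> pure_tensor k A \<one>\<^bsub>A\<^esub> b"
    using assms by (simp add: pure_tensor_mult [OF algebra])
  then show "act (pure_tensor k A a b) u = a \<odot>\<^bsub>M\<^esub> rsmult M u b"
    using assms closed [OF pure, of "\<one>\<^bsub>A\<^esub>" b u] by (simp add: mult pure act)
  have "pure_tensor k A a b = pure_tensor k A \<one>\<^bsub>A\<^esub> b \<otimes>\<^bsub>tensor_ring k A\<^esub> pure_tensor k A a \<one>\<^bsub>A\<^esub>"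
    using assms by (simp add: pure_tensor_mult [OF algebra])
  then show "act (pure_tensor k A a b) u = rsmult M (a \<odot>\<^bsub>M\<^esub> u) b"
    using assms closed [OF pure, of a "\<one>\<^bsub>A\<^esub>" u] by (simp add: mult pure act)
qed

text \<open>The left action is restriction of scalars along the ring homomorphism taking c to c
  \<otimes> 1.\<close>

lemma P_moduleD:
  assumes "P_module k A M"
  shows "module A M"
    and "\<And>c u. \<lbrakk>c \<in> carrier A; u \<in> carrier M\<rbrakk> \<Longrightarrow> rsmult M u c \<in> carrier M"
proof -
  from assms obtain act where P: "P_action k A M act" by (auto simp: P_module_def)
  let ?M = "\<lparr>carrier = carrier M, mult = mult M, one = one M, zero = zero M, add = add M, smult = act\<rparr>"
  interpret M: module "tensor_ring k A" ?M
    using P by (simp add: P_action_def)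
  have act: "c \<odot>\<^bsub>M\<^esub> v = act (pure_tensor k A c \<one>\<^bsub>A\<^esub>) v"
    "rsmult M v c = act (pure_tensor k A \<one>\<^bsub>A\<^esub> c) v" if "c \<in> carrier A" "v \<in> carrier M" for c v
    using P that by (auto simp: P_action_def)
  note pure = pure_tensor_closed [OF algebra]
  have closed: "act t v \<in> carrier M" if "t \<in> carrier (tensor_ring k A)" "v \<in> carrier M" for t v
    using M.smult_closed that by simp
  then show "rsmult M u c \<in> carrier M" if "c \<in> carrier A" "u \<in> carrier M" for c u
    using that pure by (simp add: act)
  have M: "abelian_group M"
    using M.abelian_group_axioms by (rule abelian_group_cong) simp_all
  show "module A M"
  proof (rule moduleI)
    fix a b x assume "a \<in> carrier A" "b \<in> carrier A" "x \<in> carrier M"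
    moreover have "pure_tensor k A (a \<oplus>\<^bsub>A\<^esub> b) \<one>\<^bsub>A\<^esub> =
        pure_tensor k A a \<one>\<^bsub>A\<^esub> \<oplus>\<^bsub>tensor_ring k A\<^esub> pure_tensor k A b \<one>\<^bsub>A\<^esub>"
      "pure_tensor k A (a \<otimes>\<^bsub>A\<^esub> b) \<one>\<^bsub>A\<^esub> =
        pure_tensor k A a \<one>\<^bsub>A\<^esub> \<otimes>\<^bsub>tensor_ring k A\<^esub> pure_tensor k A b \<one>\<^bsub>A\<^esub>"
      using calculation by (simp_all add: pure_tensor_add [OF algebra] pure_tensor_mult [OF algebra])
    ultimately show "(a \<oplus>\<^bsub>A\<^esub> b) \<odot>\<^bsub>M\<^esub> x = a \<odot>\<^bsub>M\<^esub> x \<oplus>\<^bsub>M\<^esub> b \<odot>\<^bsub>M\<^esub> x"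
      "(a \<otimes>\<^bsub>A\<^esub> b) \<odot>\<^bsub>M\<^esub> x = a \<odot>\<^bsub>M\<^esub> (b \<odot>\<^bsub>M\<^esub> x)"
      using M.smult_l_distr M.smult_assoc1 pure closed by (simp_all add: act)
  next
    fix x assume "x \<in> carrier M"
    then show "\<one>\<^bsub>A\<^esub> \<odot>\<^bsub>M\<^esub> x = x"
      using M.smult_one by (simp add: act pure_tensor_one [OF algebra])
  next
    fix a x y assume "a \<in> carrier A" "x \<in> carrier M" "y \<in> carrier M"
    then show "a \<odot>\<^bsub>M\<^esub> (x \<oplus>\<^bsub>M\<^esub> y) = a \<odot>\<^bsub>M\<^esub> x \<oplus>\<^bsub>M\<^esub> a \<odot>\<^bsub>M\<^esub> y"
      using M.smult_r_distr M.a_closed pure by (simp add: act)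
  qed (use M closed pure M_cring act in auto)
qed

text \<open>The tensors that \<open>h\<close> intertwines are closed under sums and negatives and
  contain the pure ones, because a \<otimes> b acts as a right multiplication followed by a left
  one.\<close>

lemma P_action_eqvI:
  assumes M: "P_action k A M act" and N: "P_action k A N act'" and h: "bimodule_map A M N h"
    and "t \<in> carrier (tensor_ring k A)" and x: "x \<in> carrier M"
  shows "h (act t x) = act' t (h x)"
proof -
  let ?M = "\<lparr>carrier = carrier M, mult = mult M, one = one M, zero = zero M, add = add M, smult = act\<rparr>"
  let ?N = "\<lparr>carrier = carrier N, mult = mult N, one = one N, zero = zero N, add = add N, smult = act'\<rparr>"
  interpret M: module "tensor_ring k A" ?M
    using M by (simp add: P_action_def)
  interpret N: module "tensor_ring k A" ?N
    using N by (simp add: P_action_def)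
  interpret M': module A M
    using M by (intro P_moduleD) (auto simp: P_module_def)
  interpret N': module A N
    using N by (intro P_moduleD) (auto simp: P_module_def)
  note h' = linear_mapD [OF bimodule_mapD(1) [OF h]] bimodule_mapD(2) [OF h]
  have closed: "act t x \<in> carrier M" "act' t (h x) \<in> carrier N" if "t \<in> carrier (tensor_ring k A)" for t
    using M.smult_closed N.smult_closed that x h' by auto
  interpret abelian_group_hom M N h
    using h' by unfold_locales (auto simp: hom_def)
  from \<open>t \<in> carrier (tensor_ring k A)\<close> show ?thesis
  proof (induction t rule: tensor_ring_induct [OF algebra, consumes 1])
    case (1 a b)
    moreover have "rsmult M x b \<in> carrier M"
      using 1 M x by (intro P_moduleD) (auto simp: P_module_def)
    ultimately show ?case
      using x h' by (simp add: P_action_pure(1) [OF M] P_action_pure(1) [OF N])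
  next
    case (2 s t)
    then show ?case
      using x h' M.smult_l_distr N.smult_l_distr closed by simp
  next
    case (3 t)
    then show ?case
      using x h' M.smult_l_minus [of t x] N.smult_l_minus [of t "h x"] closed
        a_inv_cong [of ?M M] a_inv_cong [of ?N N] by simp
  qed
qed

text \<open>Forwards, equivariance is evaluated at c \<otimes> 1 and 1 \<otimes> c. Backwards, any
  two actions witnessing the P-modules will do, since equivariance spreads from the two one-sided
  actions to the whole tensor ring.\<close>

lemma P_linear_map_iff:
  "P_linear_map k A M N h \<longleftrightarrow> P_module k A M \<and> P_module k A N \<and> bimodule_map A M N h"
proof
  assume "P_linear_map k A M N h"
  then obtain act act' where act: "P_action k A M act" "P_action k A N act'"
    and h: "h \<in> carrier M \<rightarrow> carrier N"
      "\<forall>x \<in> carrier M. \<forall>y \<in> carrier M. h (x \<oplus>\<^bsub>M\<^esub> y) = h x \<oplus>\<^bsub>N\<^esub> h y"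
      "\<forall>t \<in> carrier (tensor_ring k A). \<forall>x \<in> carrier M. h (act t x) = act' t (h x)"
    by (auto simp: P_linear_map_def)
  have "h (c \<odot>\<^bsub>M\<^esub> u) = c \<odot>\<^bsub>N\<^esub> h u \<and> h (rsmult M u c) = rsmult N (h u) c"
    if "c \<in> carrier A" "u \<in> carrier M" for c u
  proof -
    have "h u \<in> carrier N" "pure_tensor k A c \<one>\<^bsub>A\<^esub> \<in> carrier (tensor_ring k A)"
      "pure_tensor k A \<one>\<^bsub>A\<^esub> c \<in> carrier (tensor_ring k A)"
      using h that by (auto intro!: pure_tensor_closed [OF algebra])
    then show ?thesis
      using act h(3) that unfolding P_action_def by metis
  qed
  then show "P_module k A M \<and> P_module k A N \<and> bimodule_map A M N h"
    using act h by (auto simp: P_module_def bimodule_map_def linear_map_def)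
next
  assume *: "P_module k A M \<and> P_module k A N \<and> bimodule_map A M N h"
  then obtain act act' where act: "P_action k A M act" "P_action k A N act'"
    by (auto simp: P_module_def)
  moreover have "linear_map A M N h"
    using * by (simp add: bimodule_map_def)
  ultimately show "P_linear_map k A M N h"
    unfolding P_linear_map_def using * P_action_eqvI [OF act]
    by (intro exI [of _ act] exI [of _ act']) (auto simp: linear_map_def)
qed

text \<open>The maps identify \<open>M\<close> with a subset of N1 x N2 that is closed under
  addition and both one-sided actions. Pure tensors generate, so this subset is stable under the
  whole tensor ring, and all axioms, including the annihilation, are equations that may be compared
  in \<open>N1\<close> and \<open>N2\<close>.\<close>

lemma P_module_embed:
  assumes N1: "P_module k A N1" and N2: "P_module k A N2"
    and h1: "bimodule_map A M N1 h1" and h2: "bimodule_map A M N2 h2"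
    and inj: "\<And>x y. \<lbrakk>x \<in> carrier M; y \<in> carrier M; h1 x = h1 y; h2 x = h2 y\<rbrakk> \<Longrightarrow> x = y"
    and zero: "\<zero>\<^bsub>M\<^esub> \<in> carrier M" "h1 \<zero>\<^bsub>M\<^esub> = \<zero>\<^bsub>N1\<^esub>" "h2 \<zero>\<^bsub>M\<^esub> = \<zero>\<^bsub>N2\<^esub>"
    and add: "\<And>x y. \<lbrakk>x \<in> carrier M; y \<in> carrier M\<rbrakk> \<Longrightarrow> x \<oplus>\<^bsub>M\<^esub> y \<in> carrier M"
    and smult: "\<And>a x. \<lbrakk>a \<in> carrier A; x \<in> carrier M\<rbrakk> \<Longrightarrow> a \<odot>\<^bsub>M\<^esub> x \<in> carrier M"
    and rsmult: "\<And>a x. \<lbrakk>a \<in> carrier A; x \<in> carrier M\<rbrakk> \<Longrightarrow> rsmult M x a \<in> carrier M"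
  shows "P_module k A M"
proof -
  from N1 N2 obtain act1 act2 where P1: "P_action k A N1 act1" and P2: "P_action k A N2 act2"
    by (auto simp: P_module_def)
  let ?N1 = "\<lparr>carrier = carrier N1, mult = mult N1, one = one N1, zero = zero N1, add = add N1, smult = act1\<rparr>"
  let ?N2 = "\<lparr>carrier = carrier N2, mult = mult N2, one = one N2, zero = zero N2, add = add N2, smult = act2\<rparr>"
  interpret N1: module "tensor_ring k A" ?N1 using P1 by (simp add: P_action_def)
  interpret N2: module "tensor_ring k A" ?N2 using P2 by (simp add: P_action_def)
  interpret N1': module A N1 using N1 by (rule P_moduleD)
  interpret N2': module A N2 using N2 by (rule P_moduleD)
  note h1' = linear_mapD [OF bimodule_mapD(1) [OF h1]] bimodule_mapD(2) [OF h1]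
  note h2' = linear_mapD [OF bimodule_mapD(1) [OF h2]] bimodule_mapD(2) [OF h2]
  have closed1: "act1 t x \<in> carrier N1" if "t \<in> carrier (tensor_ring k A)" "x \<in> carrier N1" for t x
    using N1.smult_closed that by auto
  have closed2: "act2 t x \<in> carrier N2" if "t \<in> carrier (tensor_ring k A)" "x \<in> carrier N2" for t x
    using N2.smult_closed that by auto
  have inv: "a_inv ?N1 = a_inv N1" "a_inv ?N2 = a_inv N2"
    by (intro ext a_inv_cong; simp)+
  have "\<exists>y \<in> carrier M. h1 y = act1 t (h1 x) \<and> h2 y = act2 t (h2 x)"
    if "t \<in> carrier (tensor_ring k A)" and x: "x \<in> carrier M" for t x
    using that(1)
  proof (induction t rule: tensor_ring_induct [OF algebra, consumes 1])
    case (1 a b)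
    then show ?case
      using x h1' h2' smult rsmult P_action_pure(1) [OF P1] P_action_pure(1) [OF P2]
      by (intro bexI [of _ "a \<odot>\<^bsub>M\<^esub> rsmult M x b"]) simp_all
  next
    case (2 s t)
    then obtain y z where "y \<in> carrier M" "h1 y = act1 s (h1 x)" "h2 y = act2 s (h2 x)"
      "z \<in> carrier M" "h1 z = act1 t (h1 x)" "h2 z = act2 t (h2 x)" by blast
    then show ?case
      using 2 x h1' h2' add N1.smult_l_distr N2.smult_l_distr
      by (intro bexI [of _ "y \<oplus>\<^bsub>M\<^esub> z"]) simp_all
  next
    case (3 t)
    then obtain y where "y \<in> carrier M" "h1 y = act1 t (h1 x)" "h2 y = act2 t (h2 x)"
      by blast
    \<comment> \<open>\<open>M\<close> is not yet known to be a group, so the negative of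
      \<open>y\<close> is produced as its multiple by -1.\<close>
    then show ?case
      using 3 x h1' h2' smult N1.smult_l_minus [of t "h1 x"] N2.smult_l_minus [of t "h2 x"]
        N1'.smult_l_minus [of "\<one>\<^bsub>A\<^esub>" "h1 y"] N2'.smult_l_minus [of "\<one>\<^bsub>A\<^esub>" "h2 y"] closed1 closed2
      by (intro bexI [of _ "(\<ominus>\<^bsub>A\<^esub> \<one>\<^bsub>A\<^esub>) \<odot>\<^bsub>M\<^esub> y"]) (simp_all add: inv)
  qed
  \<comment> \<open>Joint injectivity makes the witness unique, so the chosen function is forced and
    obeys every law that holds in both targets.\<close>
  then obtain act where act: "\<And>t x. \<lbrakk>t \<in> carrier (tensor_ring k A); x \<in> carrier M\<rbrakk> \<Longrightarrow>
      act t x \<in> carrier M \<and> h1 (act t x) = act1 t (h1 x) \<and> h2 (act t x) = act2 t (h2 x)"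
    by metis
  have M: "abelian_group M"
  proof (rule abelian_groupI)
    fix x assume x: "x \<in> carrier M"
    show "\<exists>y \<in> carrier M. y \<oplus>\<^bsub>M\<^esub> x = \<zero>\<^bsub>M\<^esub>"
      using x h1' h2' smult add zero N1'.smult_l_minus [of "\<one>\<^bsub>A\<^esub>" "h1 x"]
        N2'.smult_l_minus [of "\<one>\<^bsub>A\<^esub>" "h2 x"]
      by (intro bexI [of _ "(\<ominus>\<^bsub>A\<^esub> \<one>\<^bsub>A\<^esub>) \<odot>\<^bsub>M\<^esub> x"] inj) (simp_all add: N1'.l_neg N2'.l_neg)
  next
    fix x y assume "x \<in> carrier M" "y \<in> carrier M"
    then show "x \<oplus>\<^bsub>M\<^esub> y = y \<oplus>\<^bsub>M\<^esub> x"
      using h1' h2' add by (intro inj) (simp_all add: N1'.a_comm N2'.a_comm)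
  next
    fix x y z assume "x \<in> carrier M" "y \<in> carrier M" "z \<in> carrier M"
    then show "x \<oplus>\<^bsub>M\<^esub> y \<oplus>\<^bsub>M\<^esub> z = x \<oplus>\<^bsub>M\<^esub> (y \<oplus>\<^bsub>M\<^esub> z)"
      using h1' h2' add by (intro inj) (simp_all add: N1'.a_assoc N2'.a_assoc)
  next
    fix x assume "x \<in> carrier M"
    then show "\<zero>\<^bsub>M\<^esub> \<oplus>\<^bsub>M\<^esub> x = x"
      using h1' h2' add zero by (intro inj) simp_all
  qed (use zero add in auto)
  let ?M = "\<lparr>carrier = carrier M, mult = mult M, one = one M, zero = zero M, add = add M, smult = act\<rparr>"
  note [simp] = pure_tensor_closed [OF algebra] h1' h2' act add smult rsmult closed1 closed2
  have "module (tensor_ring k A) ?M"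
  proof (rule moduleI)
    show "abelian_group ?M" using M by (rule abelian_group_cong) simp_all
    \<comment> \<open>Only the ring laws were derived for the quotient. Commutativity is read off
      from the module structure of \<open>N1\<close>, whose locale demands commutative
      scalars.\<close>
    show "cring (tensor_ring k A)" using N1.is_cring .
  next
    fix s t x assume "s \<in> carrier (tensor_ring k A)" "t \<in> carrier (tensor_ring k A)" "x \<in> carrier ?M"
    then show "(s \<oplus>\<^bsub>tensor_ring k A\<^esub> t) \<odot>\<^bsub>?M\<^esub> x = s \<odot>\<^bsub>?M\<^esub> x \<oplus>\<^bsub>?M\<^esub> t \<odot>\<^bsub>?M\<^esub> x"
      "(s \<otimes>\<^bsub>tensor_ring k A\<^esub> t) \<odot>\<^bsub>?M\<^esub> x = s \<odot>\<^bsub>?M\<^esub> (t \<odot>\<^bsub>?M\<^esub> x)"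
      using N1.smult_l_distr N2.smult_l_distr N1.smult_assoc1 N2.smult_assoc1
      by (auto intro!: inj)
  next
    fix t x y assume "t \<in> carrier (tensor_ring k A)" "x \<in> carrier ?M" "y \<in> carrier ?M"
    then show "t \<odot>\<^bsub>?M\<^esub> (x \<oplus>\<^bsub>?M\<^esub> y) = t \<odot>\<^bsub>?M\<^esub> x \<oplus>\<^bsub>?M\<^esub> t \<odot>\<^bsub>?M\<^esub> y"
      using N1.smult_r_distr N2.smult_r_distr by (auto intro!: inj)
  next
    fix x assume "x \<in> carrier ?M"
    then show "\<one>\<^bsub>tensor_ring k A\<^esub> \<odot>\<^bsub>?M\<^esub> x = x"
      using N1.smult_one N2.smult_one by (auto intro!: inj)
  qed simp
  moreover have "act t u = \<zero>\<^bsub>M\<^esub>"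
    if "t \<in> diag_ideal k A \<cdot>\<^bsub>tensor_ring k A\<^esub> diag_ideal k A" "u \<in> carrier M" for t u
  proof -
    \<comment> \<open>The maps intertwine the actions only for elements of the tensor ring, so
      membership comes before annihilation.\<close>
    have "t \<in> carrier (tensor_ring k A)"
      using that(1)
      by (induction t rule: ideal_prod.induct) (auto simp: diag_ideal_def a_kernel_def')
    then show ?thesis
      using that P1 P2 zero by (intro inj) (auto simp: P_action_def)
  qed
  moreover have "act (pure_tensor k A c \<one>\<^bsub>A\<^esub>) u = c \<odot>\<^bsub>M\<^esub> u \<and> act (pure_tensor k A \<one>\<^bsub>A\<^esub> c) u = rsmult M u c"
    if "c \<in> carrier A" "u \<in> carrier M" for c u
    using that P1 P2 by (auto intro!: inj simp: P_action_def)
  ultimately show ?thesis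
    unfolding P_module_def P_action_def by blast
qed

end

section \<open>Lie-Rinehart quotients of \<open>D\<close>-Lie algebras\<close>

lemma (in abelian_group) minus_add_cancel:
  assumes "a \<in> carrier G" "b \<in> carrier G"
  shows "(a \<ominus> b) \<oplus> b = a"
  using assms by (simp add: a_minus_def a_assoc l_neg)

lemma restrict_scalars_simps [simp]:
  "carrier (restrict_scalars A M) = carrier M"
  "zero (restrict_scalars A M) = zero M"
  "add (restrict_scalars A M) = add M"
  "r \<odot>\<^bsub>restrict_scalars A M\<^esub> x = (r \<odot>\<^bsub>A\<^esub> \<one>\<^bsub>A\<^esub>) \<odot>\<^bsub>M\<^esub> x"
  "\<ominus>\<^bsub>restrict_scalars A M\<^esub> x = \<ominus>\<^bsub>M\<^esub> x"
  by (simp_all add: restrict_scalars_def a_inv_def m_inv_def)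

lemma module_restrict_scalars:
  assumes "algebra k A" "module A M"
  shows "module k (restrict_scalars A M)"
proof -
  interpret algebra k A by fact
  interpret M': module A M by fact
  have "abelian_group (restrict_scalars A M)"
    using M'.abelian_group_axioms by (rule abelian_group_cong) simp_all
  moreover have "(r \<otimes>\<^bsub>k\<^esub> s) \<odot>\<^bsub>A\<^esub> \<one>\<^bsub>A\<^esub> = (r \<odot>\<^bsub>A\<^esub> \<one>\<^bsub>A\<^esub>) \<otimes>\<^bsub>A\<^esub> (s \<odot>\<^bsub>A\<^esub> \<one>\<^bsub>A\<^esub>)"
    if "r \<in> carrier k" "s \<in> carrier k" for r s
    using that by (simp add: smult_assoc1 smult_assoc2)
  ultimately show ?thesis
    using R_cring
    by (intro moduleI) (auto simp: smult_l_distr M'.smult_l_distr M'.smult_r_distr M'.smult_assoc1)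
qed

lemma linear_map_restrict_scalars:
  assumes "algebra k A" "linear_map A M N h"
  shows "linear_map k (restrict_scalars A M) (restrict_scalars A N) h"
proof -
  interpret algebra k A by fact
  show ?thesis
    using assms(2) by (auto simp: linear_map_def)
qed

context lie_algebra
begin

lemma br_closed: "\<lbrakk>x \<in> carrier V; y \<in> carrier V\<rbrakk> \<Longrightarrow> br x y \<in> carrier V"
  using linear_mapD(1) [OF br_linear_right] .

lemma br_add_right:
  "\<lbrakk>x \<in> carrier V; y \<in> carrier V; z \<in> carrier V\<rbrakk> \<Longrightarrow> br x (y \<oplus>\<^bsub>V\<^esub> z) = br x y \<oplus>\<^bsub>V\<^esub> br x z"
  using br_linear_right by (auto simp: linear_map_def)

lemma br_add_left:
  "\<lbrakk>x \<in> carrier V; y \<in> carrier V; z \<in> carrier V\<rbrakk> \<Longrightarrow> br (x \<oplus>\<^bsub>V\<^esub> y) z = br x z \<oplus>\<^bsub>V\<^esub> br y z"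
  using br_linear_left by (auto simp: linear_map_def)

lemma br_smult_right:
  "\<lbrakk>r \<in> carrier k; x \<in> carrier V; y \<in> carrier V\<rbrakk> \<Longrightarrow> br x (r \<odot>\<^bsub>V\<^esub> y) = r \<odot>\<^bsub>V\<^esub> br x y"
  using br_linear_right by (auto simp: linear_map_def)

lemma br_smult_left:
  "\<lbrakk>r \<in> carrier k; x \<in> carrier V; y \<in> carrier V\<rbrakk> \<Longrightarrow> br (r \<odot>\<^bsub>V\<^esub> x) y = r \<odot>\<^bsub>V\<^esub> br x y"
  using br_linear_left by (auto simp: linear_map_def)

lemma br_swap:
  assumes "x \<in> carrier V" "y \<in> carrier V"
  shows "br x y = \<ominus>\<^bsub>V\<^esub> br y x"
proof -
  have "br x y \<oplus>\<^bsub>V\<^esub> br y x = \<zero>\<^bsub>V\<^esub>"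
    using br_alternating [of "x \<oplus>\<^bsub>V\<^esub> y"] assms
    by (simp add: br_add_left br_add_right br_alternating [OF assms(1)] br_alternating [OF assms(2)]
        br_closed M.a_comm)
  then show ?thesis
    using assms by (auto intro!: M.minus_equality [symmetric] simp: br_closed)
qed

end

lemma derivationsD:
  assumes "x \<in> derivations k A"
  shows "\<And>a. a \<in> carrier A \<Longrightarrow> x a \<in> carrier A"
    and "\<And>a b. \<lbrakk>a \<in> carrier A; b \<in> carrier A\<rbrakk> \<Longrightarrow> x (a \<oplus>\<^bsub>A\<^esub> b) = x a \<oplus>\<^bsub>A\<^esub> x b"
    and "\<And>a b. \<lbrakk>a \<in> carrier A; b \<in> carrier A\<rbrakk> \<Longrightarrow>
      x (a \<otimes>\<^bsub>A\<^esub> b) = (a \<otimes>\<^bsub>A\<^esub> x b) \<oplus>\<^bsub>A\<^esub> (x a \<otimes>\<^bsub>A\<^esub> b)"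
    and "x \<in> extensional (carrier A)"
  using assms by (auto simp: derivations_def linear_map_def PiE_def)

lemma Der_simps [simp]:
  "carrier (Der k A) = derivations k A"
  "zero (Der k A) = (\<lambda>a \<in> carrier A. \<zero>\<^bsub>A\<^esub>)"
  "x \<oplus>\<^bsub>Der k A\<^esub> y = (\<lambda>a \<in> carrier A. x a \<oplus>\<^bsub>A\<^esub> y a)"
  "c \<odot>\<^bsub>Der k A\<^esub> x = (\<lambda>a \<in> carrier A. c \<otimes>\<^bsub>A\<^esub> x a)"
  "rsmult (Der k A) x c = (\<lambda>a \<in> carrier A. c \<otimes>\<^bsub>A\<^esub> x a)"
  "bracket (Der k A) x y = (\<lambda>a \<in> carrier A. x (y a) \<ominus>\<^bsub>A\<^esub> y (x a))"
  by (simp_all add: Der_def)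

section \<open>Calculus with multiples of \<open>D\<close> in a D-Lie algebra\<close>

context d_lie_algebra
begin

lemma algebra: "algebra k A" ..

lemma A_module: "module A Lt"
  using algebra P_module by (rule P_moduleD)

interpretation Lt: module A Lt by (rule A_module)

lemma rsmult_closed: "\<lbrakk>c \<in> carrier A; u \<in> carrier Lt\<rbrakk> \<Longrightarrow> rsmult Lt u c \<in> carrier Lt"
  using algebra P_module by (rule P_moduleD)

lemma bracket_closed:
  "\<lbrakk>u \<in> carrier Lt; v \<in> carrier Lt\<rbrakk> \<Longrightarrow> bracket Lt u v \<in> carrier Lt"
  using br_closed by simp

lemma bracket_add:
  assumes "u \<in> carrier Lt" "v \<in> carrier Lt" "w \<in> carrier Lt"
  shows "bracket Lt u (v \<oplus>\<^bsub>Lt\<^esub> w) = bracket Lt u v \<oplus>\<^bsub>Lt\<^esub> bracket Lt u w"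
    and "bracket Lt (u \<oplus>\<^bsub>Lt\<^esub> v) w = bracket Lt u w \<oplus>\<^bsub>Lt\<^esub> bracket Lt v w"
  using assms br_add_left br_add_right by simp_all

lemma bracket_swap:
  "\<lbrakk>u \<in> carrier Lt; v \<in> carrier Lt\<rbrakk> \<Longrightarrow> bracket Lt u v = \<ominus>\<^bsub>Lt\<^esub> bracket Lt v u"
  using br_swap [of u v] by simp

lemma d_pi_bimodule_map: "bimodule_map A Lt (Der k A) (d_pi Lt)"
  using pi_P_linear by (simp add: P_linear_map_iff [OF algebra])

lemma d_pi_linear: "linear_map A Lt (Der k A) (d_pi Lt)"
  using d_pi_bimodule_map by (rule bimodule_mapD)

lemma d_pi_derivation: "u \<in> carrier Lt \<Longrightarrow> d_pi Lt u \<in> derivations k A"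
  using linear_mapD [OF d_pi_linear] by simp

lemma d_pi_closed: "\<lbrakk>u \<in> carrier Lt; a \<in> carrier A\<rbrakk> \<Longrightarrow> d_pi Lt u a \<in> carrier A"
  using d_pi_derivation by (rule derivationsD)

lemma d_pi_add:
  "\<lbrakk>u \<in> carrier Lt; v \<in> carrier Lt; a \<in> carrier A\<rbrakk> \<Longrightarrow>
    d_pi Lt (u \<oplus>\<^bsub>Lt\<^esub> v) a = d_pi Lt u a \<oplus>\<^bsub>A\<^esub> d_pi Lt v a"
  using linear_mapD(2) [OF d_pi_linear] by simp

lemma d_pi_bracket:
  "\<lbrakk>u \<in> carrier Lt; v \<in> carrier Lt\<rbrakk> \<Longrightarrow>
    d_pi Lt (bracket Lt u v) = bracket (Der k A) (d_pi Lt u) (d_pi Lt v)"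
  using pi_lie_hom by (simp add: lie_hom_def)

lemma d_pi_center_multiple: "c \<in> carrier A \<Longrightarrow> d_pi Lt (c \<odot>\<^bsub>Lt\<^esub> d_center Lt) = \<zero>\<^bsub>Der k A\<^esub>"
  using linear_mapD(3) [OF d_pi_linear, of c "d_center Lt"] center_closed
  by (auto simp: center_pi intro!: restrict_ext)

text \<open>Makes the anchor of the canonical quotient independent of the representative.\<close>

lemma d_pi_shift:
  assumes "c \<in> carrier A" "u \<in> carrier Lt"
  shows "d_pi Lt (c \<odot>\<^bsub>Lt\<^esub> d_center Lt \<oplus>\<^bsub>Lt\<^esub> u) = d_pi Lt u"
proof (rule extensionalityI)
  have "c \<odot>\<^bsub>Lt\<^esub> d_center Lt \<oplus>\<^bsub>Lt\<^esub> u \<in> carrier Lt"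
    using assms center_closed by simp
  then show "d_pi Lt (c \<odot>\<^bsub>Lt\<^esub> d_center Lt \<oplus>\<^bsub>Lt\<^esub> u) \<in> extensional (carrier A)"
    by (rule derivationsD(4) [OF d_pi_derivation])
  show "d_pi Lt u \<in> extensional (carrier A)"
    using assms(2) by (rule derivationsD(4) [OF d_pi_derivation])
  fix a assume "a \<in> carrier A"
  then show "d_pi Lt (c \<odot>\<^bsub>Lt\<^esub> d_center Lt \<oplus>\<^bsub>Lt\<^esub> u) a = d_pi Lt u a"
    using assms center_closed d_pi_closed by (simp add: d_pi_add d_pi_center_multiple)
qed

lemma bracket_center:
  "u \<in> carrier Lt \<Longrightarrow> bracket Lt u (d_center Lt) = \<zero>\<^bsub>Lt\<^esub>"
  using bracket_swap [of u "d_center Lt"] center_central center_closed by simp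

text \<open>Since \<open>D\<close> is central, the Leibniz rule leaves only the derivative of the
  coefficient. So AD is a Lie ideal, although its elements need not be central.\<close>

lemma bracket_center_multiple:
  assumes "c \<in> carrier A" "u \<in> carrier Lt"
  shows "bracket Lt u (c \<odot>\<^bsub>Lt\<^esub> d_center Lt) = d_pi Lt u c \<odot>\<^bsub>Lt\<^esub> d_center Lt"
    and "bracket Lt (c \<odot>\<^bsub>Lt\<^esub> d_center Lt) u = (\<ominus>\<^bsub>A\<^esub> d_pi Lt u c) \<odot>\<^bsub>Lt\<^esub> d_center Lt"
proof -
  show *: "bracket Lt u (c \<odot>\<^bsub>Lt\<^esub> d_center Lt) = d_pi Lt u c \<odot>\<^bsub>Lt\<^esub> d_center Lt"
    using assms center_closed d_pi_closed by (simp add: leibniz bracket_center)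
  have "bracket Lt (c \<odot>\<^bsub>Lt\<^esub> d_center Lt) u = \<ominus>\<^bsub>Lt\<^esub> bracket Lt u (c \<odot>\<^bsub>Lt\<^esub> d_center Lt)"
    by (rule bracket_swap) (use assms center_closed in simp_all)
  then show "bracket Lt (c \<odot>\<^bsub>Lt\<^esub> d_center Lt) u = (\<ominus>\<^bsub>A\<^esub> d_pi Lt u c) \<odot>\<^bsub>Lt\<^esub> d_center Lt"
    unfolding * using Lt.smult_l_minus [OF d_pi_closed [OF assms(2,1)] center_closed] by simp
qed

text \<open>Two multiples of \<open>D\<close> commute because \<open>d_pi\<close> kills AD, and both
  mixed brackets are multiples of \<open>D\<close>. The explicit coefficient serves as witness
  whenever a bracket has to be independent of lifts.\<close>

lemma bracket_shift:
  assumes "a \<in> carrier A" "b \<in> carrier A" "u \<in> carrier Lt" "v \<in> carrier Lt"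
  shows "bracket Lt (a \<odot>\<^bsub>Lt\<^esub> d_center Lt \<oplus>\<^bsub>Lt\<^esub> u) (b \<odot>\<^bsub>Lt\<^esub> d_center Lt \<oplus>\<^bsub>Lt\<^esub> v) =
    (d_pi Lt u b \<ominus>\<^bsub>A\<^esub> d_pi Lt v a) \<odot>\<^bsub>Lt\<^esub> d_center Lt \<oplus>\<^bsub>Lt\<^esub> bracket Lt u v"
proof -
  have "bracket Lt (a \<odot>\<^bsub>Lt\<^esub> d_center Lt) (b \<odot>\<^bsub>Lt\<^esub> d_center Lt) = \<zero>\<^bsub>Lt\<^esub>"
    using assms center_closed by (simp add: bracket_center_multiple d_pi_center_multiple)
  then show ?thesis
    using assms center_closed d_pi_closed
    by (simp add: bracket_add bracket_center_multiple d_pi_add d_pi_center_multiple bracket_closed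
        a_minus_def Lt.smult_l_distr Lt.a_ac)
qed

text \<open>The axiom \<open>d_action\<close> solved for the right action: modulo \<open>D\<close>
  the two actions agree.\<close>

lemma rsmult_eq:
  assumes "c \<in> carrier A" "u \<in> carrier Lt"
  shows "rsmult Lt u c = d_pi Lt u c \<odot>\<^bsub>Lt\<^esub> d_center Lt \<oplus>\<^bsub>Lt\<^esub> c \<odot>\<^bsub>Lt\<^esub> u"
  using d_action [OF assms] assms rsmult_closed Lt.minus_add_cancel [of "rsmult Lt u c" "c \<odot>\<^bsub>Lt\<^esub> u"]
  by simp

end

text \<open>With \<open>d_pi\<close> as anchor a D-Lie algebra is already a Lie-Rinehart algebra;
  this record forgets \<open>D\<close>, \<open>d_alpha\<close> and the right action. It is the
  common cover of the quotients to be compared.\<close>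

definition underlying_lie_rinehart :: "('a, 'b) d_lie \<Rightarrow> ('a, 'b) lie_rinehart" where
  "underlying_lie_rinehart Lt =
     \<lparr>carrier = carrier Lt, mult = mult Lt, one = one Lt, zero = zero Lt, add = add Lt,
      smult = smult Lt, lr_bracket = bracket Lt, anchor = d_pi Lt\<rparr>"

lemma underlying_lie_rinehart_simps [simp]:
  "carrier (underlying_lie_rinehart Lt) = carrier Lt"
  "zero (underlying_lie_rinehart Lt) = zero Lt"
  "add (underlying_lie_rinehart Lt) = add Lt"
  "smult (underlying_lie_rinehart Lt) = smult Lt"
  "lr_bracket (underlying_lie_rinehart Lt) = bracket Lt"
  "anchor (underlying_lie_rinehart Lt) = d_pi Lt"
  by (simp_all add: underlying_lie_rinehart_def)

lemma (in d_lie_algebra) lie_rinehart_underlying: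
  "lie_rinehart_algebra k A (underlying_lie_rinehart Lt)"
proof -
  interpret Lt: module A Lt by (rule A_module)
  have "abelian_group (underlying_lie_rinehart Lt)"
    using Lt.abelian_group_axioms by (rule abelian_group_cong) simp_all
  then have "module A (underlying_lie_rinehart Lt)"
    using M_cring
    by (intro moduleI) (simp_all add: Lt.smult_l_distr Lt.smult_r_distr Lt.smult_assoc1)
  moreover have "restrict_scalars A (underlying_lie_rinehart Lt) = restrict_scalars A Lt"
    by (simp add: restrict_scalars_def underlying_lie_rinehart_def)
  moreover have "linear_map A (underlying_lie_rinehart Lt) (Der k A) (d_pi Lt)"
    using d_pi_linear by (simp add: linear_map_def)
  ultimately show ?thesis
    using algebra lie_algebra_axioms pi_lie_hom
    by (intro lie_rinehart_algebra.intro lie_rinehart_algebra_axioms.intro) (simp_all add: leibniz)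
qed

text \<open>The axioms of a Lie-Rinehart algebra are equations, hence inherited by surjective images.\<close>

definition lie_rinehart_epi ::
    "('k, 'a) module \<Rightarrow> ('a, 'b) lie_rinehart \<Rightarrow> ('a, 'c) lie_rinehart \<Rightarrow> ('b \<Rightarrow> 'c) \<Rightarrow> bool" where
  "lie_rinehart_epi A X L q \<longleftrightarrow>
     q ` carrier X = carrier L \<and> linear_map A X L q \<and> q \<zero>\<^bsub>X\<^esub> = \<zero>\<^bsub>L\<^esub> \<and>
     (\<forall>x \<in> carrier X. \<forall>y \<in> carrier X. q (lr_bracket X x y) = lr_bracket L (q x) (q y)) \<and>
     (\<forall>x \<in> carrier X. anchor L (q x) = anchor X x)"

lemma lie_rinehart_epi_algebra:
  assumes "lie_rinehart_algebra k A X" and epi: "lie_rinehart_epi A X L q"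
  shows "lie_rinehart_algebra k A L"
proof -
  interpret X': module A X using assms(1) by (rule lie_rinehart_algebra.axioms)
  interpret X: lie_rinehart_algebra k A X by fact
  \<comment> \<open>The equations are oriented so that every term over \<open>L\<close> becomes the
    image of a term over \<open>X\<close>. The zero of \<open>L\<close> has to be given as an image:
    additivity of \<open>q\<close> yields it only once \<open>L\<close> is known to be a
    group.\<close>
  have onto: "carrier L = q ` carrier X"
    and q: "\<And>x y. \<lbrakk>x \<in> carrier X; y \<in> carrier X\<rbrakk> \<Longrightarrow> q x \<oplus>\<^bsub>L\<^esub> q y = q (x \<oplus>\<^bsub>X\<^esub> y)"
      "\<And>a x. \<lbrakk>a \<in> carrier A; x \<in> carrier X\<rbrakk> \<Longrightarrow> a \<odot>\<^bsub>L\<^esub> q x = q (a \<odot>\<^bsub>X\<^esub> x)"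
      "\<zero>\<^bsub>L\<^esub> = q \<zero>\<^bsub>X\<^esub>"
      "\<And>x y. \<lbrakk>x \<in> carrier X; y \<in> carrier X\<rbrakk> \<Longrightarrow> lr_bracket L (q x) (q y) = q (lr_bracket X x y)"
      "\<And>x. x \<in> carrier X \<Longrightarrow> anchor L (q x) = anchor X x"
    using epi by (auto simp: lie_rinehart_epi_def linear_map_def)
  have br: "lr_bracket X x y \<in> carrier X" if "x \<in> carrier X" "y \<in> carrier X" for x y
    using X.br_closed that by simp
  have "abelian_group L"
  proof (rule abelian_groupI)
    fix x assume "x \<in> carrier L"
    then obtain u where "u \<in> carrier X" "x = q u" by (auto simp: onto)
    then show "\<exists>y \<in> carrier L. y \<oplus>\<^bsub>L\<^esub> x = \<zero>\<^bsub>L\<^esub>"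
      by (intro bexI [of _ "q (\<ominus>\<^bsub>X\<^esub> u)"]) (auto simp: q onto X'.l_neg)
  qed (auto simp: onto q X'.a_ac)
  then have L: "module A L"
    using X'.R.is_cring
    by (intro moduleI) (auto simp: onto q X'.smult_l_distr X'.smult_r_distr X'.smult_assoc1)
  have "algebra k A" ..
  have k: "r \<odot>\<^bsub>A\<^esub> \<one>\<^bsub>A\<^esub> \<in> carrier A" if "r \<in> carrier k" for r
    using that by simp
  have lie: "lie_algebra k (restrict_scalars A L) (lr_bracket L)"
  proof (intro lie_algebra.intro lie_algebra_axioms.intro module_restrict_scalars L)
    show "algebra k A" by fact
    fix x assume "x \<in> carrier (restrict_scalars A L)"
    then obtain u where "u \<in> carrier X" "x = q u" by (auto simp: onto)
    then show "linear_map k (restrict_scalars A L) (restrict_scalars A L) (lr_bracket L x)"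
      "linear_map k (restrict_scalars A L) (restrict_scalars A L) (\<lambda>y. lr_bracket L y x)"
      "lr_bracket L x x = \<zero>\<^bsub>restrict_scalars A L\<^esub>"
      using X.br_add_right X.br_add_left X.br_smult_right X.br_smult_left X.br_alternating k
      by (auto intro!: linear_mapI simp: onto q br)
    fix y z assume "y \<in> carrier (restrict_scalars A L)" "z \<in> carrier (restrict_scalars A L)"
    then show "lr_bracket L x (lr_bracket L y z) \<oplus>\<^bsub>restrict_scalars A L\<^esub>
      lr_bracket L y (lr_bracket L z x) \<oplus>\<^bsub>restrict_scalars A L\<^esub> lr_bracket L z (lr_bracket L x y) =
      \<zero>\<^bsub>restrict_scalars A L\<^esub>"
      using X.jacobi \<open>u \<in> carrier X\<close> \<open>x = q u\<close> by (auto simp: onto q br)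
  qed
  have anchor: "linear_map A L (Der k A) (anchor L)"
    using X.anchor_linear by (auto simp: linear_map_def onto q)
  have hom: "lie_hom k (restrict_scalars A L) (lr_bracket L)
          (restrict_scalars A (Der k A)) (bracket (Der k A)) (anchor L)"
    using X.anchor_lie_hom k by (auto simp: lie_hom_def linear_map_def onto q br)
  have leibniz: "lr_bracket L x (a \<odot>\<^bsub>L\<^esub> y) = a \<odot>\<^bsub>L\<^esub> lr_bracket L x y \<oplus>\<^bsub>L\<^esub> anchor L x a \<odot>\<^bsub>L\<^esub> y"
    if "a \<in> carrier A" "x \<in> carrier L" "y \<in> carrier L" for a x y
  proof -
    from that obtain u v where "u \<in> carrier X" "x = q u" "v \<in> carrier X" "y = q v"
      by (auto simp: onto)
    moreover have "anchor X u a \<in> carrier A"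
      using linear_mapD(1) [OF X.anchor_linear \<open>u \<in> carrier X\<close>] \<open>a \<in> carrier A\<close>
      by (auto dest: derivationsD(1))
    ultimately show ?thesis
      using \<open>a \<in> carrier A\<close> X.leibniz [of a u v] by (simp add: q br)
  qed
  have "lie_rinehart_algebra_axioms k A L"
    using anchor hom leibniz by (rule lie_rinehart_algebra_axioms.intro)
  with \<open>algebra k A\<close> L lie show ?thesis
    by (rule lie_rinehart_algebra.intro)
qed

text \<open>The first isomorphism theorem: both targets are \<open>X\<close> modulo the same
  congruence. The map sends a point to the image under \<open>r\<close> of a chosen preimage under
  \<open>q\<close>, and \<open>kernel\<close> makes the choice immaterial.\<close>

lemma lie_rinehart_epi_isomorphic:
  assumes X: "lie_rinehart_algebra k A X"
    and q: "lie_rinehart_epi A X L q" and r: "lie_rinehart_epi A X L' r"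
    and kernel: "\<And>x y. \<lbrakk>x \<in> carrier X; y \<in> carrier X\<rbrakk> \<Longrightarrow> q x = q y \<longleftrightarrow> r x = r y"
  shows "lie_rinehart_isomorphic k A L L'"
proof -
  interpret X': module A X using assms(1) by (rule lie_rinehart_algebra.axioms)
  interpret X: lie_rinehart_algebra k A X by fact
  define h where "h = (\<lambda>z. r (SOME x. x \<in> carrier X \<and> q x = z))"
  have h: "h (q x) = r x" if "x \<in> carrier X" for x
  proof -
    have "(SOME y. y \<in> carrier X \<and> q y = q x) \<in> carrier X \<and>
        q (SOME y. y \<in> carrier X \<and> q y = q x) = q x"
      by (rule someI) (use that in simp)
    then show ?thesis
      unfolding h_def using kernel that by blast
  qed
  have onto: "carrier L = q ` carrier X" "carrier L' = r ` carrier X"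
    using q r by (auto simp: lie_rinehart_epi_def)
  have br: "lr_bracket X x y \<in> carrier X" if "x \<in> carrier X" "y \<in> carrier X" for x y
    using X.br_closed that by simp
  note q' = q [unfolded lie_rinehart_epi_def linear_map_def]
  note r' = r [unfolded lie_rinehart_epi_def linear_map_def]
  have bij: "bij_betw h (carrier L) (carrier L')"
    unfolding bij_betw_def inj_on_def onto by (auto simp: h kernel image_image)
  have lin: "linear_map A L L' h"
  proof (rule linear_mapI)
    fix x assume "x \<in> carrier L"
    then show "h x \<in> carrier L'" by (auto simp: onto h)
  next
    fix x y assume "x \<in> carrier L" "y \<in> carrier L"
    then obtain u v where "u \<in> carrier X" "x = q u" "v \<in> carrier X" "y = q v" by (auto simp: onto)
    then show "h (x \<oplus>\<^bsub>L\<^esub> y) = h x \<oplus>\<^bsub>L'\<^esub> h y"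
      using h [of "u \<oplus>\<^bsub>X\<^esub> v"] q' r' by (simp add: h)
  next
    fix a x assume "a \<in> carrier A" "x \<in> carrier L"
    then obtain u where "u \<in> carrier X" "x = q u" by (auto simp: onto)
    then show "h (a \<odot>\<^bsub>L\<^esub> x) = a \<odot>\<^bsub>L'\<^esub> h x"
      using h [of "a \<odot>\<^bsub>X\<^esub> u"] q' r' \<open>a \<in> carrier A\<close> by (simp add: h)
  qed
  have hbr: "h (lr_bracket L x y) = lr_bracket L' (h x) (h y)" if "x \<in> carrier L" "y \<in> carrier L" for x y
  proof -
    from that obtain u v where "u \<in> carrier X" "x = q u" "v \<in> carrier X" "y = q v"
      by (auto simp: onto)
    then show ?thesis
      using h [of "lr_bracket X u v"] q' r' by (simp add: h br)
  qed
  have hanchor: "anchor L' (h x) = anchor L x" if "x \<in> carrier L" for x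
  proof -
    from that obtain u where "u \<in> carrier X" "x = q u" by (auto simp: onto)
    then show ?thesis using q' r' by (simp add: h)
  qed
  have "lie_hom k (restrict_scalars A L) (lr_bracket L) (restrict_scalars A L') (lr_bracket L') h"
    unfolding lie_hom_def using linear_map_restrict_scalars [OF X.algebra_axioms lin] hbr by simp
  then show ?thesis
    unfolding lie_rinehart_isomorphic_def
    using bij lin hanchor lie_rinehart_epi_algebra [OF X q] lie_rinehart_epi_algebra [OF X r] by blast
qed

section \<open>The canonical quotient as an image\<close>

context d_lie_algebra
begin

interpretation Lt: module A Lt by (rule A_module)

lemma center_span_subgroup: "abelian_subgroup (center_span A Lt) Lt"
proof -
  have "additive_subgroup (center_span A Lt) Lt"
  proof (intro additive_subgroup.intro subgroup.intro)
    fix x y assume "x \<in> center_span A Lt" "y \<in> center_span A Lt"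
    then obtain a b where "a \<in> carrier A" "x = a \<odot>\<^bsub>Lt\<^esub> d_center Lt" "b \<in> carrier A"
      "y = b \<odot>\<^bsub>Lt\<^esub> d_center Lt"
      by (auto simp: center_span_def)
    then show "x \<otimes>\<^bsub>add_monoid Lt\<^esub> y \<in> center_span A Lt"
      using center_closed
      by (auto simp: center_span_def Lt.smult_l_distr intro!: exI [of _ "a \<oplus>\<^bsub>A\<^esub> b"])
  next
    fix x assume "x \<in> center_span A Lt"
    then obtain a where "a \<in> carrier A" "x = a \<odot>\<^bsub>Lt\<^esub> d_center Lt"
      by (auto simp: center_span_def)
    then have "\<ominus>\<^bsub>Lt\<^esub> x = (\<ominus>\<^bsub>A\<^esub> a) \<odot>\<^bsub>Lt\<^esub> d_center Lt" "\<ominus>\<^bsub>A\<^esub> a \<in> carrier A"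
      using center_closed by (simp_all add: Lt.smult_l_minus)
    then show "inv\<^bsub>add_monoid Lt\<^esub> x \<in> center_span A Lt"
      unfolding a_inv_def center_span_def by blast
  next
    show "\<one>\<^bsub>add_monoid Lt\<^esub> \<in> center_span A Lt"
      using center_closed by (auto simp: center_span_def intro!: exI [of _ "\<zero>\<^bsub>A\<^esub>"])
  qed (use center_closed in \<open>auto simp: center_span_def\<close>)
  then show ?thesis
    using Lt.abelian_group_axioms Lt.a_comm by (intro abelian_subgroupI3)
qed

interpretation J: abelian_subgroup "center_span A Lt" Lt by (rule center_span_subgroup)

abbreviation coset :: "'b \<Rightarrow> 'b set" where
  "coset u \<equiv> center_span A Lt +>\<^bsub>Lt\<^esub> u"

lemma coset_mem_iff:
  "v \<in> coset u \<longleftrightarrow> (\<exists>a \<in> carrier A. v = a \<odot>\<^bsub>Lt\<^esub> d_center Lt \<oplus>\<^bsub>Lt\<^esub> u)"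
  by (auto simp: a_r_coset_def' center_span_def)

lemma coset_eq_iff:
  assumes "u \<in> carrier Lt" "v \<in> carrier Lt"
  shows "coset u = coset v \<longleftrightarrow> (\<exists>a \<in> carrier A. u = a \<odot>\<^bsub>Lt\<^esub> d_center Lt \<oplus>\<^bsub>Lt\<^esub> v)"
  unfolding coset_mem_iff [symmetric]
  using assms J.a_repr_independence' [of u v] J.a_rcos_self [of u] by auto

lemma coset_self: "u \<in> carrier Lt \<Longrightarrow> u \<in> coset u"
  by (rule J.a_rcos_self)

lemma carrier_canonical_quotient: "carrier (canonical_quotient A Lt) = coset ` carrier Lt"
  by (auto simp: canonical_quotient_def A_RCOSETS_def' Let_def)

text \<open>Scalar multiplication and bracket of the quotient are unions of cosets over all
  representatives. Changing a representative by an element of AD changes the result by an element of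
  AD, so each union is over copies of a single coset.\<close>

lemma canonical_quotient_epi:
  "lie_rinehart_epi A (underlying_lie_rinehart Lt) (canonical_quotient A Lt) coset"
proof -
  have smult: "coset (a \<odot>\<^bsub>Lt\<^esub> u) = a \<odot>\<^bsub>canonical_quotient A Lt\<^esub> coset u"
    if "a \<in> carrier A" "u \<in> carrier Lt" for a u
  proof -
    have "coset (a \<odot>\<^bsub>Lt\<^esub> v) = coset (a \<odot>\<^bsub>Lt\<^esub> u)" if "v \<in> coset u" for v
    proof -
      from that obtain b where "b \<in> carrier A" "v = b \<odot>\<^bsub>Lt\<^esub> d_center Lt \<oplus>\<^bsub>Lt\<^esub> u"
        by (auto simp: coset_mem_iff)
      then show ?thesis
        using \<open>a \<in> carrier A\<close> \<open>u \<in> carrier Lt\<close> center_closed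
        by (subst coset_eq_iff)
          (auto simp: Lt.smult_r_distr Lt.smult_assoc1 intro!: bexI [of _ "a \<otimes>\<^bsub>A\<^esub> b"])
    qed
    then have "(\<Union>v \<in> coset u. coset (a \<odot>\<^bsub>Lt\<^esub> v)) = coset (a \<odot>\<^bsub>Lt\<^esub> u)"
      using coset_self [OF \<open>u \<in> carrier Lt\<close>] by (intro SUP_eq_const) blast+
    then show ?thesis by (simp add: canonical_quotient_def Let_def)
  qed
  have bracket: "coset (bracket Lt u v) = lr_bracket (canonical_quotient A Lt) (coset u) (coset v)"
    if "u \<in> carrier Lt" "v \<in> carrier Lt" for u v
  proof -
    have "coset (bracket Lt u' v') = coset (bracket Lt u v)" if "u' \<in> coset u" "v' \<in> coset v" for u' v'
    proof -
      from that obtain a b where "a \<in> carrier A" "u' = a \<odot>\<^bsub>Lt\<^esub> d_center Lt \<oplus>\<^bsub>Lt\<^esub> u"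
        "b \<in> carrier A" "v' = b \<odot>\<^bsub>Lt\<^esub> d_center Lt \<oplus>\<^bsub>Lt\<^esub> v"
        by (auto simp: coset_mem_iff)
      then show ?thesis
        using \<open>u \<in> carrier Lt\<close> \<open>v \<in> carrier Lt\<close> center_closed bracket_closed d_pi_closed
        by (subst coset_eq_iff)
          (auto simp: bracket_shift intro!: bexI [of _ "d_pi Lt u b \<ominus>\<^bsub>A\<^esub> d_pi Lt v a"])
    qed
    then have "(\<Union>u' \<in> coset u. \<Union>v' \<in> coset v. coset (bracket Lt u' v')) = coset (bracket Lt u v)"
      using coset_self [OF that(1)] coset_self [OF that(2)] by (intro SUP_eq_const) blast+
    then show ?thesis by (simp add: canonical_quotient_def Let_def)
  qed
  have anchor: "anchor (canonical_quotient A Lt) (coset u) = d_pi Lt u" if "u \<in> carrier Lt" for u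
  proof -
    have "d_pi Lt ` coset u = {d_pi Lt u}"
      using that coset_self [OF that] d_pi_shift by (force simp: coset_mem_iff)
    then show ?thesis by (simp add: canonical_quotient_def Let_def)
  qed
  have "coset \<zero>\<^bsub>Lt\<^esub> = \<zero>\<^bsub>canonical_quotient A Lt\<^esub>"
    using Lt.a_coset_add_zero [OF J.a_subset] by (simp add: canonical_quotient_def Let_def)
  moreover have "coset (u \<oplus>\<^bsub>Lt\<^esub> v) = coset u \<oplus>\<^bsub>canonical_quotient A Lt\<^esub> coset v"
    if "u \<in> carrier Lt" "v \<in> carrier Lt" for u v
    using J.a_rcos_sum [OF that] by (simp add: canonical_quotient_def Let_def)
  ultimately show ?thesis
    using smult bracket anchor
    by (auto simp: lie_rinehart_epi_def carrier_canonical_quotient intro!: linear_mapI)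
qed

lemma lie_rinehart_canonical_quotient: "lie_rinehart_algebra k A (canonical_quotient A Lt)"
  using lie_rinehart_underlying canonical_quotient_epi by (rule lie_rinehart_epi_algebra)

end

section \<open>Embedding Lie algebras\<close>

text \<open>The Jacobi identity for commutators after evaluation at a vector. The letters are the
  values of pqr, prq, qrp, rqp, qpr and rpq, in this order, and each occurs once with either
  sign.\<close>

lemma (in abelian_group) six_term_cancel:
  assumes "a \<in> carrier G" "b \<in> carrier G" "c \<in> carrier G" "d \<in> carrier G" "e \<in> carrier G" "f \<in> carrier G"
  shows "(a \<ominus> b \<ominus> (c \<ominus> d)) \<oplus> (c \<ominus> e \<ominus> (f \<ominus> b)) \<oplus> (f \<ominus> d \<ominus> (a \<ominus> e)) = \<zero>"
proof -
  have "(a \<ominus> b \<ominus> (c \<ominus> d)) \<oplus> (c \<ominus> e \<ominus> (f \<ominus> b)) \<oplus> (f \<ominus> d \<ominus> (a \<ominus> e)) =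
      (a \<oplus> b \<oplus> c \<oplus> d \<oplus> e \<oplus> f) \<ominus> (a \<oplus> b \<oplus> c \<oplus> d \<oplus> e \<oplus> f)"
    using assms by (simp add: a_minus_def minus_add a_ac)
  then show ?thesis
    using assms by (simp add: a_minus_def r_neg)
qed

text \<open>With the values of PQ in one bracket and those of QP in the other, this gives additivity
  of a commutator in the vector and in each operator.\<close>

lemma (in abelian_group) commutator_additive:
  assumes "a \<in> carrier G" "b \<in> carrier G" "c \<in> carrier G" "d \<in> carrier G"
  shows "(a \<oplus> b) \<ominus> (c \<oplus> d) = (a \<ominus> c) \<oplus> (b \<ominus> d)"
  using assms by (simp add: a_minus_def minus_add a_ac)

section \<open>Operators on a module and their commutators\<close>

lemma op_simps [simp]:
  "e \<in> carrier E \<Longrightarrow> op_id E e = e"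
  "e \<in> carrier E \<Longrightarrow> op_zero E e = \<zero>\<^bsub>E\<^esub>"
  "e \<in> carrier E \<Longrightarrow> op_scalar E a e = a \<odot>\<^bsub>E\<^esub> e"
  "e \<in> carrier E \<Longrightarrow> op_add E p q e = p e \<oplus>\<^bsub>E\<^esub> q e"
  "e \<in> carrier E \<Longrightarrow> op_diff E p q e = p e \<ominus>\<^bsub>E\<^esub> q e"
  "e \<in> carrier E \<Longrightarrow> op_comm E p q e = p (q e) \<ominus>\<^bsub>E\<^esub> q (p e)"
  by (simp_all add: op_id_def op_zero_def op_scalar_def op_add_def op_diff_def op_comm_def compose_def)

lemma op_extensional [simp]:
  "op_id E \<in> extensional (carrier E)" "op_zero E \<in> extensional (carrier E)"
  "op_scalar E a \<in> extensional (carrier E)" "op_add E p q \<in> extensional (carrier E)"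
  "op_diff E p q \<in> extensional (carrier E)" "op_comm E p q \<in> extensional (carrier E)"
  "compose (carrier E) p q \<in> extensional (carrier E)"
  by (simp_all add: op_id_def op_zero_def op_scalar_def op_add_def op_diff_def op_comm_def compose_def)

lemma op_restrict_scalars [simp]:
  "op_zero (restrict_scalars A E) = op_zero E"
  "op_add (restrict_scalars A E) = op_add E"
  "op_diff (restrict_scalars A E) = op_diff E"
  "op_comm (restrict_scalars A E) = op_comm E"
  by (simp_all add: op_zero_def op_add_def op_diff_def op_comm_def a_minus_def fun_eq_iff)

lemma linear_endos_iff:
  "p \<in> linear_endos k E \<longleftrightarrow> p \<in> extensional (carrier E) \<and> linear_map k E E p"
  by (auto simp: linear_endos_def linear_map_def PiE_def)

lemma A_endos_iff:
  "p \<in> A_endos A E \<longleftrightarrow> p \<in> extensional (carrier E) \<and> linear_map A E E p"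
  by (auto simp: A_endos_def linear_map_def PiE_def)

text \<open>The usual general linear Lie algebra, with \<open>op_comm\<close> as bracket. It is
  applied to \<open>restrict_scalars A E\<close>, because the operators of a connection are only
  \<open>k\<close>-linear.\<close>

definition gl :: "'k ring \<Rightarrow> ('k, 'e) module \<Rightarrow> ('k, 'e \<Rightarrow> 'e) module" where
  "gl k E = \<lparr>carrier = linear_endos k E, mult = undefined, one = undefined, zero = op_zero E,
     add = op_add E, smult = (\<lambda>r p. compose (carrier E) (op_scalar E r) p)\<rparr>"

lemma gl_simps [simp]:
  "carrier (gl k E) = linear_endos k E" "zero (gl k E) = op_zero E" "add (gl k E) = op_add E"
  "r \<odot>\<^bsub>gl k E\<^esub> p = compose (carrier E) (op_scalar E r) p"
  by (simp_all add: gl_def)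

context
  fixes k :: "'k ring" and E :: "('k, 'e) module"
  assumes module: "module k E"
begin

interpretation module k E by (rule module)

lemma linear_endosD:
  assumes "p \<in> linear_endos k E"
  shows "p \<in> extensional (carrier E)" "\<And>e. e \<in> carrier E \<Longrightarrow> p e \<in> carrier E"
    "\<And>e e'. \<lbrakk>e \<in> carrier E; e' \<in> carrier E\<rbrakk> \<Longrightarrow> p (e \<oplus>\<^bsub>E\<^esub> e') = p e \<oplus>\<^bsub>E\<^esub> p e'"
    "\<And>r e. \<lbrakk>r \<in> carrier k; e \<in> carrier E\<rbrakk> \<Longrightarrow> p (r \<odot>\<^bsub>E\<^esub> e) = r \<odot>\<^bsub>E\<^esub> p e"
    "\<And>e. e \<in> carrier E \<Longrightarrow> p (\<ominus>\<^bsub>E\<^esub> e) = \<ominus>\<^bsub>E\<^esub> p e"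
    "\<And>e e'. \<lbrakk>e \<in> carrier E; e' \<in> carrier E\<rbrakk> \<Longrightarrow> p (e \<ominus>\<^bsub>E\<^esub> e') = p e \<ominus>\<^bsub>E\<^esub> p e'"
proof -
  show p: "p \<in> extensional (carrier E)" "\<And>e. e \<in> carrier E \<Longrightarrow> p e \<in> carrier E"
    "\<And>e e'. \<lbrakk>e \<in> carrier E; e' \<in> carrier E\<rbrakk> \<Longrightarrow> p (e \<oplus>\<^bsub>E\<^esub> e') = p e \<oplus>\<^bsub>E\<^esub> p e'"
    "\<And>r e. \<lbrakk>r \<in> carrier k; e \<in> carrier E\<rbrakk> \<Longrightarrow> p (r \<odot>\<^bsub>E\<^esub> e) = r \<odot>\<^bsub>E\<^esub> p e"
    using assms by (auto simp: linear_endos_iff linear_map_def)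
  interpret abelian_group_hom E E p
    using p by unfold_locales (auto simp: hom_def)
  show "\<And>e. e \<in> carrier E \<Longrightarrow> p (\<ominus>\<^bsub>E\<^esub> e) = \<ominus>\<^bsub>E\<^esub> p e"
    by simp
  then show "\<And>e e'. \<lbrakk>e \<in> carrier E; e' \<in> carrier E\<rbrakk> \<Longrightarrow> p (e \<ominus>\<^bsub>E\<^esub> e') = p e \<ominus>\<^bsub>E\<^esub> p e'"
    by (simp add: a_minus_def p)
qed

lemma linear_endosI:
  assumes "p \<in> extensional (carrier E)" "\<And>e. e \<in> carrier E \<Longrightarrow> p e \<in> carrier E"
    "\<And>e e'. \<lbrakk>e \<in> carrier E; e' \<in> carrier E\<rbrakk> \<Longrightarrow> p (e \<oplus>\<^bsub>E\<^esub> e') = p e \<oplus>\<^bsub>E\<^esub> p e'"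
    "\<And>r e. \<lbrakk>r \<in> carrier k; e \<in> carrier E\<rbrakk> \<Longrightarrow> p (r \<odot>\<^bsub>E\<^esub> e) = r \<odot>\<^bsub>E\<^esub> p e"
  shows "p \<in> linear_endos k E"
  using assms by (simp add: linear_endos_iff linear_map_def)

lemma smult_r_minus':
  "\<lbrakk>r \<in> carrier k; x \<in> carrier E; y \<in> carrier E\<rbrakk> \<Longrightarrow> r \<odot>\<^bsub>E\<^esub> (x \<ominus>\<^bsub>E\<^esub> y) = r \<odot>\<^bsub>E\<^esub> x \<ominus>\<^bsub>E\<^esub> r \<odot>\<^bsub>E\<^esub> y"
  by (simp add: a_minus_def smult_r_distr smult_r_minus)

lemma gl_closed:
  shows "op_zero E \<in> linear_endos k E"
    and "\<lbrakk>p \<in> linear_endos k E; q \<in> linear_endos k E\<rbrakk> \<Longrightarrow> op_add E p q \<in> linear_endos k E"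
    and "\<lbrakk>r \<in> carrier k; p \<in> linear_endos k E\<rbrakk> \<Longrightarrow> compose (carrier E) (op_scalar E r) p \<in> linear_endos k E"
    and "\<lbrakk>p \<in> linear_endos k E; q \<in> linear_endos k E\<rbrakk> \<Longrightarrow> op_comm E p q \<in> linear_endos k E"
proof -
  show "op_zero E \<in> linear_endos k E"
    by (rule linear_endosI) simp_all
next
  assume p: "p \<in> linear_endos k E" and q: "q \<in> linear_endos k E"
  note [simp] = linear_endosD(2-6) [OF p] linear_endosD(2-6) [OF q]
  show "op_add E p q \<in> linear_endos k E"
    by (rule linear_endosI) (simp_all add: smult_r_distr M.a_ac)
  show "op_comm E p q \<in> linear_endos k E"
    by (rule linear_endosI) (simp_all add: smult_r_minus' M.commutator_additive)
next
  assume r: "r \<in> carrier k" and p: "p \<in> linear_endos k E"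
  note [simp] = linear_endosD(2-6) [OF p]
  have "s \<odot>\<^bsub>E\<^esub> (r \<odot>\<^bsub>E\<^esub> e) = r \<odot>\<^bsub>E\<^esub> (s \<odot>\<^bsub>E\<^esub> e)" if "s \<in> carrier k" "e \<in> carrier E" for s e
    using r that by (simp add: smult_assoc1 [symmetric] R.m_comm)
  then show "compose (carrier E) (op_scalar E r) p \<in> linear_endos k E"
    using r by (intro linear_endosI) (simp_all add: compose_def smult_r_distr)
qed

lemma gl_module: "module k (gl k E)"
proof (rule moduleI)
  show "abelian_group (gl k E)"
  proof (rule abelian_groupI)
    fix p assume p: "p \<in> carrier (gl k E)"
    then have p': "p \<in> linear_endos k E" by simp
    note [simp] = linear_endosD(2-6) [OF p']
    let ?n = "compose (carrier E) (op_scalar E (\<ominus>\<^bsub>k\<^esub> \<one>\<^bsub>k\<^esub>)) p"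
    have "?n \<oplus>\<^bsub>gl k E\<^esub> p = \<zero>\<^bsub>gl k E\<^esub>"
      by (rule extensionalityI [of _ "carrier E"]) (simp_all add: compose_def smult_l_minus M.l_neg)
    then show "\<exists>q \<in> carrier (gl k E). q \<oplus>\<^bsub>gl k E\<^esub> p = \<zero>\<^bsub>gl k E\<^esub>"
      using gl_closed(3) [OF _ p'] by (intro bexI [of _ ?n]) simp_all
  next
    fix p assume p: "p \<in> carrier (gl k E)"
    then show "\<zero>\<^bsub>gl k E\<^esub> \<oplus>\<^bsub>gl k E\<^esub> p = p"
      by (intro extensionalityI [of _ "carrier E"]) (simp_all add: linear_endosD)
  next
    fix p q assume "p \<in> carrier (gl k E)" "q \<in> carrier (gl k E)"
    then show "p \<oplus>\<^bsub>gl k E\<^esub> q = q \<oplus>\<^bsub>gl k E\<^esub> p"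
      by (intro extensionalityI [of _ "carrier E"]) (simp_all add: linear_endosD M.a_comm)
  next
    fix p q r assume "p \<in> carrier (gl k E)" "q \<in> carrier (gl k E)" "r \<in> carrier (gl k E)"
    then show "p \<oplus>\<^bsub>gl k E\<^esub> q \<oplus>\<^bsub>gl k E\<^esub> r = p \<oplus>\<^bsub>gl k E\<^esub> (q \<oplus>\<^bsub>gl k E\<^esub> r)"
      by (intro extensionalityI [of _ "carrier E"]) (simp_all add: linear_endosD M.a_assoc)
  qed (simp_all add: gl_closed)
next
  fix a b p assume "a \<in> carrier k" "b \<in> carrier k" "p \<in> carrier (gl k E)"
  then show "(a \<oplus>\<^bsub>k\<^esub> b) \<odot>\<^bsub>gl k E\<^esub> p = a \<odot>\<^bsub>gl k E\<^esub> p \<oplus>\<^bsub>gl k E\<^esub> b \<odot>\<^bsub>gl k E\<^esub> p"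
    "(a \<otimes>\<^bsub>k\<^esub> b) \<odot>\<^bsub>gl k E\<^esub> p = a \<odot>\<^bsub>gl k E\<^esub> (b \<odot>\<^bsub>gl k E\<^esub> p)"
    by (intro extensionalityI [of _ "carrier E"];
        simp add: linear_endosD compose_def smult_l_distr smult_assoc1)+
next
  fix a p q assume "a \<in> carrier k" "p \<in> carrier (gl k E)" "q \<in> carrier (gl k E)"
  then show "a \<odot>\<^bsub>gl k E\<^esub> (p \<oplus>\<^bsub>gl k E\<^esub> q) = a \<odot>\<^bsub>gl k E\<^esub> p \<oplus>\<^bsub>gl k E\<^esub> a \<odot>\<^bsub>gl k E\<^esub> q"
    by (intro extensionalityI [of _ "carrier E"]) (simp_all add: linear_endosD compose_def smult_r_distr)
next
  fix p assume "p \<in> carrier (gl k E)"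
  then show "\<one>\<^bsub>k\<^esub> \<odot>\<^bsub>gl k E\<^esub> p = p"
    by (intro extensionalityI [of _ "carrier E"]) (simp_all add: linear_endosD compose_def)
qed (simp_all add: R.is_cring gl_closed)

lemma gl_lie_algebra:
  "lie_algebra k (gl k E) (op_comm E)"
proof -
  have "linear_map k (gl k E) (gl k E) (op_comm E p)"
    "linear_map k (gl k E) (gl k E) (\<lambda>q. op_comm E q p)" if p: "p \<in> linear_endos k E" for p
  proof -
    note [simp] = linear_endosD(2-6) [OF p]
    show "linear_map k (gl k E) (gl k E) (op_comm E p)"
    proof (rule linear_mapI)
      fix q q' assume "q \<in> carrier (gl k E)" "q' \<in> carrier (gl k E)"
      then show "op_comm E p (q \<oplus>\<^bsub>gl k E\<^esub> q') = op_comm E p q \<oplus>\<^bsub>gl k E\<^esub> op_comm E p q'"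
        by (intro extensionalityI [of _ "carrier E"])
          (simp_all add: linear_endosD M.commutator_additive)
    next
      fix r q assume "r \<in> carrier k" "q \<in> carrier (gl k E)"
      then show "op_comm E p (r \<odot>\<^bsub>gl k E\<^esub> q) = r \<odot>\<^bsub>gl k E\<^esub> op_comm E p q"
        by (intro extensionalityI [of _ "carrier E"])
          (simp_all add: linear_endosD compose_def smult_r_minus')
    qed (simp add: gl_closed p)
    show "linear_map k (gl k E) (gl k E) (\<lambda>q. op_comm E q p)"
    proof (rule linear_mapI)
      fix q q' assume "q \<in> carrier (gl k E)" "q' \<in> carrier (gl k E)"
      then show "op_comm E (q \<oplus>\<^bsub>gl k E\<^esub> q') p = op_comm E q p \<oplus>\<^bsub>gl k E\<^esub> op_comm E q' p"
        by (intro extensionalityI [of _ "carrier E"])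
          (simp_all add: linear_endosD M.commutator_additive)
    next
      fix r q assume "r \<in> carrier k" "q \<in> carrier (gl k E)"
      then show "op_comm E (r \<odot>\<^bsub>gl k E\<^esub> q) p = r \<odot>\<^bsub>gl k E\<^esub> op_comm E q p"
        by (intro extensionalityI [of _ "carrier E"])
          (simp_all add: linear_endosD compose_def smult_r_minus')
    qed (simp add: gl_closed p)
  qed
  moreover have "op_comm E p p = \<zero>\<^bsub>gl k E\<^esub>" if "p \<in> linear_endos k E" for p
    using that by (intro extensionalityI [of _ "carrier E"]) (simp_all add: linear_endosD M.r_neg a_minus_def)
  moreover have "op_comm E p (op_comm E q r) \<oplus>\<^bsub>gl k E\<^esub> op_comm E q (op_comm E r p) \<oplus>\<^bsub>gl k E\<^esub>
      op_comm E r (op_comm E p q) = \<zero>\<^bsub>gl k E\<^esub>"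
    if "p \<in> linear_endos k E" "q \<in> linear_endos k E" "r \<in> linear_endos k E" for p q r
    using that
    by (intro extensionalityI [of _ "carrier E"]) (simp_all add: linear_endosD M.six_term_cancel)
  ultimately show ?thesis
    using gl_module by (simp add: lie_algebra_def lie_algebra_axioms_def)
qed

end

lemma linear_map_zero:
  assumes "module R M" "module R N" "linear_map R M N h"
  shows "h \<zero>\<^bsub>M\<^esub> = \<zero>\<^bsub>N\<^esub>"
proof -
  interpret M: module R M by fact
  interpret N: module R N by fact
  interpret abelian_group_hom M N h
    using linear_mapD [OF assms(3)] by unfold_locales (auto simp: hom_def)
  show ?thesis by simp
qed

text \<open>\<open>V\<close> behaves like a subalgebra of W1 x W2. Each axiom is an equation in
  \<open>V\<close>, so it suffices to compare both images; neither map has to be injective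
  alone.\<close>

lemma lie_algebra_embed:
  assumes V: "module k V" and W1: "lie_algebra k W1 br1" and W2: "lie_algebra k W2 br2"
    and h1: "linear_map k V W1 h1" and h2: "linear_map k V W2 h2"
    and inj: "\<And>x y. \<lbrakk>x \<in> carrier V; y \<in> carrier V; h1 x = h1 y; h2 x = h2 y\<rbrakk> \<Longrightarrow> x = y"
    and br: "\<And>x y. \<lbrakk>x \<in> carrier V; y \<in> carrier V\<rbrakk> \<Longrightarrow>
      br x y \<in> carrier V \<and> h1 (br x y) = br1 (h1 x) (h1 y) \<and> h2 (br x y) = br2 (h2 x) (h2 y)"
  shows "lie_algebra k V br"
proof -
  interpret V: module k V by fact
  interpret W1: lie_algebra k W1 br1 by fact
  interpret W2: lie_algebra k W2 br2 by fact
  have zero: "h1 \<zero>\<^bsub>V\<^esub> = \<zero>\<^bsub>W1\<^esub>" "h2 \<zero>\<^bsub>V\<^esub> = \<zero>\<^bsub>W2\<^esub>"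
    by (rule linear_map_zero [OF V W1.module_axioms h1] linear_map_zero [OF V W2.module_axioms h2])+
  note [simp] = linear_mapD [OF h1] linear_mapD [OF h2] br zero
    W1.br_add_left W1.br_add_right W1.br_smult_left W1.br_smult_right W1.br_alternating
    W2.br_add_left W2.br_add_right W2.br_smult_left W2.br_smult_right W2.br_alternating
  have "linear_map k V V (br x)" "linear_map k V V (\<lambda>y. br y x)" "br x x = \<zero>\<^bsub>V\<^esub>"
    if "x \<in> carrier V" for x
    using that by (auto intro!: linear_mapI inj)
  moreover have "br x (br y z) \<oplus>\<^bsub>V\<^esub> br y (br z x) \<oplus>\<^bsub>V\<^esub> br z (br x y) = \<zero>\<^bsub>V\<^esub>"
    if "x \<in> carrier V" "y \<in> carrier V" "z \<in> carrier V" for x y z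
    using that by (intro inj) (simp_all add: W1.jacobi W2.jacobi)
  ultimately show ?thesis
    using V by (simp add: lie_algebra_def lie_algebra_axioms_def)
qed

section \<open>The endomorphism algebra of a connection\<close>

text \<open>The operators whose commutator with multiplication by \<open>c\<close> is multiplication
  by \<open>d c\<close>; \<open>d\<close> plays the role of a symbol. It may be any function, so the
  notion covers \<open>A\<close>-linear maps, with symbol 0, as well as the operators of a
  connection, with symbol \<open>d_pi Lt u\<close>.\<close>

definition first_order_op ::
    "('k, 'a) module \<Rightarrow> ('a, 'e) module \<Rightarrow> ('a \<Rightarrow> 'a) \<Rightarrow> ('e \<Rightarrow> 'e) \<Rightarrow> bool" where
  "first_order_op A E d P \<longleftrightarrow> P \<in> extensional (carrier E) \<and>
     (\<forall>e \<in> carrier E. P e \<in> carrier E) \<and>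
     (\<forall>e \<in> carrier E. \<forall>e' \<in> carrier E. P (e \<oplus>\<^bsub>E\<^esub> e') = P e \<oplus>\<^bsub>E\<^esub> P e') \<and>
     (\<forall>c \<in> carrier A. \<forall>e \<in> carrier E. P (c \<odot>\<^bsub>E\<^esub> e) = c \<odot>\<^bsub>E\<^esub> P e \<oplus>\<^bsub>E\<^esub> d c \<odot>\<^bsub>E\<^esub> e)"

lemma first_order_opI:
  assumes "P \<in> extensional (carrier E)" "\<And>e. e \<in> carrier E \<Longrightarrow> P e \<in> carrier E"
    and "\<And>e e'. \<lbrakk>e \<in> carrier E; e' \<in> carrier E\<rbrakk> \<Longrightarrow> P (e \<oplus>\<^bsub>E\<^esub> e') = P e \<oplus>\<^bsub>E\<^esub> P e'"
    and "\<And>c e. \<lbrakk>c \<in> carrier A; e \<in> carrier E\<rbrakk> \<Longrightarrow>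
      P (c \<odot>\<^bsub>E\<^esub> e) = c \<odot>\<^bsub>E\<^esub> P e \<oplus>\<^bsub>E\<^esub> d c \<odot>\<^bsub>E\<^esub> e"
  shows "first_order_op A E d P"
  using assms by (simp add: first_order_op_def)

lemma first_order_op_cong:
  assumes "first_order_op A E d P" "\<And>c. c \<in> carrier A \<Longrightarrow> d c = d' c"
  shows "first_order_op A E d' P"
  using assms by (simp add: first_order_op_def)

context
  fixes A :: "('k, 'a) module" and E :: "('a, 'e) module"
  assumes module: "module A E"
begin

interpretation module A E by (rule module)

lemma first_order_opD:
  assumes "first_order_op A E d P"
  shows "P \<in> extensional (carrier E)" "\<And>e. e \<in> carrier E \<Longrightarrow> P e \<in> carrier E"
    and "\<And>e e'. \<lbrakk>e \<in> carrier E; e' \<in> carrier E\<rbrakk> \<Longrightarrow> P (e \<oplus>\<^bsub>E\<^esub> e') = P e \<oplus>\<^bsub>E\<^esub> P e'"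
    and "\<And>c e. \<lbrakk>c \<in> carrier A; e \<in> carrier E\<rbrakk> \<Longrightarrow>
      P (c \<odot>\<^bsub>E\<^esub> e) = c \<odot>\<^bsub>E\<^esub> P e \<oplus>\<^bsub>E\<^esub> d c \<odot>\<^bsub>E\<^esub> e"
    and "\<And>e. e \<in> carrier E \<Longrightarrow> P (\<ominus>\<^bsub>E\<^esub> e) = \<ominus>\<^bsub>E\<^esub> P e"
    and "P \<zero>\<^bsub>E\<^esub> = \<zero>\<^bsub>E\<^esub>"
proof -
  show P: "P \<in> extensional (carrier E)" "\<And>e. e \<in> carrier E \<Longrightarrow> P e \<in> carrier E"
    "\<And>e e'. \<lbrakk>e \<in> carrier E; e' \<in> carrier E\<rbrakk> \<Longrightarrow> P (e \<oplus>\<^bsub>E\<^esub> e') = P e \<oplus>\<^bsub>E\<^esub> P e'"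
    "\<And>c e. \<lbrakk>c \<in> carrier A; e \<in> carrier E\<rbrakk> \<Longrightarrow>
      P (c \<odot>\<^bsub>E\<^esub> e) = c \<odot>\<^bsub>E\<^esub> P e \<oplus>\<^bsub>E\<^esub> d c \<odot>\<^bsub>E\<^esub> e"
    using assms by (auto simp: first_order_op_def)
  interpret abelian_group_hom E E P
    using P by unfold_locales (auto simp: hom_def)
  show "\<And>e. e \<in> carrier E \<Longrightarrow> P (\<ominus>\<^bsub>E\<^esub> e) = \<ominus>\<^bsub>E\<^esub> P e" "P \<zero>\<^bsub>E\<^esub> = \<zero>\<^bsub>E\<^esub>"
    by simp_all
qed

lemma A_endos_first_order: "p \<in> A_endos A E \<longleftrightarrow> first_order_op A E (\<lambda>_. \<zero>\<^bsub>A\<^esub>) p"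
  by (auto simp: A_endos_iff linear_map_def first_order_op_def Pi_iff)

lemma first_order_op_add:
  assumes P: "first_order_op A E d P" and Q: "first_order_op A E d' Q"
    and d: "d \<in> carrier A \<rightarrow> carrier A" "d' \<in> carrier A \<rightarrow> carrier A"
  shows "first_order_op A E (\<lambda>c. d c \<oplus>\<^bsub>A\<^esub> d' c) (op_add E P Q)"
proof -
  note [simp] = first_order_opD(2-6) [OF P] first_order_opD(2-6) [OF Q] Pi_mem [OF d(1)] Pi_mem [OF d(2)]
  show ?thesis
    by (rule first_order_opI) (simp_all add: smult_r_distr smult_l_distr M.a_ac)
qed

lemma first_order_op_diff:
  assumes P: "first_order_op A E d P" and Q: "first_order_op A E d' Q"
    and d: "d \<in> carrier A \<rightarrow> carrier A" "d' \<in> carrier A \<rightarrow> carrier A"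
  shows "first_order_op A E (\<lambda>c. d c \<ominus>\<^bsub>A\<^esub> d' c) (op_diff E P Q)"
proof -
  note [simp] = first_order_opD(2-6) [OF P] first_order_opD(2-6) [OF Q] Pi_mem [OF d(1)] Pi_mem [OF d(2)]
  show ?thesis
    by (rule first_order_opI)
      (simp_all add: a_minus_def smult_r_distr smult_l_distr smult_r_minus smult_l_minus M.minus_add M.a_ac)
qed

text \<open>In the Leibniz defect of \<open>PQ - QP\<close> the mixed terms \<open>d c (Q e) + d' c (P e)\<close> cancel.\<close>

lemma first_order_op_comm:
  assumes P: "first_order_op A E d P" and Q: "first_order_op A E d' Q"
    and d: "d \<in> carrier A \<rightarrow> carrier A" "d' \<in> carrier A \<rightarrow> carrier A"
  shows "first_order_op A E (\<lambda>c. d (d' c) \<ominus>\<^bsub>A\<^esub> d' (d c)) (op_comm E P Q)"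
proof -
  note [simp] = first_order_opD(2-6) [OF P] first_order_opD(2-6) [OF Q] Pi_mem [OF d(1)] Pi_mem [OF d(2)]
  show ?thesis
  proof (rule first_order_opI)
    fix e e' assume "e \<in> carrier E" "e' \<in> carrier E"
    then show "op_comm E P Q (e \<oplus>\<^bsub>E\<^esub> e') = op_comm E P Q e \<oplus>\<^bsub>E\<^esub> op_comm E P Q e'"
      by (simp add: M.commutator_additive)
  next
    fix c e assume *: "c \<in> carrier A" "e \<in> carrier E"
    let ?m = "d' c \<odot>\<^bsub>E\<^esub> P e \<oplus>\<^bsub>E\<^esub> d c \<odot>\<^bsub>E\<^esub> Q e"
    have m: "?m \<in> carrier E" using * by simp
    have "P (Q (c \<odot>\<^bsub>E\<^esub> e)) = (c \<odot>\<^bsub>E\<^esub> P (Q e) \<oplus>\<^bsub>E\<^esub> d (d' c) \<odot>\<^bsub>E\<^esub> e) \<oplus>\<^bsub>E\<^esub> ?m"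
      "Q (P (c \<odot>\<^bsub>E\<^esub> e)) = (c \<odot>\<^bsub>E\<^esub> Q (P e) \<oplus>\<^bsub>E\<^esub> d' (d c) \<odot>\<^bsub>E\<^esub> e) \<oplus>\<^bsub>E\<^esub> ?m"
      using * by (simp_all add: M.a_ac)
    then have "op_comm E P Q (c \<odot>\<^bsub>E\<^esub> e) =
        (c \<odot>\<^bsub>E\<^esub> P (Q e) \<oplus>\<^bsub>E\<^esub> d (d' c) \<odot>\<^bsub>E\<^esub> e) \<ominus>\<^bsub>E\<^esub> (c \<odot>\<^bsub>E\<^esub> Q (P e) \<oplus>\<^bsub>E\<^esub> d' (d c) \<odot>\<^bsub>E\<^esub> e) \<oplus>\<^bsub>E\<^esub> (?m \<ominus>\<^bsub>E\<^esub> ?m)"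
      using * m by (simp only: op_simps smult_closed M.a_closed) (subst M.commutator_additive; simp)
    also have "?m \<ominus>\<^bsub>E\<^esub> ?m = \<zero>\<^bsub>E\<^esub>"
      using m by (simp add: a_minus_def M.r_neg)
    also have "(c \<odot>\<^bsub>E\<^esub> P (Q e) \<oplus>\<^bsub>E\<^esub> d (d' c) \<odot>\<^bsub>E\<^esub> e) \<ominus>\<^bsub>E\<^esub> (c \<odot>\<^bsub>E\<^esub> Q (P e) \<oplus>\<^bsub>E\<^esub> d' (d c) \<odot>\<^bsub>E\<^esub> e) \<oplus>\<^bsub>E\<^esub> \<zero>\<^bsub>E\<^esub> =
        c \<odot>\<^bsub>E\<^esub> op_comm E P Q e \<oplus>\<^bsub>E\<^esub> (d (d' c) \<ominus>\<^bsub>A\<^esub> d' (d c)) \<odot>\<^bsub>E\<^esub> e"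
      using * by (simp add: a_minus_def smult_r_distr smult_l_distr smult_r_minus smult_l_minus
          M.minus_add M.a_ac)
    finally show "op_comm E P Q (c \<odot>\<^bsub>E\<^esub> e) =
        c \<odot>\<^bsub>E\<^esub> op_comm E P Q e \<oplus>\<^bsub>E\<^esub> (d (d' c) \<ominus>\<^bsub>A\<^esub> d' (d c)) \<odot>\<^bsub>E\<^esub> e" .
  qed simp_all
qed

text \<open>The Leibniz rule [P, cQ] = c[P, Q] + d(c)Q. It is the image in operators of the Leibniz
  rule of \<open>End\<close>.\<close>

lemma op_comm_smult_right:
  assumes P: "first_order_op A E d P" and Q: "first_order_op A E d' Q"
    and c: "c \<in> carrier A" "d c \<in> carrier A"
  shows "op_comm E P (compose (carrier E) (op_scalar E c) Q) =
    op_add E (compose (carrier E) (op_scalar E c) (op_comm E P Q)) (compose (carrier E) (op_scalar E (d c)) Q)"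
proof (rule extensionalityI [of _ "carrier E"])
  note [simp] = first_order_opD(2-6) [OF P] first_order_opD(2-6) [OF Q]
  fix e assume "e \<in> carrier E"
  then show "op_comm E P (compose (carrier E) (op_scalar E c) Q) e =
      op_add E (compose (carrier E) (op_scalar E c) (op_comm E P Q))
        (compose (carrier E) (op_scalar E (d c)) Q) e"
    using c by (simp add: compose_def a_minus_def smult_r_distr smult_r_minus M.a_ac)
qed simp_all

end

section \<open>Connections on which \<open>D\<close> acts as the identity\<close>

locale d_lie_connection = d_lie_algebra k A f Lt
  for k :: "'k ring" and A :: "('k, 'a) module"
    and f :: "('a \<Rightarrow> 'a) \<Rightarrow> ('a \<Rightarrow> 'a) \<Rightarrow> 'a" and Lt :: "('a, 'b) d_lie" +
  fixes E :: "('a, 'e) module" and \<rho> :: "'b \<Rightarrow> 'e \<Rightarrow> 'e"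
  assumes connection: "connection k A Lt E \<rho>"
    and rho_center: "\<rho> (d_center Lt) = op_id E"
begin

abbreviation (input) "E\<^sub>k \<equiv> restrict_scalars A E"

lemma E_module: "module A E"
  using connection by (simp add: connection_def)

interpretation Lt: module A Lt by (rule A_module)
interpretation E: module A E by (rule E_module)

lemma Ek_module: "module k E\<^sub>k"
  using algebra E_module by (rule module_restrict_scalars)

lemma Diff1_P_module: "P_module k A (Diff1 k A E)"
  using connection by (simp add: connection_def P_linear_map_iff [OF algebra])

lemma rho_bimodule_map: "bimodule_map A Lt (Diff1 k A E) \<rho>"
  using connection by (simp add: connection_def P_linear_map_iff [OF algebra])

lemma rho_endo: "u \<in> carrier Lt \<Longrightarrow> \<rho> u \<in> linear_endos k E\<^sub>k"
  using linear_mapD(1) [OF bimodule_mapD(1) [OF rho_bimodule_map]] by (simp add: Diff1_def)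

lemma rho_add:
  "\<lbrakk>u \<in> carrier Lt; v \<in> carrier Lt\<rbrakk> \<Longrightarrow> \<rho> (u \<oplus>\<^bsub>Lt\<^esub> v) = op_add E (\<rho> u) (\<rho> v)"
  using linear_mapD(2) [OF bimodule_mapD(1) [OF rho_bimodule_map]] by (simp add: Diff1_def)

lemma rho_smult:
  "\<lbrakk>c \<in> carrier A; u \<in> carrier Lt\<rbrakk> \<Longrightarrow> \<rho> (c \<odot>\<^bsub>Lt\<^esub> u) = compose (carrier E) (op_scalar E c) (\<rho> u)"
  using linear_mapD(3) [OF bimodule_mapD(1) [OF rho_bimodule_map]] by (simp add: Diff1_def)

lemma rho_rsmult:
  "\<lbrakk>c \<in> carrier A; u \<in> carrier Lt\<rbrakk> \<Longrightarrow> \<rho> (rsmult Lt u c) = compose (carrier E) (\<rho> u) (op_scalar E c)"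
  using bimodule_mapD(2) [OF rho_bimodule_map] by (simp add: Diff1_def)

text \<open>Applying \<open>\<rho> u\<close> after multiplication by \<open>c\<close> is
  \<open>\<rho>\<close> of uc. Since uc = \<pi>(u)(c) D + cu and \<open>D\<close> acts as the
  identity, the first summand becomes multiplication by \<pi>(u)(c).\<close>

lemma rho_first_order:
  assumes "u \<in> carrier Lt"
  shows "first_order_op A E (d_pi Lt u) (\<rho> u)"
proof (rule first_order_opI)
  have "linear_map k E\<^sub>k E\<^sub>k (\<rho> u)" "\<rho> u \<in> extensional (carrier E)"
    using rho_endo [OF assms] by (simp_all add: linear_endos_iff)
  note endo = linear_mapD [OF this(1), simplified] this(2)
  then show closed: "\<And>e. e \<in> carrier E \<Longrightarrow> \<rho> u e \<in> carrier E"
    and "\<rho> u \<in> extensional (carrier E)"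
    and "\<And>e e'. \<lbrakk>e \<in> carrier E; e' \<in> carrier E\<rbrakk> \<Longrightarrow> \<rho> u (e \<oplus>\<^bsub>E\<^esub> e') = \<rho> u e \<oplus>\<^bsub>E\<^esub> \<rho> u e'"
    by blast+
  fix c e assume c: "c \<in> carrier A" and e: "e \<in> carrier E"
  then have "\<rho> u (c \<odot>\<^bsub>E\<^esub> e) = \<rho> (rsmult Lt u c) e"
    using assms by (simp add: rho_rsmult compose_def)
  also have "\<dots> = d_pi Lt u c \<odot>\<^bsub>E\<^esub> e \<oplus>\<^bsub>E\<^esub> c \<odot>\<^bsub>E\<^esub> \<rho> u e"
    using assms c e d_pi_closed center_closed
    by (simp add: rsmult_eq rho_add rho_smult rho_center compose_def closed)
  also have "\<dots> = c \<odot>\<^bsub>E\<^esub> \<rho> u e \<oplus>\<^bsub>E\<^esub> d_pi Lt u c \<odot>\<^bsub>E\<^esub> e"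
    using assms c e d_pi_closed closed by (simp add: E.M.a_comm)
  finally show "\<rho> u (c \<odot>\<^bsub>E\<^esub> e) = c \<odot>\<^bsub>E\<^esub> \<rho> u e \<oplus>\<^bsub>E\<^esub> d_pi Lt u c \<odot>\<^bsub>E\<^esub> e" .
qed

lemma A_endos_gl: "p \<in> A_endos A E \<Longrightarrow> p \<in> linear_endos k E\<^sub>k"
  using linear_map_restrict_scalars [OF algebra, of E E p] by (simp add: A_endos_iff linear_endos_iff)

abbreviation (input) "End \<equiv> End_d_lie A Lt E \<rho>"

lemma End_simps [simp]:
  "carrier End = A_endos A E \<times> carrier Lt"
  "zero End = (op_zero E, \<zero>\<^bsub>Lt\<^esub>)"
  "(p, u) \<oplus>\<^bsub>End\<^esub> (q, v) = (op_add E p q, u \<oplus>\<^bsub>Lt\<^esub> v)"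
  "c \<odot>\<^bsub>End\<^esub> (p, u) = (compose (carrier E) (op_scalar E c) p, c \<odot>\<^bsub>Lt\<^esub> u)"
  "rsmult End (p, u) c = (compose (carrier E) p (op_scalar E c), rsmult Lt u c)"
  "bracket End (p, u) (q, v) = (End_bracket Lt E \<rho> p u q v, bracket Lt u v)"
  "d_alpha End (p, u) = d_alpha Lt u"
  "d_pi End (p, u) = d_pi Lt u"
  "d_center End = (op_zero E, d_center Lt)"
  by (simp_all add: End_d_lie_def)

lemma A_endosD:
  assumes "p \<in> A_endos A E"
  shows "p \<in> extensional (carrier E)" "\<And>e. e \<in> carrier E \<Longrightarrow> p e \<in> carrier E"
    "\<And>e e'. \<lbrakk>e \<in> carrier E; e' \<in> carrier E\<rbrakk> \<Longrightarrow> p (e \<oplus>\<^bsub>E\<^esub> e') = p e \<oplus>\<^bsub>E\<^esub> p e'"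
    "\<And>c e. \<lbrakk>c \<in> carrier A; e \<in> carrier E\<rbrakk> \<Longrightarrow> p (c \<odot>\<^bsub>E\<^esub> e) = c \<odot>\<^bsub>E\<^esub> p e"
  using assms by (auto simp: A_endos_iff linear_map_def)

lemma A_endos_closed:
  shows "op_zero E \<in> A_endos A E"
    and "\<lbrakk>p \<in> A_endos A E; q \<in> A_endos A E\<rbrakk> \<Longrightarrow> op_add E p q \<in> A_endos A E"
    and "\<lbrakk>c \<in> carrier A; p \<in> A_endos A E\<rbrakk> \<Longrightarrow> compose (carrier E) (op_scalar E c) p \<in> A_endos A E"
    and "\<lbrakk>c \<in> carrier A; p \<in> A_endos A E\<rbrakk> \<Longrightarrow> compose (carrier E) p (op_scalar E c) \<in> A_endos A E"
proof -
  show "op_zero E \<in> A_endos A E"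
    by (auto simp: A_endos_iff intro!: linear_mapI)
next
  assume "p \<in> A_endos A E" "q \<in> A_endos A E"
  then show "op_add E p q \<in> A_endos A E"
    unfolding A_endos_iff [of "op_add E p q"]
    by (auto intro!: linear_mapI simp: A_endosD E.smult_r_distr E.M.a_ac)
next
  assume c: "c \<in> carrier A" and p: "p \<in> A_endos A E"
  have "c \<odot>\<^bsub>E\<^esub> (r \<odot>\<^bsub>E\<^esub> e) = r \<odot>\<^bsub>E\<^esub> (c \<odot>\<^bsub>E\<^esub> e)" if "r \<in> carrier A" "e \<in> carrier E" for r e
    using c that by (simp add: E.smult_assoc1 [symmetric] m_comm)
  then show "compose (carrier E) (op_scalar E c) p \<in> A_endos A E"
    "compose (carrier E) p (op_scalar E c) \<in> A_endos A E"
    unfolding A_endos_iff [of "compose _ _ _"]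
    using c p by (auto intro!: linear_mapI simp: A_endosD compose_def E.smult_r_distr)
qed

text \<open>Allows the first projection of \<open>End\<close> to be viewed as a map into the
  P-module \<open>Diff1\<close>.\<close>

lemma A_endos_Diff1: "A_endos A E \<subseteq> carrier (Diff1 k A E)"
proof
  fix p assume p: "p \<in> A_endos A E"
  have "op_comm E p (op_scalar E a) = op_zero E" if "a \<in> carrier A" for a
    using that p
    by (intro extensionalityI [of _ "carrier E"]) (simp_all add: A_endosD a_minus_def E.M.r_neg)
  moreover have "op_comm E (op_zero E) (op_scalar E b) = op_zero E" if "b \<in> carrier A" for b
    using that by (intro extensionalityI [of _ "carrier E"]) (simp_all add: a_minus_def)
  ultimately show "p \<in> carrier (Diff1 k A E)"
    using A_endos_gl [OF p] by (simp add: Diff1_def)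
qed

lemma End_bimodule_maps:
  "bimodule_map A End (Diff1 k A E) fst" "bimodule_map A End Lt snd"
  using A_endos_Diff1 by (auto simp: bimodule_map_def Diff1_def intro!: linear_mapI)

text \<open>The two projections of a pair are jointly injective, with values in the P-modules
  \<open>Diff1\<close> and \<open>Lt\<close>.\<close>

lemma End_P_module: "P_module k A End"
  by (rule P_module_embed [OF algebra Diff1_P_module P_module End_bimodule_maps])
    (auto simp: Diff1_def A_endos_closed rsmult_closed)

lemma End_module: "module A End"
  using algebra End_P_module by (rule P_moduleD)

definition End_operator :: "('e \<Rightarrow> 'e) \<times> 'b \<Rightarrow> 'e \<Rightarrow> 'e" where
  "End_operator x = op_add E (fst x) (\<rho> (snd x))"

lemma End_operator_first_order:
  assumes "x \<in> carrier End"
  shows "first_order_op A E (d_pi End x) (End_operator x)"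
proof -
  obtain p u where x: "x = (p, u)" "p \<in> A_endos A E" "u \<in> carrier Lt"
    using assms by auto
  then have "first_order_op A E (\<lambda>c. \<zero>\<^bsub>A\<^esub> \<oplus>\<^bsub>A\<^esub> d_pi Lt u c) (op_add E p (\<rho> u))"
    using A_endos_first_order [OF E_module, of p] rho_first_order [of u] d_pi_closed
    by (intro first_order_op_add [OF E_module]) auto
  then show ?thesis
    unfolding x End_operator_def using x d_pi_closed by (auto elim!: first_order_op_cong)
qed

lemma End_operator_endo:
  assumes "x \<in> carrier End"
  shows "End_operator x \<in> linear_endos k E\<^sub>k"
  using assms gl_closed(2) [OF Ek_module, of "fst x" "\<rho> (snd x)"] A_endos_gl rho_endo
  by (auto simp: End_operator_def)

lemma End_operator_inj:
  assumes "x \<in> carrier End" "y \<in> carrier End" "End_operator x = End_operator y" "snd x = snd y"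
  shows "x = y"
proof -
  have "fst x = fst y"
  proof (rule extensionalityI [of _ "carrier E"])
    fix e assume e: "e \<in> carrier E"
    have "fst x e \<oplus>\<^bsub>E\<^esub> \<rho> (snd x) e = fst y e \<oplus>\<^bsub>E\<^esub> \<rho> (snd x) e"
      using fun_cong [OF assms(3), of e] assms(4) e unfolding End_operator_def by simp
    then show "fst x e = fst y e"
      using assms e first_order_opD(2) [OF E_module rho_first_order [of "snd x"]]
      by (auto simp: A_endosD)
  qed (use assms in \<open>auto simp: A_endosD\<close>)
  then show ?thesis using assms(4) by (simp add: prod_eq_iff)
qed

lemma End_operator_add:
  assumes "x \<in> carrier End" "y \<in> carrier End"
  shows "End_operator (x \<oplus>\<^bsub>End\<^esub> y) = op_add E (End_operator x) (End_operator y)"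
proof -
  obtain p u q v where xy: "x = (p, u)" "p \<in> A_endos A E" "u \<in> carrier Lt"
    "y = (q, v)" "q \<in> A_endos A E" "v \<in> carrier Lt"
    using assms by auto
  note [simp] = first_order_opD(2) [OF E_module rho_first_order [OF xy(3)]]
    first_order_opD(2) [OF E_module rho_first_order [OF xy(6)]]
  show ?thesis
    using xy by (intro extensionalityI [of _ "carrier E"])
      (simp_all add: End_operator_def rho_add A_endosD E.M.a_ac)
qed

lemma End_operator_smult:
  assumes "c \<in> carrier A" "x \<in> carrier End"
  shows "End_operator (c \<odot>\<^bsub>End\<^esub> x) = compose (carrier E) (op_scalar E c) (End_operator x)"
proof -
  obtain p u where x: "x = (p, u)" "p \<in> A_endos A E" "u \<in> carrier Lt"
    using assms by auto
  note [simp] = first_order_opD(2) [OF E_module rho_first_order [OF x(3)]]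
  show ?thesis
    using x assms by (intro extensionalityI [of _ "carrier E"])
      (simp_all add: End_operator_def rho_smult A_endosD compose_def E.smult_r_distr)
qed

text \<open>Expanding [p + \<rho>(u), q + \<rho>(v)] yields the first three terms of
  \<open>End_bracket\<close> and [\<rho>(u), \<rho>(v)]. The curvature is this last commutator minus
  \<rho>([u, v]), so the long formula is a single commutator with one correction.\<close>

lemma End_bracket_eq:
  assumes "x \<in> carrier End" "y \<in> carrier End"
  shows "fst (bracket End x y) =
    op_diff E (op_comm E (End_operator x) (End_operator y)) (\<rho> (bracket Lt (snd x) (snd y)))"
proof -
  obtain p u q v where xy: "x = (p, u)" "p \<in> A_endos A E" "u \<in> carrier Lt"
    "y = (q, v)" "q \<in> A_endos A E" "v \<in> carrier Lt"
    using assms by auto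
  note [simp] = first_order_opD(2,3) [OF E_module rho_first_order [OF xy(3)]]
    first_order_opD(2,3) [OF E_module rho_first_order [OF xy(6)]]
    first_order_opD(2,3) [OF E_module rho_first_order [OF bracket_closed [OF xy(3,6)]]]
  show ?thesis
    using xy by (intro extensionalityI [of _ "carrier E"])
      (simp_all add: End_operator_def End_bracket_def curvature_def A_endosD a_minus_def
        E.M.minus_add E.M.a_ac)
qed

text \<open>The commutator of the two operators has symbol [\<pi>(u), \<pi>(v)]. As \<pi> is a Lie
  homomorphism, this is the symbol of \<rho>([u, v]); the difference has symbol 0 and is
  \<open>A\<close>-linear.\<close>

lemma End_bracket_closed:
  assumes x: "x \<in> carrier End" and y: "y \<in> carrier End"
  shows "bracket End x y \<in> carrier End"
proof -
  have uv: "snd x \<in> carrier Lt" "snd y \<in> carrier Lt" and pi: "d_pi End x = d_pi Lt (snd x)" "d_pi End y = d_pi Lt (snd y)"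
    using x y by auto
  note closed = d_pi_closed [OF uv(1)] d_pi_closed [OF uv(2)]
  have "first_order_op A E (\<lambda>c. (d_pi End x (d_pi End y c) \<ominus>\<^bsub>A\<^esub> d_pi End y (d_pi End x c)) \<ominus>\<^bsub>A\<^esub>
      d_pi Lt (bracket Lt (snd x) (snd y)) c) (fst (bracket End x y))"
    unfolding End_bracket_eq [OF x y]
    using End_operator_first_order [OF x] End_operator_first_order [OF y] uv bracket_closed [OF uv]
      closed rho_first_order [OF bracket_closed [OF uv]] d_pi_closed [OF bracket_closed [OF uv]]
    unfolding pi
    by (intro first_order_op_diff [OF E_module] first_order_op_comm [OF E_module]) auto
  then have "fst (bracket End x y) \<in> A_endos A E"
    unfolding A_endos_first_order [OF E_module] pi
    by (rule first_order_op_cong) (simp add: d_pi_bracket uv closed a_minus_def abelian_group.r_neg [OF ring.is_abelian_group [OF cring.axioms(1) [OF M_cring]]])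
  then show ?thesis
    using x y bracket_closed by auto
qed

text \<open>The correction subtracted in the first component is \<open>\<rho>\<close> of the second
  component, and forming the operator adds it back.\<close>

lemma End_operator_bracket:
  assumes x: "x \<in> carrier End" and y: "y \<in> carrier End"
  shows "End_operator (bracket End x y) = op_comm E (End_operator x) (End_operator y)"
proof (rule extensionalityI [of _ "carrier E"])
  fix e assume e: "e \<in> carrier E"
  have uv: "snd x \<in> carrier Lt" "snd y \<in> carrier Lt" "snd (bracket End x y) = bracket Lt (snd x) (snd y)"
    using x y by auto
  note [simp] = first_order_opD(2) [OF E_module rho_first_order [OF bracket_closed [OF uv(1,2)]]]
    first_order_opD(2) [OF E_module End_operator_first_order [OF x]]
    first_order_opD(2) [OF E_module End_operator_first_order [OF y]]
  show "End_operator (bracket End x y) e = op_comm E (End_operator x) (End_operator y) e"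
    unfolding End_operator_def [of "bracket End x y"] End_bracket_eq [OF x y] uv(3)
    using e by (simp add: E.M.minus_add_cancel)
qed (simp_all add: End_operator_def)

lemma End_lie_algebra: "lie_algebra k (restrict_scalars A End) (bracket End)"
proof (rule lie_algebra_embed)
  show "module k (restrict_scalars A End)"
    using algebra End_module by (rule module_restrict_scalars)
  show "lie_algebra k (gl k E\<^sub>k) (op_comm E\<^sub>k)"
    using Ek_module by (rule gl_lie_algebra)
  show "lie_algebra k (restrict_scalars A Lt) (bracket Lt)" by (rule lie_algebra_axioms)
  have r: "r \<odot>\<^bsub>A\<^esub> \<one>\<^bsub>A\<^esub> \<in> carrier A" if "r \<in> carrier k" for r
    using that by simp
  show "linear_map k (restrict_scalars A End) (gl k E\<^sub>k) End_operator"
    using End_operator_add End_operator_smult [OF r] End_operator_endo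
    by (intro linear_mapI) (simp_all add: op_scalar_def)
  show "linear_map k (restrict_scalars A End) (restrict_scalars A Lt) snd"
    using algebra End_bimodule_maps(2) by (intro linear_map_restrict_scalars bimodule_mapD)
  fix x y assume "x \<in> carrier (restrict_scalars A End)" "y \<in> carrier (restrict_scalars A End)"
  then have xy: "x \<in> carrier End" "y \<in> carrier End" by simp_all
  show "bracket End x y \<in> carrier (restrict_scalars A End) \<and>
      End_operator (bracket End x y) = op_comm E\<^sub>k (End_operator x) (End_operator y) \<and>
      snd (bracket End x y) = bracket Lt (snd x) (snd y)"
    using End_bracket_closed [OF xy] End_operator_bracket [OF xy] xy by auto
  show "End_operator x = End_operator y \<Longrightarrow> snd x = snd y \<Longrightarrow> x = y"
    using xy by (rule End_operator_inj)
qed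

text \<open>Second components agree by the Leibniz rule of \<open>Lt\<close>, operators by that of
  first-order operators. This spares a direct expansion of the curvature.\<close>

lemma End_leibniz:
  assumes a: "a \<in> carrier A" and x: "x \<in> carrier End" and y: "y \<in> carrier End"
  shows "bracket End x (a \<odot>\<^bsub>End\<^esub> y) = a \<odot>\<^bsub>End\<^esub> bracket End x y \<oplus>\<^bsub>End\<^esub> d_pi End x a \<odot>\<^bsub>End\<^esub> y"
proof (rule End_operator_inj)
  interpret End: module A End by (rule End_module)
  have pi: "d_pi End x a \<in> carrier A"
    using a x d_pi_closed by auto
  note closed = a x y pi End_bracket_closed End.smult_closed End.M.a_closed
  show "bracket End x (a \<odot>\<^bsub>End\<^esub> y) \<in> carrier End"
    "a \<odot>\<^bsub>End\<^esub> bracket End x y \<oplus>\<^bsub>End\<^esub> d_pi End x a \<odot>\<^bsub>End\<^esub> y \<in> carrier End"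
    by (intro closed)+
  show "snd (bracket End x (a \<odot>\<^bsub>End\<^esub> y)) =
      snd (a \<odot>\<^bsub>End\<^esub> bracket End x y \<oplus>\<^bsub>End\<^esub> d_pi End x a \<odot>\<^bsub>End\<^esub> y)"
    using a x y leibniz by auto
  have "End_operator (bracket End x (a \<odot>\<^bsub>End\<^esub> y)) =
      op_comm E (End_operator x) (compose (carrier E) (op_scalar E a) (End_operator y))"
    by (subst End_operator_bracket, (intro closed)+, subst End_operator_smult, (intro closed)+) simp
  also have "\<dots> = End_operator (a \<odot>\<^bsub>End\<^esub> bracket End x y \<oplus>\<^bsub>End\<^esub> d_pi End x a \<odot>\<^bsub>End\<^esub> y)"
    by (subst op_comm_smult_right [OF E_module End_operator_first_order [OF x]
            End_operator_first_order [OF y] a pi],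
        subst End_operator_add, (intro closed)+, subst End_operator_smult, (intro closed)+,
        subst End_operator_smult, (intro closed)+, subst End_operator_bracket, (intro closed)+) simp
  finally show "End_operator (bracket End x (a \<odot>\<^bsub>End\<^esub> y)) =
      End_operator (a \<odot>\<^bsub>End\<^esub> bracket End x y \<oplus>\<^bsub>End\<^esub> d_pi End x a \<odot>\<^bsub>End\<^esub> y)" .
qed

lemma End_d_lie_algebra: "d_lie_algebra k A f End"
proof -
  interpret End: module A End by (rule End_module)
  have alpha: "bimodule_map A Lt (D1 k A f) (d_alpha Lt)" "P_module k A (D1 k A f)"
    and Der: "P_module k A (Der k A)"
    using alpha_P_linear pi_P_linear by (simp_all add: P_linear_map_iff [OF algebra])
  have alpha': "bimodule_map A End (D1 k A f) (d_alpha End)"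
    using alpha(1) by (auto simp: bimodule_map_def linear_map_def)
  have pi': "bimodule_map A End (Der k A) (d_pi End)"
    using d_pi_bimodule_map by (auto simp: bimodule_map_def linear_map_def)
  have alpha_hom: "lie_hom k (restrict_scalars A End) (bracket End)
      (restrict_scalars A (D1 k A f)) (bracket (D1 k A f)) (d_alpha End)"
    using linear_map_restrict_scalars [OF algebra bimodule_mapD(1) [OF alpha']] alpha_lie_hom
    by (auto simp: lie_hom_def)
  have pi_hom: "lie_hom k (restrict_scalars A End) (bracket End)
      (restrict_scalars A (Der k A)) (bracket (Der k A)) (d_pi End)"
    using linear_map_restrict_scalars [OF algebra bimodule_mapD(1) [OF pi']] pi_lie_hom
    by (auto simp: lie_hom_def)
  have center: "d_center End \<in> carrier End"
    using center_closed A_endos_closed by simp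
  have action: "rsmult End x a \<ominus>\<^bsub>End\<^esub> a \<odot>\<^bsub>End\<^esub> x = d_pi End x a \<odot>\<^bsub>End\<^esub> d_center End"
    if a: "a \<in> carrier A" and x: "x \<in> carrier End" for a x
  proof -
    obtain p u where pu: "x = (p, u)" "p \<in> A_endos A E" "u \<in> carrier Lt"
      using x by auto
    have pi: "d_pi Lt u a \<in> carrier A" using a pu d_pi_closed by simp
    \<comment> \<open>An \<open>A\<close>-linear \<open>p\<close> commutes with scalars, so the left
      and right actions agree on it. This is consistent with the zero first component of the central
      element.\<close>
    have "compose (carrier E) p (op_scalar E a) =
        op_add E (compose (carrier E) (op_scalar E (d_pi Lt u a)) (op_zero E)) (compose (carrier E) (op_scalar E a) p)"
      using a pu pi by (intro extensionalityI [of _ "carrier E"]) (simp_all add: compose_def A_endosD)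
    then have "rsmult End x a = d_pi End x a \<odot>\<^bsub>End\<^esub> d_center End \<oplus>\<^bsub>End\<^esub> a \<odot>\<^bsub>End\<^esub> x"
      using a pu by (simp add: rsmult_eq)
    moreover have "d_pi End x a \<odot>\<^bsub>End\<^esub> d_center End \<in> carrier End" "a \<odot>\<^bsub>End\<^esub> x \<in> carrier End"
      using a x pi pu center by (intro End.smult_closed; simp)+
    ultimately show ?thesis
      by (simp only: a_minus_def End.M.a_assoc End.M.a_inv_closed End.M.r_neg End.M.r_zero)
  qed
  have central: "bracket End (d_center End) x = \<zero>\<^bsub>End\<^esub>" if x: "x \<in> carrier End" for x
  proof (rule End_operator_inj)
    show "bracket End (d_center End) x \<in> carrier End" "\<zero>\<^bsub>End\<^esub> \<in> carrier End"
      using End_bracket_closed [OF center x] A_endos_closed by simp_all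
    show "snd (bracket End (d_center End) x) = snd \<zero>\<^bsub>End\<^esub>"
      using x center_central by auto
    note fo = first_order_opD [OF E_module End_operator_first_order [OF x]]
    \<comment> \<open>The central element acts as \<open>\<rho> D\<close>, the identity, which
      commutes with every operator. Its brackets thus have operator zero.\<close>
    have id: "End_operator (d_center End) = op_id E"
      by (rule extensionalityI [of _ "carrier E"]) (simp_all add: End_operator_def rho_center)
    have "\<rho> \<zero>\<^bsub>Lt\<^esub> = \<zero>\<^bsub>Diff1 k A E\<^esub>"
      using A_module P_moduleD(1) [OF algebra Diff1_P_module] bimodule_mapD(1) [OF rho_bimodule_map]
      by (rule linear_map_zero)
    then have zero: "End_operator \<zero>\<^bsub>End\<^esub> = op_zero E"
      by (intro extensionalityI [of _ "carrier E"]) (simp_all add: End_operator_def Diff1_def)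
    show "End_operator (bracket End (d_center End) x) = End_operator \<zero>\<^bsub>End\<^esub>"
      unfolding zero End_operator_bracket [OF center x] id
      by (rule extensionalityI [of _ "carrier E"]) (simp_all add: fo a_minus_def E.M.r_neg)
  qed
  have "d_lie_algebra_axioms k A f End"
  proof (rule d_lie_algebra_axioms.intro)
    show "P_linear_map k A End (D1 k A f) (d_alpha End)" "P_linear_map k A End (Der k A) (d_pi End)"
      using alpha alpha' pi' Der End_P_module by (simp_all add: P_linear_map_iff [OF algebra])
    show "d_pi End x = snd (d_alpha End x)" if "x \<in> carrier End" for x
      using that pi_alpha by auto
    show "d_pi End (d_center End) = \<zero>\<^bsub>Der k A\<^esub>"
      unfolding End_simps by (rule center_pi)
  qed (fact cocycle End_P_module alpha_hom pi_hom End_leibniz action center central)+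
  then show ?thesis
    using algebra End_lie_algebra by (intro d_lie_algebra.intro)
qed

end

section \<open>Isomorphisms of \<open>D\<close>-Lie algebras\<close>

text \<open>Stated through projections, because the values of \<open>d_alpha\<close> on an abstract
  \<open>Lt\<close> are not literal pairs.\<close>

lemma D1_simps [simp]:
  "carrier (D1 k A f) = carrier A \<times> derivations k A"
  "fst (x \<oplus>\<^bsub>D1 k A f\<^esub> y) = fst x \<oplus>\<^bsub>A\<^esub> fst y"
  "snd (x \<oplus>\<^bsub>D1 k A f\<^esub> y) = snd x \<oplus>\<^bsub>Der k A\<^esub> snd y"
  "fst (c \<odot>\<^bsub>D1 k A f\<^esub> x) = c \<otimes>\<^bsub>A\<^esub> fst x"
  "snd (c \<odot>\<^bsub>D1 k A f\<^esub> x) = c \<odot>\<^bsub>Der k A\<^esub> snd x"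
  "fst (rsmult (D1 k A f) x c) = (fst x \<otimes>\<^bsub>A\<^esub> c) \<oplus>\<^bsub>A\<^esub> snd x c"
  "snd (rsmult (D1 k A f) x c) = c \<odot>\<^bsub>Der k A\<^esub> snd x"
  "fst (bracket (D1 k A f) x y) = snd x (fst y) \<ominus>\<^bsub>A\<^esub> snd y (fst x) \<oplus>\<^bsub>A\<^esub> f (snd x) (snd y)"
  "snd (bracket (D1 k A f) x y) = bracket (Der k A) (snd x) (snd y)"
  by (simp_all add: D1_def split_def)

lemma L_ext_simps [simp]:
  "carrier (L_ext k A f L) = carrier A \<times> carrier L"
  "zero (L_ext k A f L) = (\<zero>\<^bsub>A\<^esub>, \<zero>\<^bsub>L\<^esub>)"
  "(a, x) \<oplus>\<^bsub>L_ext k A f L\<^esub> (b, y) = (a \<oplus>\<^bsub>A\<^esub> b, x \<oplus>\<^bsub>L\<^esub> y)"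
  "c \<odot>\<^bsub>L_ext k A f L\<^esub> (a, x) = (c \<otimes>\<^bsub>A\<^esub> a, c \<odot>\<^bsub>L\<^esub> x)"
  "rsmult (L_ext k A f L) (a, x) c = ((a \<otimes>\<^bsub>A\<^esub> c) \<oplus>\<^bsub>A\<^esub> anchor L x c, c \<odot>\<^bsub>L\<^esub> x)"
  "bracket (L_ext k A f L) (a, x) (b, y) =
    (anchor L x b \<ominus>\<^bsub>A\<^esub> anchor L y a \<oplus>\<^bsub>A\<^esub> f (anchor L x) (anchor L y), lr_bracket L x y)"
  "d_alpha (L_ext k A f L) (a, x) = (a, anchor L x)"
  "d_pi (L_ext k A f L) (a, x) = anchor L x"
  "d_center (L_ext k A f L) = (\<one>\<^bsub>A\<^esub>, \<zero>\<^bsub>L\<^esub>)"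
  by (simp_all add: L_ext_def)

lemma two_cocycles_closed:
  "\<lbrakk>f \<in> two_cocycles A L; x \<in> carrier L; y \<in> carrier L\<rbrakk> \<Longrightarrow> f x y \<in> carrier A"
  by (simp add: two_cocycles_def)

text \<open>Nothing is assumed about \<open>M\<close> beyond a structure-preserving bijection from
  \<open>Lt\<close>. The inverse embeds \<open>M\<close> into \<open>Lt\<close> and so makes it a
  P-module, which is why the conclusion concerns the inverse.\<close>

lemma (in d_lie_algebra) d_lie_iso_inverse:
  fixes M :: "('a, 'd) d_lie"
  assumes bij: "bij_betw h (carrier Lt) (carrier M)"
    and lin: "bimodule_map A Lt M h" and zero: "h \<zero>\<^bsub>Lt\<^esub> = \<zero>\<^bsub>M\<^esub>"
    and br: "\<And>u v. \<lbrakk>u \<in> carrier Lt; v \<in> carrier Lt\<rbrakk> \<Longrightarrow> h (bracket Lt u v) = bracket M (h u) (h v)"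
    and center: "h (d_center Lt) = d_center M"
    and pi: "\<And>u. u \<in> carrier Lt \<Longrightarrow> d_pi M (h u) = d_pi Lt u"
  shows "d_lie_iso k A M Lt (inv_into (carrier Lt) h)"
proof -
  interpret Lt: module A Lt by (rule A_module)
  let ?g = "inv_into (carrier Lt) h"
  have onto: "carrier M = h ` carrier Lt" and g: "\<And>u. u \<in> carrier Lt \<Longrightarrow> ?g (h u) = u"
    using bij by (auto simp: bij_betw_def)
  have lin_h: "\<And>u v. \<lbrakk>u \<in> carrier Lt; v \<in> carrier Lt\<rbrakk> \<Longrightarrow> h u \<oplus>\<^bsub>M\<^esub> h v = h (u \<oplus>\<^bsub>Lt\<^esub> v)"
    "\<And>c u. \<lbrakk>c \<in> carrier A; u \<in> carrier Lt\<rbrakk> \<Longrightarrow> c \<odot>\<^bsub>M\<^esub> h u = h (c \<odot>\<^bsub>Lt\<^esub> u)"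
    "\<And>c u. \<lbrakk>c \<in> carrier A; u \<in> carrier Lt\<rbrakk> \<Longrightarrow> rsmult M (h u) c = h (rsmult Lt u c)"
    using linear_mapD [OF bimodule_mapD(1) [OF lin]] bimodule_mapD(2) [OF lin] by simp_all
  have bim: "bimodule_map A M Lt ?g"
    unfolding bimodule_map_def by (auto simp: onto g lin_h rsmult_closed intro!: linear_mapI)
  have "P_module k A M"
    \<comment> \<open>The inverse is injective on its own, so it fills both places.\<close>
    by (rule P_module_embed [OF algebra P_module P_module bim bim])
      (auto simp: onto g lin_h rsmult_closed zero [symmetric])
  then have "P_linear_map k A M Lt ?g"
    using bim P_module by (simp add: P_linear_map_iff [OF algebra])
  moreover have "lie_hom k (restrict_scalars A M) (bracket M) (restrict_scalars A Lt) (bracket Lt) ?g"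
    using linear_map_restrict_scalars [OF algebra bimodule_mapD(1) [OF bim]]
    by (auto simp: lie_hom_def onto g br [symmetric] bracket_closed)
  moreover have "?g (d_center M) = d_center Lt"
    using center_closed by (simp add: center [symmetric] g)
  moreover have "\<forall>x \<in> carrier M. d_pi M x = d_pi Lt (?g x)"
    by (auto simp: onto g pi)
  moreover have "bij_betw ?g (carrier M) (carrier Lt)"
    using bij by (rule bij_betw_inv_into)
  ultimately show ?thesis
    by (simp add: d_lie_iso_def d_lie_hom_def)
qed

text \<open>An injective homomorphism reflects equations, which settles all axioms about the
  bracket, the actions, \<open>D\<close> and \<open>d_pi\<close>. A homomorphism carries no
  information on \<open>d_alpha\<close>, hence the separate hypotheses about it.\<close>

lemma (in d_lie_algebra) d_lie_algebra_pullback: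
  fixes M :: "('a, 'd) d_lie"
  assumes hom: "d_lie_hom k A M Lt h" and inj: "inj_on h (carrier M)"
    and br: "\<And>x y. \<lbrakk>x \<in> carrier M; y \<in> carrier M\<rbrakk> \<Longrightarrow> bracket M x y \<in> carrier M"
    and center: "d_center M \<in> carrier M"
    and alpha: "bimodule_map A M (D1 k A f) (d_alpha M)"
    and alpha_br: "\<And>x y. \<lbrakk>x \<in> carrier M; y \<in> carrier M\<rbrakk> \<Longrightarrow>
      d_alpha M (bracket M x y) = bracket (D1 k A f) (d_alpha M x) (d_alpha M y)"
    and pi_alpha': "\<And>x. x \<in> carrier M \<Longrightarrow> d_pi M x = snd (d_alpha M x)"
  shows "d_lie_algebra k A f M"
proof -
  interpret Lt: module A Lt by (rule A_module)
  have M: "P_module k A M" and bim: "bimodule_map A M Lt h"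
    using hom by (simp_all add: d_lie_hom_def P_linear_map_iff [OF algebra])
  have targets: "P_module k A (D1 k A f)" "P_module k A (Der k A)"
    using alpha_P_linear pi_P_linear by (simp_all add: P_linear_map_iff [OF algebra])
  interpret M: module A M using algebra M by (rule P_moduleD)
  note rsmult = P_moduleD(2) [OF algebra M]
  note h = linear_mapD [OF bimodule_mapD(1) [OF bim]] bimodule_mapD(2) [OF bim]
  interpret h: abelian_group_hom M Lt h
    using h by unfold_locales (auto simp: hom_def)
  have h_br: "h (bracket M x y) = bracket Lt (h x) (h y)" if "x \<in> carrier M" "y \<in> carrier M" for x y
    using hom that by (simp add: d_lie_hom_def lie_hom_def)
  have h_center: "h (d_center M) = d_center Lt"
    and pi: "\<And>x. x \<in> carrier M \<Longrightarrow> d_pi M x = d_pi Lt (h x)"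
    using hom by (simp_all add: d_lie_hom_def)
  have pi_closed: "d_pi M x a \<in> carrier A" if "a \<in> carrier A" "x \<in> carrier M" for a x
    using that h d_pi_closed by (simp add: pi)
  note [simp] = h br center rsmult h_br h_center pi_closed
  have lie: "lie_algebra k (restrict_scalars A M) (bracket M)"
  proof (rule lie_algebra_embed)
    show "module k (restrict_scalars A M)"
      using algebra M.module_axioms by (rule module_restrict_scalars)
    show "lie_algebra k (restrict_scalars A Lt) (bracket Lt)"
      "lie_algebra k (restrict_scalars A Lt) (bracket Lt)"
      by (rule lie_algebra_axioms)+
    show "linear_map k (restrict_scalars A M) (restrict_scalars A Lt) h"
      "linear_map k (restrict_scalars A M) (restrict_scalars A Lt) h"
      by (rule linear_map_restrict_scalars [OF algebra bimodule_mapD(1) [OF bim]])+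
  qed (auto intro: inj_onD [OF inj])
  have pi_lin: "bimodule_map A M (Der k A) (d_pi M)"
    using d_pi_bimodule_map by (auto simp: bimodule_map_def linear_map_def pi)
  have "lie_hom k (restrict_scalars A M) (bracket M)
      (restrict_scalars A (D1 k A f)) (bracket (D1 k A f)) (d_alpha M)"
    using linear_map_restrict_scalars [OF algebra bimodule_mapD(1) [OF alpha]] alpha_br
    by (simp add: lie_hom_def)
  moreover have "lie_hom k (restrict_scalars A M) (bracket M)
      (restrict_scalars A (Der k A)) (bracket (Der k A)) (d_pi M)"
    using linear_map_restrict_scalars [OF algebra bimodule_mapD(1) [OF pi_lin]] d_pi_bracket
    by (simp add: lie_hom_def pi)
  moreover have "bracket M x (a \<odot>\<^bsub>M\<^esub> y) = a \<odot>\<^bsub>M\<^esub> bracket M x y \<oplus>\<^bsub>M\<^esub> d_pi M x a \<odot>\<^bsub>M\<^esub> y"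
    if "a \<in> carrier A" "x \<in> carrier M" "y \<in> carrier M" for a x y
    using that by (intro inj_onD [OF inj]) (simp_all add: leibniz pi [symmetric])
  moreover have "rsmult M x a \<ominus>\<^bsub>M\<^esub> a \<odot>\<^bsub>M\<^esub> x = d_pi M x a \<odot>\<^bsub>M\<^esub> d_center M"
    if "a \<in> carrier A" "x \<in> carrier M" for a x
    using that d_action [of a "h x"]
    by (intro inj_onD [OF inj]) (simp_all add: a_minus_def pi [symmetric])
  moreover have "bracket M (d_center M) x = \<zero>\<^bsub>M\<^esub>" if "x \<in> carrier M" for x
    using that by (intro inj_onD [OF inj]) (simp_all add: center_central)
  moreover have "d_pi M (d_center M) = \<zero>\<^bsub>Der k A\<^esub>"
    using center_pi by (simp add: pi)
  moreover have "P_linear_map k A M (D1 k A f) (d_alpha M)" "P_linear_map k A M (Der k A) (d_pi M)"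
    using M targets alpha pi_lin by (simp_all add: P_linear_map_iff [OF algebra])
  ultimately have "d_lie_algebra_axioms k A f M"
    using cocycle M center pi_alpha' by (intro d_lie_algebra_axioms.intro)
  with algebra lie show ?thesis
    by (rule d_lie_algebra.intro)
qed

section \<open>L(f^\<alpha>) and the splitting of a D-Lie algebra over its canonical
  quotient\<close>

context d_lie_algebra
begin

interpretation Lt: module A Lt by (rule A_module)

abbreviation (input) "L \<equiv> canonical_quotient A Lt"

lemma canonical_quotient_simps:
  shows "\<lbrakk>u \<in> carrier Lt; v \<in> carrier Lt\<rbrakk> \<Longrightarrow> coset u \<oplus>\<^bsub>L\<^esub> coset v = coset (u \<oplus>\<^bsub>Lt\<^esub> v)"
    and "\<lbrakk>c \<in> carrier A; u \<in> carrier Lt\<rbrakk> \<Longrightarrow> c \<odot>\<^bsub>L\<^esub> coset u = coset (c \<odot>\<^bsub>Lt\<^esub> u)"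
    and "\<zero>\<^bsub>L\<^esub> = coset \<zero>\<^bsub>Lt\<^esub>"
    and "\<lbrakk>u \<in> carrier Lt; v \<in> carrier Lt\<rbrakk> \<Longrightarrow> lr_bracket L (coset u) (coset v) = coset (bracket Lt u v)"
    and "u \<in> carrier Lt \<Longrightarrow> anchor L (coset u) = d_pi Lt u"
  using canonical_quotient_epi by (simp_all add: lie_rinehart_epi_def linear_map_def)

text \<open>The Jacobi identity and the Leibniz rule of L(f^\<alpha>) are pulled back along
  \<open>\<theta>\<close> instead of being computed from the cocycle. The facts about
  \<open>d_alpha\<close> follow from the anchor being a homomorphism of Lie-Rinehart
  structures.\<close>

lemma L_ext_d_lie_algebra:
  assumes iso: "d_lie_iso k A (L_ext k A f L) Lt \<theta>"
  shows "d_lie_algebra k A f (L_ext k A f L)"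
proof (rule d_lie_algebra_pullback)
  interpret L: lie_rinehart_algebra k A L by (rule lie_rinehart_canonical_quotient)
  interpret L': module A L by (rule lie_rinehart_algebra.axioms) (rule lie_rinehart_canonical_quotient)
  show "d_lie_hom k A (L_ext k A f L) Lt \<theta>" "inj_on \<theta> (carrier (L_ext k A f L))"
    using iso by (auto simp: d_lie_iso_def bij_betw_def)
  have br: "lr_bracket L x y \<in> carrier L" if "x \<in> carrier L" "y \<in> carrier L" for x y
    using L.br_closed that by simp
  note anchor = linear_mapD [OF L.anchor_linear]
  have anchor_closed: "anchor L x a \<in> carrier A" if "x \<in> carrier L" "a \<in> carrier A" for x a
    using anchor(1) [OF that(1)] that(2) by (auto dest: derivationsD(1))
  have f_closed: "f (anchor L x) (anchor L y) \<in> carrier A" if "x \<in> carrier L" "y \<in> carrier L" for x y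
    using two_cocycles_closed [OF cocycle] that anchor(1) by (simp add: Der_lie_rinehart_def)
  show "bracket (L_ext k A f L) x y \<in> carrier (L_ext k A f L)"
    if "x \<in> carrier (L_ext k A f L)" "y \<in> carrier (L_ext k A f L)" for x y
    using that by (auto simp: br anchor_closed f_closed)
  show "d_center (L_ext k A f L) \<in> carrier (L_ext k A f L)"
    by simp
  show "bimodule_map A (L_ext k A f L) (D1 k A f) (d_alpha (L_ext k A f L))"
    unfolding bimodule_map_def using anchor
    by (auto intro!: linear_mapI simp: prod_eq_iff)
  show "d_alpha (L_ext k A f L) (bracket (L_ext k A f L) x y) =
      bracket (D1 k A f) (d_alpha (L_ext k A f L) x) (d_alpha (L_ext k A f L) y)"
    if "x \<in> carrier (L_ext k A f L)" "y \<in> carrier (L_ext k A f L)" for x y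
    using that L.anchor_lie_hom by (auto simp: prod_eq_iff lie_hom_def)
  show "d_pi (L_ext k A f L) x = snd (d_alpha (L_ext k A f L) x)"
    if "x \<in> carrier (L_ext k A f L)" for x
    using that by auto
qed

text \<open>
  If \<open>D\<close> lies over \<open>(1, 0)\<close>, every coset has exactly one representative lying over some \<open>(0, x)\<close>;
  this splits the canonical quotient.
\<close>

definition to_L_ext :: "'b \<Rightarrow> 'a \<times> 'b set" where
  "to_L_ext u = (fst (d_alpha Lt u), coset u)"

text \<open>The formulas for the right action and the bracket of L(f^\<alpha>) are the first
  components of those in \<open>D1\<close>, with the anchor of a coset in place of the derivation.
  So \<open>to_L_ext\<close> respects them for any \<open>D\<close>; the hypothesis enters for
  bijectivity and for the image of \<open>D\<close>.\<close>

lemma L_ext_iso: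
  assumes D: "d_alpha Lt (d_center Lt) = (\<one>\<^bsub>A\<^esub>, \<zero>\<^bsub>Der k A\<^esub>)"
  shows "d_lie_iso k A (L_ext k A f L) Lt (inv_into (carrier Lt) to_L_ext)"
proof (rule d_lie_iso_inverse)
  have alpha: "bimodule_map A Lt (D1 k A f) (d_alpha Lt)"
    using alpha_P_linear by (simp add: P_linear_map_iff [OF algebra])
  note lin = linear_mapD [OF bimodule_mapD(1) [OF alpha]] bimodule_mapD(2) [OF alpha]
  have A: "abelian_group A"
    using M_cring by (intro ring.is_abelian_group cring.axioms)
  define t where "t u = fst (d_alpha Lt u)" for u
  have t: "\<And>u. u \<in> carrier Lt \<Longrightarrow> t u \<in> carrier A"
    "\<And>u v. \<lbrakk>u \<in> carrier Lt; v \<in> carrier Lt\<rbrakk> \<Longrightarrow> t (u \<oplus>\<^bsub>Lt\<^esub> v) = t u \<oplus>\<^bsub>A\<^esub> t v"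
    "\<And>c u. \<lbrakk>c \<in> carrier A; u \<in> carrier Lt\<rbrakk> \<Longrightarrow> t (c \<odot>\<^bsub>Lt\<^esub> u) = c \<otimes>\<^bsub>A\<^esub> t u"
    "\<And>c u. \<lbrakk>c \<in> carrier A; u \<in> carrier Lt\<rbrakk> \<Longrightarrow> t (rsmult Lt u c) = (t u \<otimes>\<^bsub>A\<^esub> c) \<oplus>\<^bsub>A\<^esub> d_pi Lt u c"
    using lin by (auto simp: t_def pi_alpha mem_Times_iff)
  have t_br: "t (bracket Lt u v) = d_pi Lt u (t v) \<ominus>\<^bsub>A\<^esub> d_pi Lt v (t u) \<oplus>\<^bsub>A\<^esub> f (d_pi Lt u) (d_pi Lt v)"
    if "u \<in> carrier Lt" "v \<in> carrier Lt" for u v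
    using that alpha_lie_hom by (simp add: t_def lie_hom_def pi_alpha)
  have tD: "t (d_center Lt) = \<one>\<^bsub>A\<^esub>" by (simp add: t_def D)
  have to: "to_L_ext u = (t u, coset u)" for u by (simp add: to_L_ext_def t_def)
  show "bij_betw to_L_ext (carrier Lt) (carrier (L_ext k A f L))"
  proof (rule bij_betw_imageI)
    show "inj_on to_L_ext (carrier Lt)"
    proof (rule inj_onI)
      fix u v assume uv: "u \<in> carrier Lt" "v \<in> carrier Lt" "to_L_ext u = to_L_ext v"
      then obtain c where c: "c \<in> carrier A" "u = c \<odot>\<^bsub>Lt\<^esub> d_center Lt \<oplus>\<^bsub>Lt\<^esub> v"
        using coset_eq_iff by (auto simp: to)
      \<comment> \<open>Elements with equal cosets differ by some cD, and \<open>t\<close> reads off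
        the coefficient because it sends \<open>D\<close> to 1.\<close>
      then have "t v = c \<oplus>\<^bsub>A\<^esub> t v"
        using uv t center_closed by (simp add: to tD)
      then have "c = \<zero>\<^bsub>A\<^esub>"
        using c uv t group.r_cancel_one' [OF abelian_group.a_group [OF A], of "t v" c] by simp
      then show "u = v" using c uv center_closed by simp
    qed
    show "to_L_ext ` carrier Lt = carrier (L_ext k A f L)"
    proof (intro equalityI subsetI)
      fix X assume "X \<in> carrier (L_ext k A f L)"
      then obtain a u where X: "X = (a, coset u)" "a \<in> carrier A" "u \<in> carrier Lt"
        by (auto simp: carrier_canonical_quotient)
      \<comment> \<open>The representative \<open>u\<close> is corrected by the multiple of
        \<open>D\<close> that changes the value of \<open>t\<close> to \<open>a\<close>; its coset
        stays the same.\<close>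
      let ?v = "(a \<ominus>\<^bsub>A\<^esub> t u) \<odot>\<^bsub>Lt\<^esub> d_center Lt \<oplus>\<^bsub>Lt\<^esub> u"
      have v: "?v \<in> carrier Lt" using X t center_closed by simp
      have "coset ?v = coset u"
        using X t v by (subst coset_eq_iff) auto
      moreover have "t ?v = a"
        using X t center_closed by (simp add: tD abelian_group.minus_add_cancel [OF A])
      ultimately show "X \<in> to_L_ext ` carrier Lt"
        using X v by (auto simp: to intro!: image_eqI [of _ _ ?v])
    qed (auto simp: to t carrier_canonical_quotient)
  qed
  show "to_L_ext \<zero>\<^bsub>Lt\<^esub> = \<zero>\<^bsub>L_ext k A f L\<^esub>"
    using t(3) [of "\<zero>\<^bsub>A\<^esub>" "\<zero>\<^bsub>Lt\<^esub>"] t(1) by (simp add: to canonical_quotient_simps)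
  \<comment> \<open>The second component of the right action on L(f^\<alpha>) is a left multiple,
    which matches because the two actions agree modulo \<open>D\<close>.\<close>
  have "coset (rsmult Lt u c) = coset (c \<odot>\<^bsub>Lt\<^esub> u)" if "c \<in> carrier A" "u \<in> carrier Lt" for c u
    using that d_pi_closed rsmult_closed by (subst coset_eq_iff) (auto simp: rsmult_eq)
  then show "bimodule_map A Lt (L_ext k A f L) to_L_ext"
    unfolding bimodule_map_def
    by (auto intro!: linear_mapI simp: to t canonical_quotient_simps carrier_canonical_quotient)
  show "to_L_ext (bracket Lt u v) = bracket (L_ext k A f L) (to_L_ext u) (to_L_ext v)"
    if "u \<in> carrier Lt" "v \<in> carrier Lt" for u v
    using that by (simp add: to t_br canonical_quotient_simps)
  have "coset (d_center Lt) = coset \<zero>\<^bsub>Lt\<^esub>"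
    using center_closed by (subst coset_eq_iff) (auto intro!: bexI [of _ "\<one>\<^bsub>A\<^esub>"])
  then show "to_L_ext (d_center Lt) = d_center (L_ext k A f L)"
    by (simp add: to tD canonical_quotient_simps)
  show "d_pi (L_ext k A f L) (to_L_ext u) = d_pi Lt u" if "u \<in> carrier Lt" for u
    using that by (simp add: to canonical_quotient_simps)
qed

end

section \<open>The two comparisons for \<open>End\<close>\<close>

context d_lie_connection
begin

interpretation Lt: module A Lt by (rule A_module)
interpretation E: module A E by (rule E_module)
interpretation End: d_lie_algebra k A f End by (rule End_d_lie_algebra)

text \<open>Multiples of the central element move only the second component. Hence a coset in
  \<open>End\<close> amounts to an endomorphism together with a coset in \<open>Lt\<close>.\<close>

lemma End_center_shift:
  assumes "a \<in> carrier A" "p \<in> A_endos A E" "u \<in> carrier Lt"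
  shows "a \<odot>\<^bsub>End\<^esub> d_center End \<oplus>\<^bsub>End\<^esub> (p, u) = (p, a \<odot>\<^bsub>Lt\<^esub> d_center Lt \<oplus>\<^bsub>Lt\<^esub> u)"
proof -
  have "op_add E (compose (carrier E) (op_scalar E a) (op_zero E)) p = p"
    using assms by (intro extensionalityI [of _ "carrier E"]) (simp_all add: A_endosD compose_def)
  then show ?thesis by simp
qed

text \<open>Independence of the lifts is not extracted from the curvature. Changing lifts shifts
  both arguments by multiples of the central element of \<open>End\<close>, and
  \<open>bracket_shift\<close> for \<open>End\<close> says that the bracket moves by another such
  multiple, leaving its first component alone.\<close>

lemma End_lie_rinehart_epi:
  "lie_rinehart_epi A (underlying_lie_rinehart End) (End_lie_rinehart A Lt E \<rho>) (\<lambda>(p, u). (p, coset u))"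
proof -
  let ?L = "canonical_quotient A Lt"
  have "the_elem {End_bracket Lt E \<rho> p u' q v' | u' v'. u' \<in> coset u \<and> v' \<in> coset v} = End_bracket Lt E \<rho> p u q v"
    if pq: "p \<in> A_endos A E" "u \<in> carrier Lt" "q \<in> A_endos A E" "v \<in> carrier Lt" for p u q v
  proof -
    have "End_bracket Lt E \<rho> p u' q v' = End_bracket Lt E \<rho> p u q v"
      if "u' \<in> coset u" "v' \<in> coset v" for u' v'
    proof -
      from that obtain a b where ab: "a \<in> carrier A" "u' = a \<odot>\<^bsub>Lt\<^esub> d_center Lt \<oplus>\<^bsub>Lt\<^esub> u"
        "b \<in> carrier A" "v' = b \<odot>\<^bsub>Lt\<^esub> d_center Lt \<oplus>\<^bsub>Lt\<^esub> v"
        by (auto simp: coset_mem_iff)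
      have "bracket End (p, u') (q, v') = bracket End (a \<odot>\<^bsub>End\<^esub> d_center End \<oplus>\<^bsub>End\<^esub> (p, u))
          (b \<odot>\<^bsub>End\<^esub> d_center End \<oplus>\<^bsub>End\<^esub> (q, v))"
        using ab pq by (simp only: End_center_shift)
      also have "\<dots> = (d_pi End (p, u) b \<ominus>\<^bsub>A\<^esub> d_pi End (q, v) a) \<odot>\<^bsub>End\<^esub> d_center End \<oplus>\<^bsub>End\<^esub> bracket End (p, u) (q, v)"
        using ab pq by (intro End.bracket_shift) simp_all
      also have "\<dots> = (End_bracket Lt E \<rho> p u q v,
          (d_pi End (p, u) b \<ominus>\<^bsub>A\<^esub> d_pi End (q, v) a) \<odot>\<^bsub>Lt\<^esub> d_center Lt \<oplus>\<^bsub>Lt\<^esub> bracket Lt u v)"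
        using ab pq End_bracket_closed [of "(p, u)" "(q, v)"] d_pi_closed
        unfolding End_simps(6) by (intro End_center_shift) auto
      finally show ?thesis by simp
    qed
    then have "{End_bracket Lt E \<rho> p u' q v' | u' v'. u' \<in> coset u \<and> v' \<in> coset v} = {End_bracket Lt E \<rho> p u q v}"
      using coset_self [OF pq(2)] coset_self [OF pq(4)] by blast
    then show ?thesis by simp
  qed
  then show ?thesis
    unfolding lie_rinehart_epi_def
    by (auto simp: End_lie_rinehart_def Let_def canonical_quotient_simps carrier_canonical_quotient
        image_iff intro!: linear_mapI)
qed

lemma End_canonical_quotient:
  "lie_rinehart_isomorphic k A (canonical_quotient A End) (End_lie_rinehart A Lt E \<rho>)"
proof (rule lie_rinehart_epi_isomorphic [OF End.lie_rinehart_underlying End.canonical_quotient_epi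
      End_lie_rinehart_epi])
  fix x y assume "x \<in> carrier (underlying_lie_rinehart End)" "y \<in> carrier (underlying_lie_rinehart End)"
  then obtain p u q v where xy: "x = (p, u)" "p \<in> A_endos A E" "u \<in> carrier Lt"
    "y = (q, v)" "q \<in> A_endos A E" "v \<in> carrier Lt"
    by auto
  then have "End.coset x = End.coset y \<longleftrightarrow> (\<exists>a \<in> carrier A. x = a \<odot>\<^bsub>End\<^esub> d_center End \<oplus>\<^bsub>End\<^esub> y)"
    by (intro End.coset_eq_iff) simp_all
  also have "\<dots> \<longleftrightarrow> p = q \<and> (\<exists>a \<in> carrier A. u = a \<odot>\<^bsub>Lt\<^esub> d_center Lt \<oplus>\<^bsub>Lt\<^esub> v)"
    unfolding xy(1,4) using xy(5,6) by (auto simp: End_center_shift simp del: End_simps)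
  also have "\<dots> \<longleftrightarrow> (\<lambda>(p, u). (p, coset u)) x = (\<lambda>(p, u). (p, coset u)) y"
    using xy by (simp add: coset_eq_iff)
  finally show "End.coset x = End.coset y \<longleftrightarrow> (\<lambda>(p, u). (p, coset u)) x = (\<lambda>(p, u). (p, coset u)) y" .
qed

text \<open>The connection on L(f^\<alpha>) is the pullback of \<open>\<rho>\<close>, so its
  curvature is the pullback of the curvature, and the identity on endomorphisms paired with
  \<open>\<theta>\<close> preserves the bracket.\<close>

lemma End_L_ext_isomorphic:
  assumes iso: "d_lie_iso k A (L_ext k A f (canonical_quotient A Lt)) Lt \<theta>"
  shows "d_lie_isomorphic k A f End (End_d_lie A (L_ext k A f (canonical_quotient A Lt)) E (\<rho> \<circ> \<theta>))"
proof -
  let ?M = "L_ext k A f (canonical_quotient A Lt)"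
  have hom: "d_lie_hom k A ?M Lt \<theta>" and bij: "bij_betw \<theta> (carrier ?M) (carrier Lt)"
    using iso by (auto simp: d_lie_iso_def)
  then have M: "P_module k A ?M" and bim: "bimodule_map A ?M Lt \<theta>"
    and h_br: "\<And>x y. \<lbrakk>x \<in> carrier ?M; y \<in> carrier ?M\<rbrakk> \<Longrightarrow> \<theta> (bracket ?M x y) = bracket Lt (\<theta> x) (\<theta> y)"
    and h_center: "\<theta> (d_center ?M) = d_center Lt"
    and h_pi: "\<And>x. x \<in> carrier ?M \<Longrightarrow> d_pi ?M x = d_pi Lt (\<theta> x)"
    by (simp_all add: d_lie_hom_def lie_hom_def P_linear_map_iff [OF algebra] del: L_ext_simps)
  note h = linear_mapD [OF bimodule_mapD(1) [OF bim]] bimodule_mapD(2) [OF bim]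
  interpret M: d_lie_algebra k A f ?M
    using iso by (rule L_ext_d_lie_algebra)
  have "bimodule_map A ?M (Diff1 k A E) (\<rho> \<circ> \<theta>)"
    unfolding bimodule_map_def
    using linear_mapD [OF bimodule_mapD(1) [OF rho_bimodule_map]] bimodule_mapD(2) [OF rho_bimodule_map] h
    by (auto intro!: linear_mapI simp del: L_ext_simps)
  then have "connection k A ?M E (\<rho> \<circ> \<theta>)"
    using M E_module Diff1_P_module by (simp add: connection_def P_linear_map_iff [OF algebra])
  then interpret M: d_lie_connection k A f ?M E "\<rho> \<circ> \<theta>"
    using h_center rho_center by unfold_locales simp_all
  interpret M_End: d_lie_algebra k A f M.End by (rule M.End_d_lie_algebra)
  let ?h = "\<lambda>(p, x). (p, \<theta> x)"
  \<comment> \<open>The natural map runs from the algebra over L(f^\<alpha>) to \<open>End\<close>;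
    its inverse has the direction asked for.\<close>
  have "d_lie_iso k A End M.End (inv_into (carrier M.End) ?h)"
  proof (rule M_End.d_lie_iso_inverse)
    show "bij_betw ?h (carrier M.End) (carrier End)"
      using bij_betw_map_prod [OF bij_betw_id [of "A_endos A E"] bij]
      by (simp add: map_prod_def id_def)
    show "bimodule_map A M.End End ?h"
      unfolding bimodule_map_def using h by (auto intro!: linear_mapI simp del: L_ext_simps)
    have "\<theta> \<zero>\<^bsub>?M\<^esub> = \<zero>\<^bsub>Lt\<^esub>"
      using M.A_module A_module bimodule_mapD(1) [OF bim] by (rule linear_map_zero)
    then show "?h \<zero>\<^bsub>M.End\<^esub> = \<zero>\<^bsub>End\<^esub>"
      by (simp del: L_ext_simps)
    show "?h (bracket M.End x y) = bracket End (?h x) (?h y)"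
      if "x \<in> carrier M.End" "y \<in> carrier M.End" for x y
      using that by (auto simp: End_bracket_def curvature_def h_br simp del: L_ext_simps)
    show "?h (d_center M.End) = d_center End"
      using h_center by (simp del: L_ext_simps)
    show "d_pi End (?h x) = d_pi M.End x" if "x \<in> carrier M.End" for x
      using that by (auto simp: h_pi simp del: L_ext_simps)
  qed
  then show ?thesis
    unfolding d_lie_isomorphic_def using End_d_lie_algebra M.End_d_lie_algebra by blast
qed

end

text \<open>The isomorphism \<open>\<theta>\<close> that makes \<open>E\<close> a connection over
  L(f^\<alpha>) is a parameter, and the comparison holds for each choice. The last clause supplies
  one when \<open>d_alpha\<close> takes at \<open>D\<close> the value that it takes at the central
  element of L(f^\<alpha>).\<close>

theorem corollary4p20:
  fixes k :: "'k ring" and A :: "('k, 'a) module"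
    and f :: "('a \<Rightarrow> 'a) \<Rightarrow> ('a \<Rightarrow> 'a) \<Rightarrow> 'a"
    and Lt :: "('a, 'l) d_lie"
    and E :: "('a, 'e) module" and \<rho> :: "'l \<Rightarrow> 'e \<Rightarrow> 'e"
  assumes "algebra k A"
    and "f \<in> two_cocycles A (Der_lie_rinehart k A)"
    and "d_lie_algebra k A f Lt"
    and "connection k A Lt E \<rho>"
    and "\<rho> (d_center Lt) = op_id E"
  shows "lie_rinehart_isomorphic k A
           (canonical_quotient A (End_d_lie A Lt E \<rho>)) (End_lie_rinehart A Lt E \<rho>) \<and>
         (projective_module A (canonical_quotient A Lt) \<longrightarrow>
           (\<forall>\<theta>. d_lie_iso k A (L_ext k A f (canonical_quotient A Lt)) Lt \<theta> \<longrightarrow>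
              d_lie_isomorphic k A f (End_d_lie A Lt E \<rho>)
                (End_d_lie A (L_ext k A f (canonical_quotient A Lt)) E (\<rho> \<circ> \<theta>))) \<and>
           (d_alpha Lt (d_center Lt) = (\<one>\<^bsub>A\<^esub>, \<zero>\<^bsub>Der k A\<^esub>) \<longrightarrow>
              (\<exists>\<theta>. d_lie_iso k A (L_ext k A f (canonical_quotient A Lt)) Lt \<theta>)))"
proof -
  interpret d_lie_connection k A f Lt E \<rho>
    using assms by (intro d_lie_connection.intro d_lie_connection_axioms.intro)
  show ?thesis
    using End_canonical_quotient End_L_ext_isomorphic L_ext_iso by blast
qed

end
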